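(* (Provable in $\mathbf{HA}^\omega+\mathbf{AC}_0$.) Let $\tau=\mathbb N$, let $\sigma$ be an arbitrary fixed finite type, and let $t\colon\mathbb N$ be a term of system $\mathsf T$ whose only free variable is $\alpha\colon\mathbb N\to\tau$. Let $t^\circ=\langle\mathrm{Val}_{t^\circ};\mathsf B_{t^\circ}\rangle$ be the translation of $t$ defined in the context. Then there exists a bar $S$ which secures $\lambda\alpha.t$ such that $\mathcal{GBR}_S(\mathsf B_{t^\circ})$ holds, i.e. for all $G\colon\tau^*\to\sigma$, $H\colon\tau^*\to(\tau\to\sigma)\to\sigma$ and $s\colon\tau^*$, $$S(s)\ \to\ \mathsf B_{t^\circ}(G,H)(s)=G(s),\qquad \neg S(s)\ \to\ \mathsf B_{t^\circ}(G,H)(s)=H(s)(\lambda x^\tau.\,\mathsf B_{t^\circ}(G,H)(s*x)).$$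
   Context: Finite types: $\mathbb N$ is a finite type, and if $\tau_0,\tau_1$ are finite types then so are $\tau_0\to\tau_1$ (also written $\tau_1^{\tau_0}$) and $\tau_0^*$ (finite sequences); finite products $\tau\times\sigma$, with pairs $\langle s;t\rangle$, are used as a definitional extension. System $\mathsf T$ is the simply typed $\lambda$-calculus with $0$, $\mathsf{Succ}$ and recursors $\mathsf{Rec}^\rho$ for every finite type $\rho$, with $\mathsf{Rec}^\rho(a,f)(0)=a$, $\mathsf{Rec}^\rho(a,f)(\mathsf{Succ}(m))=f(m,\mathsf{Rec}^\rho(a,f)(m))$. $\mathbf{HA}^\omega$ is intuitionistic Heyting arithmetic in all finite types; $\mathbf{AC}_0$ is countable choice. Notation: $|s|$ is the length of $s\colon\tau^*$; $s*x$ is $s$ with $x\colon\tau$ appended; $s*t$ and $s*\beta$ denote concatenation of $s$ with a finite sequence $t$ or infinite sequence $\beta\colon\tau^{\mathbb N}$; $\hat s\colon\mathbb N\to\tau$ extends $s$ by infinitely many zero objects $0^\tau$; $\bar\alpha n=\langle\alpha(0),\dots,\alpha(n-1)\rangle$. Bars: a predicate $S(s^{\tau^*})$ is a bar if it is (i) decidable: $\forall s(S(s)\vee\neg S(s))$; (ii) $\forall\alpha^{\tau^{\mathbb N}}\exists n^{\mathbb N}S(\bar\alpha n)$; (iii) monotone: $\forall s,t\,(S(s)\to S(s*t))$. A bar $S$ secures $Y\colon\tau^{\mathbb N}\to\mathbb N$ if for all $s^{\tau^*}$, $S(s)$ implies that $\lambda\beta.Y(s*\beta)$ is constant. The term $\Psi$.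 Define by primitive recursion $\varphi(G,H)(0)=G$ and, for $n>0$, $\varphi(G,H)(n)=\lambda s^{\tau^*}.H(s)(\lambda x^\tau.\varphi(G,H)(n-1)(s*x))$. For $k\colon\mathbb N$ put $\Psi(k)(G,H)(s)=G(s)$ if $|s|>k$, and $\Psi(k)(G,H)(s)=\varphi(G,H)(k+1-|s|)(s)$ if $|s|\le k$. Translation of types (built from $\mathbb N$ and $\to$): $\mathbb N^\circ=(\tau^{\mathbb N}\to\mathbb N)\times\big((\tau^*\to\sigma)\to(\tau^*\to(\tau\to\sigma)\to\sigma)\to\tau^*\to\sigma\big)$ and $(\rho_0\to\rho_1)^\circ=\rho_0^\circ\to\rho_1^\circ$. For $u\colon\mathbb N^\circ$ write $u=\langle\mathrm{Val}_u;\mathsf B_u\rangle$. Translation of terms ($\tau=\mathbb N$). The term $t$ and its subterms have types built from $\mathbb N$ and $\to$. $\alpha$ is a special variable of type $\mathbb N\to\mathbb N$ (not treated as an ordinary variable); each ordinary variable $x\colon\eta$ is mapped to a variable $x^\circ\colon\eta^\circ$. A term $t\colon\rho$ is translated to $t^\circ\colon\rho^\circ$ by: - $0^\circ=\langle\lambda\alpha.0;\ \lambda G,H.G\rangle$; - $\mathsf{Succ}^\circ=\lambda x^{\mathbb N^\circ}.\langle\lambda\alpha.\mathsf{Succ}(\mathrm{Val}_x(\alpha));\ \mathsf B_x\rangle$; - $\alpha^\circ=\lambda x^{\mathbb N^\circ}.\langle\lambda\alpha.\alpha(\mathrm{Val}_x(\alpha));\ \lambda G,H.\,\mathsf B_x(\lambda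 s'.\Psi(\mathrm{Val}_x(\widehat{s'}))(G,H)(s'),H)\rangle$; - $(x^\eta)^\circ=x^\circ$; $(\lambda x^\eta.t)^\circ=\lambda x^\circ.t^\circ$; $(uv)^\circ=u^\circ v^\circ$; - for $\eta=\rho\to\mathbb N$ (with $\rho$ standing for a tuple of argument types when there are several, $v$ then being the corresponding tuple of variables, and with $\rho$ and $v$ omitted if $\eta=\mathbb N$): $(\mathsf{Rec}^\eta)^\circ=\lambda a^{\eta^\circ},F^{\mathbb N^\circ\to\eta^\circ\to\eta^\circ},x^{\mathbb N^\circ},v^{\rho^\circ}.\langle\lambda\alpha.\mathrm{Val}_{r[\mathrm{Val}_x(\alpha)]}(\alpha);\ \mathsf B\rangle$, where $r[n]=\mathsf{Rec}^{\eta^\circ}(a,\lambda k^{\mathbb N}.F(k^\circ))(n)(v)$, $k^\circ=\langle\lambda\alpha.k;\lambda G,H.G\rangle$ and $\mathsf B(G,H)(s)=\mathsf B_x(\lambda s'.\mathsf B_{r[\mathrm{Val}_x(\widehat{s'})]}(G,H)(s'),H)(s)$. *)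

theory Defs
  imports Main
begin

section \<open>Finite types and terms\<close>

datatype ty = N | Fn ty ty (infixr "\<rightarrow>" 65) | Seq ty | Prod ty ty

text \<open>
  Finite sequences are handled by a recursor over sequences, and pairs by surjective pairing; both
  are conservative over the recursors on numbers. All other operations on sequences are
  defined from \<open>SeqRec\<close> and \<open>Rec\<close> below.
\<close>

datatype const =
    Zero | Succ | Rec ty
  | Empty ty | Snoc ty | SeqRec ty ty
  | MkPair ty ty | Fst ty ty | Snd ty ty

primrec cty :: "const \<Rightarrow> ty" where
  "cty Zero = N"
| "cty Succ = N \<rightarrow> N"
| "cty (Rec \<rho>) = \<rho> \<rightarrow> (N \<rightarrow> \<rho> \<rightarrow> \<rho>) \<rightarrow> N \<rightarrow> \<rho>"
| "cty (Empty \<tau>) = Seq \<tau>"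
| "cty (Snoc \<tau>) = Seq \<tau> \<rightarrow> \<tau> \<rightarrow> Seq \<tau>"
| "cty (SeqRec \<tau> \<rho>) = \<rho> \<rightarrow> (Seq \<tau> \<rightarrow> \<tau> \<rightarrow> \<rho> \<rightarrow> \<rho>) \<rightarrow> Seq \<tau> \<rightarrow> \<rho>"
| "cty (MkPair \<tau> \<rho>) = \<tau> \<rightarrow> \<rho> \<rightarrow> Prod \<tau> \<rho>"
| "cty (Fst \<tau> \<rho>) = Prod \<tau> \<rho> \<rightarrow> \<tau>"
| "cty (Snd \<tau> \<rho>) = Prod \<tau> \<rho> \<rightarrow> \<rho>"

text \<open>
  Terms are locally nameless: free variables are named and carry their type, bound variables
  are de Bruijn indices, so that alpha-equivalent terms are equal. Concrete terms are written
  with \<open>lam x t\<close>, which abstracts the named variable \<open>x\<close>.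
\<close>

type_synonym var = "string \<times> ty"

datatype tm = Free var | Bound nat | Cn const | App tm tm (infixl "\<cdot>" 90) | Lam ty tm

primrec has_type :: "ty list \<Rightarrow> tm \<Rightarrow> ty \<Rightarrow> bool" where
  "has_type \<Delta> (Free x) \<rho> \<longleftrightarrow> \<rho> = snd x"
| "has_type \<Delta> (Bound i) \<rho> \<longleftrightarrow> i < length \<Delta> \<and> \<rho> = \<Delta> ! i"
| "has_type \<Delta> (Cn c) \<rho> \<longleftrightarrow> \<rho> = cty c"
| "has_type \<Delta> (t \<cdot> u) \<rho> \<longleftrightarrow> (\<exists>\<pi>. has_type \<Delta> t (\<pi> \<rightarrow> \<rho>) \<and> has_type \<Delta> u \<pi>)"
| "has_type \<Delta> (Lam \<pi> t) \<rho> \<longleftrightarrow> (\<exists>\<kappa>. \<rho> = \<pi> \<rightarrow> \<kappa> \<and> has_type (\<pi> # \<Delta>) t \<kappa>)"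

abbreviation typed :: "tm \<Rightarrow> ty \<Rightarrow> bool" (infix "\<Colon>" 50) where
  "t \<Colon> \<rho> \<equiv> has_type [] t \<rho>"

primrec fv :: "tm \<Rightarrow> var set" where
  "fv (Free x) = {x}"
| "fv (Bound i) = {}"
| "fv (Cn c) = {}"
| "fv (t \<cdot> u) = fv t \<union> fv u"
| "fv (Lam \<pi> t) = fv t"

primrec subst :: "var \<Rightarrow> tm \<Rightarrow> tm \<Rightarrow> tm" where
  "subst x u (Free y) = (if y = x then u else Free y)"
| "subst x u (Bound i) = Bound i"
| "subst x u (Cn c) = Cn c"
| "subst x u (t \<cdot> t') = subst x u t \<cdot> subst x u t'"
| "subst x u (Lam \<pi> t) = Lam \<pi> (subst x u t)"

primrec bind :: "nat \<Rightarrow> var \<Rightarrow> tm \<Rightarrow> tm" where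
  "bind k x (Free y) = (if y = x then Bound k else Free y)"
| "bind k x (Bound i) = Bound i"
| "bind k x (Cn c) = Cn c"
| "bind k x (t \<cdot> u) = bind k x t \<cdot> bind k x u"
| "bind k x (Lam \<pi> t) = Lam \<pi> (bind (Suc k) x t)"

definition lam :: "var \<Rightarrow> tm \<Rightarrow> tm" where
  "lam x t = Lam (snd x) (bind 0 x t)"

definition lams :: "var list \<Rightarrow> tm \<Rightarrow> tm" where
  "lams xs t = foldr lam xs t"

definition apps :: "tm \<Rightarrow> tm list \<Rightarrow> tm" where
  "apps t us = foldl App t us"


section \<open>Formulas and the system HA\<open>\<^sup>\<omega>\<close> + AC\<open>\<^sub>0\<close>\<close>

datatype fm =
    Eq tm tm (infix "\<doteq>" 60)
  | Bot
  | Conj fm fm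
  | Disj fm fm
  | Imp fm fm
  | All ty fm
  | Ex ty fm

abbreviation Neg :: "fm \<Rightarrow> fm" where
  "Neg A \<equiv> Imp A Bot"

primrec wff_in :: "ty list \<Rightarrow> fm \<Rightarrow> bool" where
  "wff_in \<Delta> (t \<doteq> u) \<longleftrightarrow> (\<exists>\<rho>. has_type \<Delta> t \<rho> \<and> has_type \<Delta> u \<rho>)"
| "wff_in \<Delta> Bot \<longleftrightarrow> True"
| "wff_in \<Delta> (Conj A B) \<longleftrightarrow> wff_in \<Delta> A \<and> wff_in \<Delta> B"
| "wff_in \<Delta> (Disj A B) \<longleftrightarrow> wff_in \<Delta> A \<and> wff_in \<Delta> B"
| "wff_in \<Delta> (Imp A B) \<longleftrightarrow> wff_in \<Delta> A \<and> wff_in \<Delta> B"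
| "wff_in \<Delta> (All \<pi> A) \<longleftrightarrow> wff_in (\<pi> # \<Delta>) A"
| "wff_in \<Delta> (Ex \<pi> A) \<longleftrightarrow> wff_in (\<pi> # \<Delta>) A"

abbreviation wff :: "fm \<Rightarrow> bool" where
  "wff A \<equiv> wff_in [] A"

primrec ffv :: "fm \<Rightarrow> var set" where
  "ffv (t \<doteq> u) = fv t \<union> fv u"
| "ffv Bot = {}"
| "ffv (Conj A B) = ffv A \<union> ffv B"
| "ffv (Disj A B) = ffv A \<union> ffv B"
| "ffv (Imp A B) = ffv A \<union> ffv B"
| "ffv (All \<pi> A) = ffv A"
| "ffv (Ex \<pi> A) = ffv A"

primrec fsubst :: "var \<Rightarrow> tm \<Rightarrow> fm \<Rightarrow> fm" where
  "fsubst x s (t \<doteq> u) = (subst x s t \<doteq> subst x s u)"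
| "fsubst x s Bot = Bot"
| "fsubst x s (Conj A B) = Conj (fsubst x s A) (fsubst x s B)"
| "fsubst x s (Disj A B) = Disj (fsubst x s A) (fsubst x s B)"
| "fsubst x s (Imp A B) = Imp (fsubst x s A) (fsubst x s B)"
| "fsubst x s (All \<pi> A) = All \<pi> (fsubst x s A)"
| "fsubst x s (Ex \<pi> A) = Ex \<pi> (fsubst x s A)"

primrec fbind :: "nat \<Rightarrow> var \<Rightarrow> fm \<Rightarrow> fm" where
  "fbind k x (t \<doteq> u) = (bind k x t \<doteq> bind k x u)"
| "fbind k x Bot = Bot"
| "fbind k x (Conj A B) = Conj (fbind k x A) (fbind k x B)"
| "fbind k x (Disj A B) = Disj (fbind k x A) (fbind k x B)"
| "fbind k x (Imp A B) = Imp (fbind k x A) (fbind k x B)"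
| "fbind k x (All \<pi> A) = All \<pi> (fbind (Suc k) x A)"
| "fbind k x (Ex \<pi> A) = Ex \<pi> (fbind (Suc k) x A)"

definition all :: "var \<Rightarrow> fm \<Rightarrow> fm" where
  "all x A = All (snd x) (fbind 0 x A)"

definition ex :: "var \<Rightarrow> fm \<Rightarrow> fm" where
  "ex x A = Ex (snd x) (fbind 0 x A)"

text \<open>
  Natural deduction for intuitionistic arithmetic in all finite types with countable choice.
  Equality is available at every type and is extensional. There is no rule giving excluded
  middle or double negation elimination.
\<close>

inductive deriv :: "fm set \<Rightarrow> fm \<Rightarrow> bool" (infix "\<turnstile>" 40) where
  Assm: "A \<in> \<Gamma> \<Longrightarrow> \<Gamma> \<turnstile> A"
| BotE: "\<Gamma> \<turnstile> Bot \<Longrightarrow> wff A \<Longrightarrow> \<Gamma> \<turnstile> A"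
| ConjI: "\<Gamma> \<turnstile> A \<Longrightarrow> \<Gamma> \<turnstile> B \<Longrightarrow> \<Gamma> \<turnstile> Conj A B"
| ConjE1: "\<Gamma> \<turnstile> Conj A B \<Longrightarrow> \<Gamma> \<turnstile> A"
| ConjE2: "\<Gamma> \<turnstile> Conj A B \<Longrightarrow> \<Gamma> \<turnstile> B"
| DisjI1: "\<Gamma> \<turnstile> A \<Longrightarrow> wff B \<Longrightarrow> \<Gamma> \<turnstile> Disj A B"
| DisjI2: "\<Gamma> \<turnstile> B \<Longrightarrow> wff A \<Longrightarrow> \<Gamma> \<turnstile> Disj A B"
| DisjE: "\<Gamma> \<turnstile> Disj A B \<Longrightarrow> insert A \<Gamma> \<turnstile> C \<Longrightarrow> insert B \<Gamma> \<turnstile> C \<Longrightarrow> \<Gamma> \<turnstile> C"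
| ImpI: "wff A \<Longrightarrow> insert A \<Gamma> \<turnstile> B \<Longrightarrow> \<Gamma> \<turnstile> Imp A B"
| ImpE: "\<Gamma> \<turnstile> Imp A B \<Longrightarrow> \<Gamma> \<turnstile> A \<Longrightarrow> \<Gamma> \<turnstile> B"
| AllI: "\<Gamma> \<turnstile> A \<Longrightarrow> x \<notin> \<Union> (ffv ` \<Gamma>) \<Longrightarrow> \<Gamma> \<turnstile> all x A"
| AllE: "\<Gamma> \<turnstile> all x A \<Longrightarrow> t \<Colon> snd x \<Longrightarrow> wff A \<Longrightarrow> \<Gamma> \<turnstile> fsubst x t A"
| ExI: "\<Gamma> \<turnstile> fsubst x t A \<Longrightarrow> t \<Colon> snd x \<Longrightarrow> wff A \<Longrightarrow> \<Gamma> \<turnstile> ex x A"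
| ExE: "\<Gamma> \<turnstile> ex x A \<Longrightarrow> insert A \<Gamma> \<turnstile> C \<Longrightarrow> wff A \<Longrightarrow> x \<notin> \<Union> (ffv ` \<Gamma>) \<union> ffv C \<Longrightarrow> \<Gamma> \<turnstile> C"
| Refl: "t \<Colon> \<rho> \<Longrightarrow> \<Gamma> \<turnstile> t \<doteq> t"
| Leibniz: "\<Gamma> \<turnstile> t \<doteq> u \<Longrightarrow> t \<Colon> snd x \<Longrightarrow> u \<Colon> snd x \<Longrightarrow> wff A \<Longrightarrow>
    \<Gamma> \<turnstile> fsubst x t A \<Longrightarrow> \<Gamma> \<turnstile> fsubst x u A"
| Beta: "t \<Colon> \<rho> \<Longrightarrow> u \<Colon> snd x \<Longrightarrow> \<Gamma> \<turnstile> lam x t \<cdot> u \<doteq> subst x u t"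
| Extensionality: "f \<Colon> snd x \<rightarrow> \<rho> \<Longrightarrow> g \<Colon> snd x \<rightarrow> \<rho> \<Longrightarrow> x \<notin> fv f \<union> fv g \<Longrightarrow>
    \<Gamma> \<turnstile> all x (f \<cdot> Free x \<doteq> g \<cdot> Free x) \<Longrightarrow> \<Gamma> \<turnstile> f \<doteq> g"
| Succ_not_Zero: "t \<Colon> N \<Longrightarrow> \<Gamma> \<turnstile> Neg (Cn Succ \<cdot> t \<doteq> Cn Zero)"
| Succ_inject: "t \<Colon> N \<Longrightarrow> u \<Colon> N \<Longrightarrow> \<Gamma> \<turnstile> Imp (Cn Succ \<cdot> t \<doteq> Cn Succ \<cdot> u) (t \<doteq> u)"
| Induction: "snd n = N \<Longrightarrow> wff A \<Longrightarrow> \<Gamma> \<turnstile> fsubst n (Cn Zero) A \<Longrightarrow>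
    \<Gamma> \<turnstile> all n (Imp A (fsubst n (Cn Succ \<cdot> Free n) A)) \<Longrightarrow> \<Gamma> \<turnstile> all n A"
| Rec_Zero: "a \<Colon> \<rho> \<Longrightarrow> f \<Colon> N \<rightarrow> \<rho> \<rightarrow> \<rho> \<Longrightarrow> \<Gamma> \<turnstile> Cn (Rec \<rho>) \<cdot> a \<cdot> f \<cdot> Cn Zero \<doteq> a"
| Rec_Succ: "a \<Colon> \<rho> \<Longrightarrow> f \<Colon> N \<rightarrow> \<rho> \<rightarrow> \<rho> \<Longrightarrow> m \<Colon> N \<Longrightarrow>
    \<Gamma> \<turnstile> Cn (Rec \<rho>) \<cdot> a \<cdot> f \<cdot> (Cn Succ \<cdot> m) \<doteq> f \<cdot> m \<cdot> (Cn (Rec \<rho>) \<cdot> a \<cdot> f \<cdot> m)"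
| Seq_Induction: "snd s = Seq (snd x) \<Longrightarrow> x \<notin> ffv A \<Longrightarrow> wff A \<Longrightarrow>
    \<Gamma> \<turnstile> fsubst s (Cn (Empty (snd x))) A \<Longrightarrow>
    \<Gamma> \<turnstile> all s (all x (Imp A (fsubst s (Cn (Snoc (snd x)) \<cdot> Free s \<cdot> Free x) A))) \<Longrightarrow>
    \<Gamma> \<turnstile> all s A"
| SeqRec_Empty: "a \<Colon> \<rho> \<Longrightarrow> f \<Colon> Seq \<tau> \<rightarrow> \<tau> \<rightarrow> \<rho> \<rightarrow> \<rho> \<Longrightarrow>
    \<Gamma> \<turnstile> Cn (SeqRec \<tau> \<rho>) \<cdot> a \<cdot> f \<cdot> Cn (Empty \<tau>) \<doteq> a"
| SeqRec_Snoc: "a \<Colon> \<rho> \<Longrightarrow> f \<Colon> Seq \<tau> \<rightarrow> \<tau> \<rightarrow> \<rho> \<rightarrow> \<rho> \<Longrightarrow> s \<Colon> Seq \<tau> \<Longrightarrow> b \<Colon> \<tau> \<Longrightarrow>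
    \<Gamma> \<turnstile> Cn (SeqRec \<tau> \<rho>) \<cdot> a \<cdot> f \<cdot> (Cn (Snoc \<tau>) \<cdot> s \<cdot> b)
      \<doteq> f \<cdot> s \<cdot> b \<cdot> (Cn (SeqRec \<tau> \<rho>) \<cdot> a \<cdot> f \<cdot> s)"
| Fst_Pair: "t \<Colon> \<tau> \<Longrightarrow> u \<Colon> \<rho> \<Longrightarrow> \<Gamma> \<turnstile> Cn (Fst \<tau> \<rho>) \<cdot> (Cn (MkPair \<tau> \<rho>) \<cdot> t \<cdot> u) \<doteq> t"
| Snd_Pair: "t \<Colon> \<tau> \<Longrightarrow> u \<Colon> \<rho> \<Longrightarrow> \<Gamma> \<turnstile> Cn (Snd \<tau> \<rho>) \<cdot> (Cn (MkPair \<tau> \<rho>) \<cdot> t \<cdot> u) \<doteq> u"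
| Surj_Pair: "t \<Colon> Prod \<tau> \<rho> \<Longrightarrow>
    \<Gamma> \<turnstile> Cn (MkPair \<tau> \<rho>) \<cdot> (Cn (Fst \<tau> \<rho>) \<cdot> t) \<cdot> (Cn (Snd \<tau> \<rho>) \<cdot> t) \<doteq> t"
| AC0: "snd n = N \<Longrightarrow> snd f = N \<rightarrow> snd x \<Longrightarrow> n \<noteq> x \<Longrightarrow> f \<notin> ffv A \<Longrightarrow> wff A \<Longrightarrow>
    \<Gamma> \<turnstile> Imp (all n (ex x A)) (ex f (all n (fsubst x (Free f \<cdot> Free n) A)))"


section \<open>Sequences of numbers, bars and bar recursion\<close>

text \<open>
  The terms in this section are closed, hence can be plugged under binders without renaming.
  Throughout, \<open>\<tau> = N\<close>, and \<open>\<sigma>\<close> is the result type of bar recursion.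
\<close>

definition snoc :: tm where
  "snoc = Cn (Snoc N)"

definition len :: tm where
  "len = (let s = (''s'', Seq N); x = (''x'', N); n = (''n'', N) in
     Cn (SeqRec N N) \<cdot> Cn Zero \<cdot> lam s (lam x (lam n (Cn Succ \<cdot> Free n))))"

text \<open>\<open>s * t\<close>, by \<open>s * \<langle>\<rangle> = s\<close> and \<open>s * (t * x) = (s * t) * x\<close>.\<close>

definition append :: tm where
  "append = (let s = (''s'', Seq N); t = (''t'', Seq N); x = (''x'', N); r = (''r'', Seq N) in
     lam s (Cn (SeqRec N (Seq N)) \<cdot> Free s \<cdot> lam t (lam x (lam r (snoc \<cdot> Free r \<cdot> Free x)))))"

text \<open>\<open>s * \<beta>\<close> for an infinite \<open>\<beta>\<close>, by \<open>\<langle>\<rangle> * \<beta> = \<beta>\<close> and \<open>(s * x) * \<beta> = s * (x, \<beta>(0), \<beta>(1), \<dots>)\<close>.\<close>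

definition prepend :: tm where
  "prepend = (let s = (''s'', Seq N); x = (''x'', N); \<beta> = (''b'', N \<rightarrow> N);
       r = (''r'', (N \<rightarrow> N) \<rightarrow> N \<rightarrow> N); m = (''m'', N); p = (''p'', N) in
     Cn (SeqRec N ((N \<rightarrow> N) \<rightarrow> N \<rightarrow> N)) \<cdot> lam \<beta> (Free \<beta>) \<cdot>
       lam s (lam x (lam r (lam \<beta> (Free r \<cdot>
         (Cn (Rec N) \<cdot> Free x \<cdot> lam m (lam p (Free \<beta> \<cdot> Free m))))))))"

definition hat :: tm where
  "hat = (let s = (''s'', Seq N); m = (''m'', N) in
     lam s (prepend \<cdot> Free s \<cdot> lam m (Cn Zero)))"

definition initial :: tm where
  "initial = (let \<alpha> = (''a'', N \<rightarrow> N); m = (''m'', N); r = (''r'', Seq N) in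
     lam \<alpha> (Cn (Rec (Seq N)) \<cdot> Cn (Empty N) \<cdot>
       lam m (lam r (snoc \<cdot> Free r \<cdot> (Free \<alpha> \<cdot> Free m)))))"

text \<open>
  A predicate on finite sequences is a formula in which the variable \<open>seqv\<close> marks the argument.
\<close>

definition seqv :: var where
  "seqv = (''s'', Seq N)"

definition bar :: "fm \<Rightarrow> fm" where
  "bar S = (let s = seqv; t = (''t'', Seq N); \<alpha> = (''a'', N \<rightarrow> N); n = (''n'', N) in
     Conj (all s (Disj S (Neg S)))
    (Conj (all \<alpha> (ex n (fsubst s (initial \<cdot> Free \<alpha> \<cdot> Free n) S)))
          (all s (all t (Imp S (fsubst s (append \<cdot> Free s \<cdot> Free t) S))))))"

definition secures :: "fm \<Rightarrow> tm \<Rightarrow> fm" where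
  "secures S Y = (let s = seqv; \<beta> = (''b'', N \<rightarrow> N); n = (''n'', N) in
     all s (Imp S (ex n (all \<beta> (Y \<cdot> (prepend \<cdot> Free s \<cdot> Free \<beta>) \<doteq> Free n)))))"

abbreviation GT :: "ty \<Rightarrow> ty" where
  "GT \<sigma> \<equiv> Seq N \<rightarrow> \<sigma>"

abbreviation HT :: "ty \<Rightarrow> ty" where
  "HT \<sigma> \<equiv> Seq N \<rightarrow> (N \<rightarrow> \<sigma>) \<rightarrow> \<sigma>"

definition GBR :: "ty \<Rightarrow> fm \<Rightarrow> tm \<Rightarrow> fm" where
  "GBR \<sigma> S B = (let s = seqv; G = (''G'', GT \<sigma>); H = (''H'', HT \<sigma>); x = (''x'', N) in
     all G (all H (all s (Conj
       (Imp S (B \<cdot> Free G \<cdot> Free H \<cdot> Free s \<doteq> Free G \<cdot> Free s))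
       (Imp (Neg S) (B \<cdot> Free G \<cdot> Free H \<cdot> Free s \<doteq>
          Free H \<cdot> Free s \<cdot> lam x (B \<cdot> Free G \<cdot> Free H \<cdot> (snoc \<cdot> Free s \<cdot> Free x))))))))"


section \<open>The term \<open>\<Psi>\<close>\<close>

definition predecessor :: tm where
  "predecessor = (let m = (''m'', N); r = (''r'', N) in
     Cn (Rec N) \<cdot> Cn Zero \<cdot> lam m (lam r (Free m)))"

text \<open>Truncated subtraction \<open>k - m\<close>.\<close>

definition monus :: tm where
  "monus = (let k = (''k'', N); m = (''m'', N); r = (''r'', N) in
     lam k (Cn (Rec N) \<cdot> Free k \<cdot> lam m (lam r (predecessor \<cdot> Free r))))"

text \<open>\<open>if_zero \<rho> \<cdot> n \<cdot> a \<cdot> b\<close> is \<open>a\<close> if \<open>n = 0\<close> and \<open>b\<close> otherwise.\<close>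

definition if_zero :: "ty \<Rightarrow> tm" where
  "if_zero \<rho> = (let n = (''n'', N); a = (''a'', \<rho>); b = (''b'', \<rho>); m = (''m'', N); r = (''r'', \<rho>) in
     lam n (lam a (lam b (Cn (Rec \<rho>) \<cdot> Free a \<cdot> lam m (lam r (Free b)) \<cdot> Free n))))"

definition phi :: "ty \<Rightarrow> tm" where
  "phi \<sigma> = (let G = (''G'', GT \<sigma>); H = (''H'', HT \<sigma>); m = (''m'', N); p = (''p'', Seq N \<rightarrow> \<sigma>);
       s = (''s'', Seq N); x = (''x'', N) in
     lam G (lam H (Cn (Rec (Seq N \<rightarrow> \<sigma>)) \<cdot> Free G \<cdot>
       lam m (lam p (lam s (Free H \<cdot> Free s \<cdot> lam x (Free p \<cdot> (snoc \<cdot> Free s \<cdot> Free x))))))))"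

text \<open>The test \<open>|s| > k\<close> is expressed as \<open>(k + 1) - |s| = 0\<close> with truncated subtraction.\<close>

definition Psi :: "ty \<Rightarrow> tm" where
  "Psi \<sigma> = (let k = (''k'', N); G = (''G'', GT \<sigma>); H = (''H'', HT \<sigma>); s = (''s'', Seq N);
       d = monus \<cdot> (Cn Succ \<cdot> Free k) \<cdot> (len \<cdot> Free s) in
     lam k (lam G (lam H (lam s
       (if_zero \<sigma> \<cdot> d \<cdot> (Free G \<cdot> Free s) \<cdot> (phi \<sigma> \<cdot> Free G \<cdot> Free H \<cdot> d \<cdot> Free s))))))"


section \<open>The translation\<close>

fun simple :: "ty \<Rightarrow> bool" where
  "simple N \<longleftrightarrow> True"
| "simple (\<rho> \<rightarrow> \<eta>) \<longleftrightarrow> simple \<rho> \<and> simple \<eta>"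
| "simple (Seq \<tau>) \<longleftrightarrow> False"
| "simple (Prod \<tau> \<rho>) \<longleftrightarrow> False"

fun arg_types :: "ty \<Rightarrow> ty list" where
  "arg_types (\<rho> \<rightarrow> \<eta>) = \<rho> # arg_types \<eta>"
| "arg_types _ = []"

text \<open>The special variable; bound variables are indices, so no term binds it.\<close>

definition alpha :: var where
  "alpha = (''alpha'', N \<rightarrow> N)"

primrec T_const :: "const \<Rightarrow> bool" where
  "T_const Zero \<longleftrightarrow> True"
| "T_const Succ \<longleftrightarrow> True"
| "T_const (Rec \<rho>) \<longleftrightarrow> simple \<rho>"
| "T_const (Empty \<tau>) \<longleftrightarrow> False"
| "T_const (Snoc \<tau>) \<longleftrightarrow> False"
| "T_const (SeqRec \<tau> \<rho>) \<longleftrightarrow> False"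
| "T_const (MkPair \<tau> \<rho>) \<longleftrightarrow> False"
| "T_const (Fst \<tau> \<rho>) \<longleftrightarrow> False"
| "T_const (Snd \<tau> \<rho>) \<longleftrightarrow> False"

text \<open>Together with typability: the term and all its subterms have types built from \<open>N\<close> and \<open>\<rightarrow>\<close>.\<close>

primrec T_term :: "tm \<Rightarrow> bool" where
  "T_term (Free x) \<longleftrightarrow> simple (snd x)"
| "T_term (Bound i) \<longleftrightarrow> True"
| "T_term (Cn c) \<longleftrightarrow> T_const c"
| "T_term (t \<cdot> u) \<longleftrightarrow> T_term t \<and> T_term u"
| "T_term (Lam \<pi> t) \<longleftrightarrow> simple \<pi> \<and> T_term t"

abbreviation ValT :: ty where
  "ValT \<equiv> (N \<rightarrow> N) \<rightarrow> N"

abbreviation BT :: "ty \<Rightarrow> ty" where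
  "BT \<sigma> \<equiv> GT \<sigma> \<rightarrow> HT \<sigma> \<rightarrow> Seq N \<rightarrow> \<sigma>"

text \<open>Sequence and product types are never translated; their value is irrelevant.\<close>

fun ty_tr :: "ty \<Rightarrow> ty \<Rightarrow> ty" where
  "ty_tr \<sigma> N = Prod ValT (BT \<sigma>)"
| "ty_tr \<sigma> (\<rho> \<rightarrow> \<eta>) = ty_tr \<sigma> \<rho> \<rightarrow> ty_tr \<sigma> \<eta>"
| "ty_tr \<sigma> \<tau> = \<tau>"

definition pair :: "ty \<Rightarrow> tm \<Rightarrow> tm \<Rightarrow> tm" where
  "pair \<sigma> v b = Cn (MkPair ValT (BT \<sigma>)) \<cdot> v \<cdot> b"

definition Val :: "ty \<Rightarrow> tm \<Rightarrow> tm" where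
  "Val \<sigma> u = Cn (Fst ValT (BT \<sigma>)) \<cdot> u"

definition BB :: "ty \<Rightarrow> tm \<Rightarrow> tm" where
  "BB \<sigma> u = Cn (Snd ValT (BT \<sigma>)) \<cdot> u"

text \<open>\<open>\<langle>\<lambda>\<alpha>. k; \<lambda>G H. G\<rangle>\<close> for \<open>k\<close> a closed term or a variable other than \<open>alpha\<close>.\<close>

definition num_tr :: "ty \<Rightarrow> tm \<Rightarrow> tm" where
  "num_tr \<sigma> k = (let G = (''G'', GT \<sigma>); H = (''H'', HT \<sigma>) in
     pair \<sigma> (lam alpha k) (lam G (lam H (Free G))))"

definition Succ_tr :: "ty \<Rightarrow> tm" where
  "Succ_tr \<sigma> = (let x = (''x'', ty_tr \<sigma> N) in
     lam x (pair \<sigma> (lam alpha (Cn Succ \<cdot> (Val \<sigma> (Free x) \<cdot> Free alpha))) (BB \<sigma> (Free x))))"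

definition alpha_tr :: "ty \<Rightarrow> tm" where
  "alpha_tr \<sigma> = (let x = (''x'', ty_tr \<sigma> N); G = (''G'', GT \<sigma>); H = (''H'', HT \<sigma>); s' = (''s'', Seq N) in
     lam x (pair \<sigma>
       (lam alpha (Free alpha \<cdot> (Val \<sigma> (Free x) \<cdot> Free alpha)))
       (lam G (lam H (BB \<sigma> (Free x) \<cdot>
          lam s' (Psi \<sigma> \<cdot> (Val \<sigma> (Free x) \<cdot> (hat \<cdot> Free s')) \<cdot> Free G \<cdot> Free H \<cdot> Free s') \<cdot>
          Free H)))))"

text \<open>
  The argument tuple \<open>v\<close> of \<open>Rec \<eta>\<close> consists of pairwise distinct variables named \<open>v\<close>, \<open>vv\<close>, and
  so on, one for each argument type of \<open>\<eta>\<close>.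
\<close>

definition arg_vars :: "ty \<Rightarrow> ty \<Rightarrow> var list" where
  "arg_vars \<sigma> \<eta> = map (\<lambda>i. (replicate (Suc i) (CHR ''v''), ty_tr \<sigma> (arg_types \<eta> ! i)))
     [0..<length (arg_types \<eta>)]"

definition Rec_tr :: "ty \<Rightarrow> ty \<Rightarrow> tm" where
  "Rec_tr \<sigma> \<eta> = (let
       a = (''a'', ty_tr \<sigma> \<eta>); F = (''F'', ty_tr \<sigma> N \<rightarrow> ty_tr \<sigma> \<eta> \<rightarrow> ty_tr \<sigma> \<eta>);
       x = (''x'', ty_tr \<sigma> N); v = arg_vars \<sigma> \<eta>; k = (''k'', N);
       G = (''G'', GT \<sigma>); H = (''H'', HT \<sigma>); s = (''s'', Seq N); s' = (''t'', Seq N);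
       r = (\<lambda>n. apps (Cn (Rec (ty_tr \<sigma> \<eta>)) \<cdot> Free a \<cdot> lam k (Free F \<cdot> num_tr \<sigma> (Free k)) \<cdot> n)
                     (map Free v)) in
     lam a (lam F (lam x (lams v (pair \<sigma>
       (lam alpha (Val \<sigma> (r (Val \<sigma> (Free x) \<cdot> Free alpha)) \<cdot> Free alpha))
       (lam G (lam H (lam s (BB \<sigma> (Free x) \<cdot>
          lam s' (BB \<sigma> (r (Val \<sigma> (Free x) \<cdot> (hat \<cdot> Free s'))) \<cdot> Free G \<cdot> Free H \<cdot> Free s') \<cdot>
          Free H \<cdot> Free s)))))))))"

text \<open>Constants for sequences and pairs do not occur in the terms to be translated.\<close>

fun const_tr :: "ty \<Rightarrow> const \<Rightarrow> tm" where
  "const_tr \<sigma> Zero = num_tr \<sigma> (Cn Zero)"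
| "const_tr \<sigma> Succ = Succ_tr \<sigma>"
| "const_tr \<sigma> (Rec \<eta>) = Rec_tr \<sigma> \<eta>"
| "const_tr \<sigma> c = Cn c"

primrec tm_tr :: "ty \<Rightarrow> tm \<Rightarrow> tm" where
  "tm_tr \<sigma> (Free x) = (if x = alpha then alpha_tr \<sigma> else Free (fst x, ty_tr \<sigma> (snd x)))"
| "tm_tr \<sigma> (Bound i) = Bound i"
| "tm_tr \<sigma> (Cn c) = const_tr \<sigma> c"
| "tm_tr \<sigma> (t \<cdot> u) = tm_tr \<sigma> t \<cdot> tm_tr \<sigma> u"
| "tm_tr \<sigma> (Lam \<pi> t) = Lam (ty_tr \<sigma> \<pi>) (tm_tr \<sigma> t)"

end

theory Submission
  imports Defs
begin

text \<open>
  A finite context \<open>W\<close> is a world of a Kripke model: the elements of type \<open>\<rho>\<close> at \<open>W\<close> are the terms of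
  type \<open>\<rho>\<close> modulo equality provable from \<open>W\<close>, and a formula is forced if it is derivable from \<open>W\<close>.
  Weakening makes this monotone, the rules of natural deduction are the forcing clauses, and
  conversions become rewriting in an extensional applicative structure.

  Over this model the theorem is proved with a logical relation between \<open>f : (N \<rightarrow> N) \<rightarrow> \<rho>\<close> and
  \<open>u : \<rho>\<degree>\<close>. At type \<open>N\<close> it states that \<open>f = Val\<^sub>u\<close> and that \<open>B\<^sub>u\<close> is bar recursion along a bar
  securing \<open>f\<close>; at function types related arguments have related values. It is a formula of the
  system, because the recursor is handled by an induction inside the system. The bar need not be
  chosen: it consists of the \<open>s\<close> with \<open>B\<^sub>u(\<lambda>s. 0, \<lambda>s f. 1)(s) = 0\<close>, where \<open>0 \<noteq> 1\<close> are closed terms of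
  type \<open>\<sigma>\<close>.

  The translations of \<open>\<alpha>\<close> and of the recursor are instances of one composition. Let
  \<open>x\<close> have the bar \<open>S\<close>, and let \<open>q(n)\<close> have the bar \<open>S\<^sub>n\<close> for every \<open>n\<close>. Then
  \<open>\<langle>\<lambda>\<alpha>. Val\<^bsub>q(Val\<^sub>x \<alpha>)\<^esub> \<alpha>; \<lambda>G H. B\<^sub>x(\<lambda>s. B\<^bsub>q(Val\<^sub>x s)\<^esub>(G, H)(s), H)\<rangle>\<close> has the bar of all \<open>s\<close> in \<open>S\<close> that are in \<open>S\<^sub>n\<close>
  for the value \<open>n\<close> of \<open>Val\<^sub>x\<close> secured by \<open>s\<close>. For \<open>\<alpha>\<close> take \<open>q(n) = \<langle>\<lambda>\<alpha>. \<alpha>(n); \<Psi>(n)\<rangle>\<close>, with \<open>S\<^sub>n\<close> the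
  sequences longer than \<open>n\<close>.
\<close>

text \<open>A term of type \<open>N\<close> in a world may contain free variables and need not be a
  numeral, and a derivable disjunction or existential need not have a derivable instance. Hence
  induction is available only for formulas, and a case distinction or a witness only while showing
  that some formula is derivable, in a world extended by the corresponding assumption. Such a world
  may be inconsistent. This is why facts range over all finite extensions of a world, and why an
  impossible case is closed by deriving everything from \<open>0 = m + 1\<close> instead of being
  excluded.

  A bar is coded by a term \<chi> on sequences with value zero for membership, so that deciding it
  is a case distinction on a number. Composition needs the bars \<open>S\<^sub>n\<close> as a single
  term with parameter n. Reading the bar off \<open>B\<^sub>u\<close> supplies this term uniformly,
  and nothing is lost: any other bar along which \<open>B\<^sub>u\<close> is bar recursion has
  provably the same members. As \<sigma> is arbitrary, the closed terms 0 and 1 of type \<sigma>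
  come with a closed function that separates them.\<close>

section \<open>Type inference and fresh variables\<close>

definition tapp :: "ty option \<Rightarrow> ty option \<Rightarrow> ty option" where
  "tapp A B = (case A of Some (\<pi> \<rightarrow> \<rho>) \<Rightarrow> if B = Some \<pi> then Some \<rho> else None | _ \<Rightarrow> None)"

lemma tapp_simps [simp]:
  "tapp (Some (\<pi> \<rightarrow> \<rho>)) B = (if B = Some \<pi> then Some \<rho> else None)"
  "tapp None B = None" "tapp A None = None"
  by (auto simp: tapp_def split: option.splits ty.splits)

lemma tapp_Some: "tapp A B = Some \<rho> \<longleftrightarrow> (\<exists>\<pi>. A = Some (\<pi> \<rightarrow> \<rho>) \<and> B = Some \<pi>)"
  by (auto simp: tapp_def split: option.splits ty.splits if_splits)

text \<open>Types are unique, so typing is the graph of a partial function. As a function it is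
  evaluated by simp, whereas the application clause of \<open>has_type\<close> leaves an existential
  argument type.\<close>

primrec tyof :: "ty list \<Rightarrow> tm \<Rightarrow> ty option" where
  "tyof \<Delta> (Free x) = Some (snd x)"
| "tyof \<Delta> (Bound i) = (if i < length \<Delta> then Some (\<Delta> ! i) else None)"
| "tyof \<Delta> (Cn c) = Some (cty c)"
| "tyof \<Delta> (t \<cdot> u) = tapp (tyof \<Delta> t) (tyof \<Delta> u)"
| "tyof \<Delta> (Lam \<pi> t) = map_option (Fn \<pi>) (tyof (\<pi> # \<Delta>) t)"

lemma has_type_iff: "has_type \<Delta> t \<rho> \<longleftrightarrow> tyof \<Delta> t = Some \<rho>"
proof (induction t arbitrary: \<Delta> \<rho>)
  case (App t u)
  show ?case by (simp add: App tapp_Some)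
qed auto

lemma tyof_weaken: "tyof \<Delta> t = Some \<rho> \<Longrightarrow> tyof (\<Delta> @ \<Delta>') t = Some \<rho>"
proof (induction t arbitrary: \<Delta> \<rho>)
  case (Lam \<pi> t)
  then obtain \<kappa> where "tyof (\<pi> # \<Delta>) t = Some \<kappa>" "\<rho> = \<pi> \<rightarrow> \<kappa>" by auto
  with Lam.IH[of "\<pi> # \<Delta>" \<kappa>] show ?case by simp
next
  case (App t u)
  then obtain \<pi> where "tyof \<Delta> t = Some (\<pi> \<rightarrow> \<rho>)" "tyof \<Delta> u = Some \<pi>" by (simp add: tapp_Some) blast
  with App.IH show ?case by simp
qed (auto simp: nth_append split: if_splits)

lemma tyof_weaken': "tyof [] t = Some \<rho> \<Longrightarrow> tyof \<Delta> t = Some \<rho>"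
  using tyof_weaken[of "[]" t \<rho> \<Delta>] by simp

abbreviation has_ty (infix ":|" 50) where
  "t :| \<rho> \<equiv> tyof [] t = Some \<rho>"

lemma finite_fv [simp]: "finite (fv t)"
  by (induction t) auto

lemma finite_ffv [simp]: "finite (ffv A)"
  by (induction A) auto

lemma ex_fresh:
  fixes X :: "var set"
  assumes "finite X"
  obtains z where "z \<notin> X" "snd z = (\<pi> :: ty)"
proof -
  have "infinite (UNIV :: string set)" by (rule infinite_UNIV_listI)
  then obtain n where "n \<notin> fst ` X" using ex_new_if_finite[of "fst ` X"] finite_imageI[OF assms, of fst] by auto
  then have "(n, \<pi>) \<notin> X" by force
  then show thesis using that[of "(n, \<pi>)"] by simp
qed


section \<open>Renaming and weakening\<close>

lemmas deriv_intros = Assm ConjI DisjI1 DisjI2 ImpI Refl deriv.Succ_not_Zero deriv.Succ_inject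
  Rec_Zero Rec_Succ SeqRec_Empty SeqRec_Snoc Fst_Pair Snd_Pair Surj_Pair


primrec ren :: "(var \<Rightarrow> var) \<Rightarrow> tm \<Rightarrow> tm" where
  "ren p (Free x) = Free (p x)"
| "ren p (Bound i) = Bound i"
| "ren p (Cn c) = Cn c"
| "ren p (t \<cdot> u) = ren p t \<cdot> ren p u"
| "ren p (Lam \<pi> t) = Lam \<pi> (ren p t)"

primrec fren :: "(var \<Rightarrow> var) \<Rightarrow> fm \<Rightarrow> fm" where
  "fren p (t \<doteq> u) = (ren p t \<doteq> ren p u)"
| "fren p Bot = Bot"
| "fren p (Conj A B) = Conj (fren p A) (fren p B)"
| "fren p (Disj A B) = Disj (fren p A) (fren p B)"
| "fren p (Imp A B) = Imp (fren p A) (fren p B)"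
| "fren p (All \<pi> A) = All \<pi> (fren p A)"
| "fren p (Ex \<pi> A) = Ex \<pi> (fren p A)"

text \<open>Injectivity makes a renaming commute with substitution and binding and preserves the
  freshness conditions of the rules; keeping types preserves the typing conditions. Derivations can
  therefore be renamed as a whole.\<close>

locale renaming =
  fixes p :: "var \<Rightarrow> var"
  assumes inj: "inj p" and snd_p [simp]: "snd (p x) = snd x"
begin

lemma p_eq [simp]: "p x = p y \<longleftrightarrow> x = y"
  using inj by (auto dest: injD)

lemma p_image [simp]: "p x \<in> p ` X \<longleftrightarrow> x \<in> X"
  by auto

lemma tyof_ren [simp]: "tyof \<Delta> (ren p t) = tyof \<Delta> t"
  by (induction t arbitrary: \<Delta>) auto

lemma wff_fren [simp]: "wff_in \<Delta> (fren p A) = wff_in \<Delta> A"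
  by (induction A arbitrary: \<Delta>) (auto simp: has_type_iff)

lemma fv_ren [simp]: "fv (ren p t) = p ` fv t"
  by (induction t) auto

lemma ffv_fren [simp]: "ffv (fren p A) = p ` ffv A"
  by (induction A) auto

lemma ren_subst [simp]: "ren p (subst x u t) = subst (p x) (ren p u) (ren p t)"
  by (induction t) auto

lemma fren_fsubst [simp]: "fren p (fsubst x u A) = fsubst (p x) (ren p u) (fren p A)"
  by (induction A) auto

lemma ren_bind [simp]: "ren p (bind k x t) = bind k (p x) (ren p t)"
  by (induction t arbitrary: k) auto

lemma fren_fbind [simp]: "fren p (fbind k x A) = fbind k (p x) (fren p A)"
  by (induction A arbitrary: k) auto

lemma ren_lam [simp]: "ren p (lam x t) = lam (p x) (ren p t)"
  by (simp add: lam_def)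

lemma fren_all [simp]: "fren p (all x A) = all (p x) (fren p A)"
  by (simp add: all_def)

lemma fren_ex [simp]: "fren p (ex x A) = ex (p x) (fren p A)"
  by (simp add: ex_def)

lemma notin_ffv_image: "x \<notin> \<Union> (ffv ` \<Gamma>) \<Longrightarrow> p x \<notin> \<Union> (ffv ` fren p ` \<Gamma>)"
  by auto

lemma deriv_fren: "\<Gamma> \<turnstile> A \<Longrightarrow> fren p ` \<Gamma> \<turnstile> fren p A"
proof (induction rule: deriv.induct)
  case (AllI \<Gamma> A x)
  then show ?case using deriv.AllI[of "fren p ` \<Gamma>" "fren p A" "p x"] by auto
next
  case (AllE \<Gamma> x A t)
  then show ?case using deriv.AllE[of "fren p ` \<Gamma>" "p x" "fren p A" "ren p t"] by (simp add: has_type_iff)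
next
  case (ExI \<Gamma> x t A)
  then show ?case using deriv.ExI[of "fren p ` \<Gamma>" "p x" "ren p t" "fren p A"] by (simp add: has_type_iff)
next
  case (ExE \<Gamma> x A C)
  then show ?case using deriv.ExE[of "fren p ` \<Gamma>" "p x" "fren p A" "fren p C"] by auto
next
  case (Leibniz \<Gamma> t u x A)
  then show ?case
    using deriv.Leibniz[of "fren p ` \<Gamma>" "ren p t" "ren p u" "p x" "fren p A"] by (simp add: has_type_iff)
next
  case (Beta t \<rho> u x \<Gamma>)
  then show ?case using deriv.Beta[of "ren p t" \<rho> "ren p u" "p x" "fren p ` \<Gamma>"] by (simp add: has_type_iff)
next
  case (Extensionality f x \<rho> g \<Gamma>)
  then show ?case
    using deriv.Extensionality[of "ren p f" "p x" \<rho> "ren p g" "fren p ` \<Gamma>"] by (auto simp: has_type_iff)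
next
  case (Induction n A \<Gamma>)
  then show ?case using deriv.Induction[of "p n" "fren p A" "fren p ` \<Gamma>"] by simp
next
  case (Seq_Induction s x A \<Gamma>)
  then show ?case using deriv.Seq_Induction[of "p s" "p x" "fren p A" "fren p ` \<Gamma>"] by auto
next
  case (AC0 n f x A \<Gamma>)
  then show ?case using deriv.AC0[of "p n" "p f" "p x" "fren p A" "fren p ` \<Gamma>"] by auto
next
  case (BotE \<Gamma> A)
  then show ?case using deriv.BotE[of "fren p ` \<Gamma>" "fren p A"] by simp
next
  case (DisjE \<Gamma> A B C)
  then show ?case using deriv.DisjE[of "fren p ` \<Gamma>" "fren p A" "fren p B" "fren p C"] by simp
next
  case (ImpE \<Gamma> A B)
  then show ?case using deriv.ImpE[of "fren p ` \<Gamma>" "fren p A" "fren p B"] by simp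
next
  case (ConjE1 \<Gamma> A B)
  then show ?case using deriv.ConjE1[of "fren p ` \<Gamma>" "fren p A" "fren p B"] by simp
next
  case (ConjE2 \<Gamma> A B)
  then show ?case using deriv.ConjE2[of "fren p ` \<Gamma>" "fren p A" "fren p B"] by simp
qed (simp_all add: deriv_intros has_type_iff)

end

lemma ren_cong: "(\<And>x. x \<in> fv t \<Longrightarrow> p x = x) \<Longrightarrow> ren p t = t"
  by (induction t) auto

lemma fren_cong: "(\<And>x. x \<in> ffv A \<Longrightarrow> p x = x) \<Longrightarrow> fren p A = A"
  by (induction A) (auto simp: ren_cong)

definition swap :: "var \<Rightarrow> var \<Rightarrow> var \<Rightarrow> var" where
  "swap x y z = (if z = x then y else if z = y then x else z)"

lemma swap_simps [simp]: "swap x y x = y" "swap x y y = x" "swap x y (swap x y z) = z"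
  by (auto simp: swap_def)

lemma renaming_swap: "snd x = snd y \<Longrightarrow> renaming (swap x y)"
  by unfold_locales (auto simp: swap_def inj_def)

lemma ren_swap_swap [simp]: "ren (swap x y) (ren (swap x y) t) = t"
  by (induction t) auto

lemma fren_swap_swap [simp]: "fren (swap x y) (fren (swap x y) A) = A"
  by (induction A) auto

lemma fv_bind [simp]: "fv (bind k x t) = fv t - {x}"
  by (induction t arbitrary: k) auto

lemma ffv_fbind [simp]: "ffv (fbind k x A) = ffv A - {x}"
  by (induction A arbitrary: k) auto

lemma fv_lam [simp]: "fv (lam x t) = fv t - {x}"
  by (simp add: lam_def)

lemma ffv_all [simp]: "ffv (all x A) = ffv A - {x}" "ffv (ex x A) = ffv A - {x}"
  by (simp_all add: all_def ex_def)

text \<open>The context must be finite so that the eigenvariables of the derivation can be renamed away from it.\<close>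

lemma weakening: "\<Gamma> \<turnstile> A \<Longrightarrow> \<Gamma> \<subseteq> \<Gamma>' \<Longrightarrow> finite \<Gamma>' \<Longrightarrow> \<Gamma>' \<turnstile> A"
proof (induction arbitrary: \<Gamma>' rule: deriv.induct)
  case (AllI \<Gamma> A x)
  obtain y where y: "y \<notin> \<Union> (ffv ` \<Gamma>') \<union> ffv A" "snd y = snd x"
    using ex_fresh[of "\<Union> (ffv ` \<Gamma>') \<union> ffv A"] \<open>finite \<Gamma>'\<close> by auto
  interpret renaming "swap x y" by (rule renaming_swap) (simp add: y)
  have fix_G: "fren (swap x y) B = B" if "B \<in> \<Gamma>" for B
    using that AllI.hyps AllI.prems(1) y by (intro fren_cong) (auto simp: swap_def)
  \<comment> \<open>The larger context is renamed instead of the derivation: the swap fixes \<Gamma>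
    and makes \<open>x\<close> fresh for the image of \<Gamma>'. The induction hypothesis applies to
    that image, and swapping the resulting derivation back restores \<Gamma>'.\<close>
  have "\<Gamma> \<subseteq> fren (swap x y) ` \<Gamma>'" using fix_G AllI.prems(1) by (force simp: image_iff)
  then have "fren (swap x y) ` \<Gamma>' \<turnstile> A" using AllI.IH AllI.prems by simp
  moreover have "x \<notin> \<Union> (ffv ` fren (swap x y) ` \<Gamma>')" using notin_ffv_image[of y \<Gamma>'] y by auto
  ultimately have "fren (swap x y) ` \<Gamma>' \<turnstile> all x A" by (rule deriv.AllI)
  from deriv_fren[OF this] have "\<Gamma>' \<turnstile> fren (swap x y) (all x A)" by (simp add: image_image)
  moreover have "fren (swap x y) (all x A) = all x A"
    using y by (intro fren_cong) (auto simp: swap_def)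
  ultimately show ?case by simp
next
  case (ExE \<Gamma> x A C)
  obtain y where y: "y \<notin> \<Union> (ffv ` \<Gamma>') \<union> ffv A \<union> ffv C" "snd y = snd x"
    using ex_fresh[of "\<Union> (ffv ` \<Gamma>') \<union> ffv A \<union> ffv C"] \<open>finite \<Gamma>'\<close> by auto
  interpret renaming "swap x y" by (rule renaming_swap) (simp add: y)
  have fix_G: "fren (swap x y) B = B" if "B \<in> \<Gamma>" for B
    using that ExE.hyps ExE.prems(1) y by (intro fren_cong) (auto simp: swap_def)
  have "\<Gamma> \<subseteq> fren (swap x y) ` \<Gamma>'" using fix_G ExE.prems(1) by (force simp: image_iff)
  then have "insert A (fren (swap x y) ` \<Gamma>') \<turnstile> C" using ExE.IH(2) ExE.prems by (simp add: subset_insertI2)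
  from deriv_fren[OF this]
  have "insert (fren (swap x y) A) \<Gamma>' \<turnstile> fren (swap x y) C" by (simp add: image_image)
  moreover have "fren (swap x y) C = C" using y ExE.hyps by (intro fren_cong) (auto simp: swap_def)
  \<comment> \<open>Bound variables are indices, so changing the name of the eigenvariable leaves
    the quantified formula literally the same.\<close>
  moreover have "ex x A = ex y (fren (swap x y) A)"
  proof -
    have "fren (swap x y) (ex x A) = ex x A" using y by (intro fren_cong) (auto simp: swap_def)
    then show ?thesis by simp
  qed
  ultimately show ?case
    using deriv.ExE[of \<Gamma>' y "fren (swap x y) A" C] ExE.IH(1) ExE.prems ExE.hyps y by auto
next
  case (Assm A \<Gamma>)
  then show ?case by (simp add: deriv.Assm subset_iff)
next
  case (DisjE \<Gamma> A B C)
  then show ?case by (meson deriv.DisjE finite_insert insert_mono)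
next
  case (ImpI A \<Gamma> B)
  then show ?case by (meson deriv.ImpI finite_insert insert_mono)
next
  case (ImpE A \<Gamma> B)
  then show ?case by (meson deriv.ImpE)
next
  case (AllE \<Gamma> x A t)
  then show ?case by (meson deriv.AllE)
next
  case (Leibniz \<Gamma> t u x A)
  then show ?case by (meson deriv.Leibniz)
next
  case (Extensionality f x \<rho> g \<Gamma>)
  then show ?case by (meson deriv.Extensionality)
next
  case (Induction n A \<Gamma>)
  then show ?case by (meson deriv.Induction)
next
  case (Seq_Induction s x A \<Gamma>)
  then show ?case by (meson deriv.Seq_Induction)
next
  case (ConjE1 \<Gamma> A B)
  then show ?case by (meson deriv.ConjE1)
next
  case (ConjE2 \<Gamma> A B)
  then show ?case by (meson deriv.ConjE2)
next
  case (BotE \<Gamma> A)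
  then show ?case by (meson deriv.BotE)
next
  case (ExI \<Gamma> x t A)
  then show ?case by (meson deriv.ExI)
qed (simp_all add: deriv_intros Beta deriv.AC0)


section \<open>Simultaneous substitution\<close>

text \<open>Both kinds of variables are replaced at once: free ones by \<theta>, and the indices
  from \<open>k\<close> on by the entries of \<open>e\<close>. The terms put in are typed in the
  empty context, so they have no loose indices and nothing is lifted under binders.\<close>

primrec sub :: "(var \<Rightarrow> tm) \<Rightarrow> tm list \<Rightarrow> nat \<Rightarrow> tm \<Rightarrow> tm" where
  "sub \<theta> e k (Free x) = \<theta> x"
| "sub \<theta> e k (Bound i) =
    (if i < k then Bound i else if i - k < length e then e ! (i - k) else Bound i)"
| "sub \<theta> e k (Cn c) = Cn c"
| "sub \<theta> e k (t \<cdot> u) = sub \<theta> e k t \<cdot> sub \<theta> e k u"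
| "sub \<theta> e k (Lam \<pi> t) = Lam \<pi> (sub \<theta> e (Suc k) t)"

primrec fsub :: "(var \<Rightarrow> tm) \<Rightarrow> tm list \<Rightarrow> nat \<Rightarrow> fm \<Rightarrow> fm" where
  "fsub \<theta> e k (t \<doteq> u) = (sub \<theta> e k t \<doteq> sub \<theta> e k u)"
| "fsub \<theta> e k Bot = Bot"
| "fsub \<theta> e k (Conj A B) = Conj (fsub \<theta> e k A) (fsub \<theta> e k B)"
| "fsub \<theta> e k (Disj A B) = Disj (fsub \<theta> e k A) (fsub \<theta> e k B)"
| "fsub \<theta> e k (Imp A B) = Imp (fsub \<theta> e k A) (fsub \<theta> e k B)"
| "fsub \<theta> e k (All \<pi> A) = All \<pi> (fsub \<theta> e (Suc k) A)"
| "fsub \<theta> e k (Ex \<pi> A) = Ex \<pi> (fsub \<theta> e (Suc k) A)"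

definition okt :: "(var \<Rightarrow> tm) \<Rightarrow> bool" where
  "okt \<theta> \<longleftrightarrow> (\<forall>x. (\<theta> x) :| (snd x))"

lemma okt_Free [simp]: "okt Free"
  by (simp add: okt_def)

lemma okt_upd [simp]: "okt \<theta> \<Longrightarrow> t :| (snd x) \<Longrightarrow> okt (\<theta>(x := t))"
  by (simp add: okt_def del: split_paired_All)

lemma oktD [simp]: "okt \<theta> \<Longrightarrow> (\<theta> x) :| (snd x)"
  by (simp add: okt_def del: split_paired_All)

lemma tyof_AppE:
  assumes "tyof \<Delta> (t \<cdot> u) = Some \<rho>"
  obtains \<pi> where "tyof \<Delta> t = Some (\<pi> \<rightarrow> \<rho>)" "tyof \<Delta> u = Some \<pi>"
  using assms by (auto simp: tapp_Some)

lemma sub_bounded: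
  "tyof \<Delta> t = Some \<rho> \<Longrightarrow> length \<Delta> \<le> k \<Longrightarrow> length \<Delta> \<le> k' \<Longrightarrow> sub \<theta> e k t = sub \<theta> e' k' t"
proof (induction t arbitrary: \<Delta> \<rho> k k')
  case (App t u)
  from App.prems(1) show ?case
    by (rule tyof_AppE) (simp add: App.IH(1)[OF _ App.prems(2,3)] App.IH(2)[OF _ App.prems(2,3)])
next
  case (Lam \<pi> t)
  then obtain \<kappa> where "tyof (\<pi> # \<Delta>) t = Some \<kappa>" by auto
  with Lam.IH[of "\<pi> # \<Delta>" \<kappa> "Suc k" "Suc k'"] Lam.prems show ?case by simp
qed (auto split: if_splits)

lemma sub_Free_closed: "tyof \<Delta> t = Some \<rho> \<Longrightarrow> length \<Delta> \<le> k \<Longrightarrow> sub Free e k t = t"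
proof (induction t arbitrary: \<Delta> \<rho> k)
  case (App t u)
  from App.prems(1) show ?case by (rule tyof_AppE) (use App in auto)
next
  case (Lam \<pi> t)
  then obtain \<kappa> where "tyof (\<pi> # \<Delta>) t = Some \<kappa>" by auto
  with Lam.IH[of "\<pi> # \<Delta>" \<kappa> "Suc k"] Lam.prems show ?case by simp
qed (auto split: if_splits)

lemma sub_Free_Nil [simp]: "sub Free [] k t = t"
  by (induction t arbitrary: k) auto

lemma fsub_Free_Nil [simp]: "fsub Free [] k A = A"
  by (induction A arbitrary: k) auto

abbreviation typed_list :: "tm list \<Rightarrow> ty list \<Rightarrow> bool" where
  "typed_list e \<Delta> \<equiv> list_all2 (\<lambda>u \<pi>. u :| \<pi>) e \<Delta>"

lemma tyof_sub:
  "okt \<theta> \<Longrightarrow> typed_list e \<Delta> \<Longrightarrow> tyof (\<Delta>' @ \<Delta>) t = Some \<rho> \<Longrightarrow>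
    tyof \<Delta>' (sub \<theta> e (length \<Delta>') t) = Some \<rho>"
proof (induction t arbitrary: \<Delta>' \<rho>)
  case (Free x)
  then show ?case by (auto intro: tyof_weaken')
next
  case (Bound i)
  show ?case
  proof (cases "i < length \<Delta>'")
    case True
    with Bound show ?thesis by (simp add: nth_append)
  next
    case False
    with Bound have "i - length \<Delta>' < length \<Delta>" "\<Delta> ! (i - length \<Delta>') = \<rho>"
      by (auto simp: nth_append split: if_splits)
    with Bound False show ?thesis by (auto simp: list_all2_conv_all_nth intro: tyof_weaken')
  qed
next
  case (App t u)
  from App.prems(3) show ?case by (rule tyof_AppE) (use App in auto)
next
  case (Lam \<pi> t)
  then obtain \<kappa> where "tyof ((\<pi> # \<Delta>') @ \<Delta>) t = Some \<kappa>" "\<rho> = \<pi> \<rightarrow> \<kappa>" by auto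
  with Lam.IH[of "\<pi> # \<Delta>'" \<kappa>] Lam.prems show ?case by simp
qed auto

lemma tyof_sub0:
  "okt \<theta> \<Longrightarrow> typed_list e \<Delta> \<Longrightarrow> tyof \<Delta> t = Some \<rho> \<Longrightarrow> (sub \<theta> e 0 t) :| \<rho>"
  using tyof_sub[of \<theta> e \<Delta> "[]"] by simp

lemma tyof_sub1:
  "okt \<theta> \<Longrightarrow> typed_list e \<Delta> \<Longrightarrow> tyof (\<pi> # \<Delta>) t = Some \<rho> \<Longrightarrow> tyof [\<pi>] (sub \<theta> e (Suc 0) t) = Some \<rho>"
  using tyof_sub[of \<theta> e \<Delta> "[\<pi>]"] by simp

lemma wff_fsub:
  "okt \<theta> \<Longrightarrow> typed_list e \<Delta> \<Longrightarrow> wff_in (\<Delta>' @ \<Delta>) A \<Longrightarrow> wff_in \<Delta>' (fsub \<theta> e (length \<Delta>') A)"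
proof (induction A arbitrary: \<Delta>')
  case (Eq t u)
  then show ?case using tyof_sub[of \<theta> e \<Delta> \<Delta>'] by (auto simp: has_type_iff)
next
  case (All \<pi> A)
  then show ?case using All.IH[of "\<pi> # \<Delta>'"] by simp
next
  case (Ex \<pi> A)
  then show ?case using Ex.IH[of "\<pi> # \<Delta>'"] by simp
qed auto

lemma wff_fsub0: "okt \<theta> \<Longrightarrow> wff A \<Longrightarrow> wff (fsub \<theta> [] 0 A)"
  using wff_fsub[of \<theta> "[]" "[]" "[]"] by simp

text \<open>Opening a binder after a substitution amounts to lengthening the environment, since the
  terms already put in have no loose indices. This is what turns a \<beta>-step into an environment
  extension.\<close>

lemma sub_sub:
  "okt \<theta> \<Longrightarrow> typed_list e \<Delta> \<Longrightarrow> sub Free [u] k (sub \<theta> e (Suc k) b) = sub \<theta> (u # e) k b"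
proof (induction b arbitrary: k)
  case (Free x)
  then show ?case by (simp add: sub_Free_closed[of "[]" _ "snd x"])
next
  case (Bound i)
  consider "i < k" | "i = k" | j where "i = Suc (k + j)" "j < length e"
    | j where "i = Suc (k + j)" "\<not> j < length e"
    using less_imp_Suc_add[of k i] by (metis less_linear)
  then show ?case
  proof cases
    case (3 j)
    then show ?thesis using Bound by (auto simp: list_all2_conv_all_nth intro: sub_Free_closed[of "[]"])
  qed auto
qed auto

lemma fsub_fsub:
  "okt \<theta> \<Longrightarrow> typed_list e \<Delta> \<Longrightarrow> fsub Free [u] k (fsub \<theta> e (Suc k) A) = fsub \<theta> (u # e) k A"
  by (induction A arbitrary: k) (auto simp: sub_sub)

lemma bind_sub:
  "z \<notin> fv b \<Longrightarrow> tyof (\<Delta> @ [\<pi>]) b = Some \<rho> \<Longrightarrow> bind (length \<Delta>) z (sub Free [Free z] (length \<Delta>) b) = b"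
proof (induction b arbitrary: \<Delta> \<rho>)
  case (App t u)
  from App.prems(2) show ?case by (rule tyof_AppE) (use App in auto)
next
  case (Lam \<kappa> t)
  then obtain \<rho>' where "tyof ((\<kappa> # \<Delta>) @ [\<pi>]) t = Some \<rho>'" by auto
  with Lam.IH[of "\<kappa> # \<Delta>" \<rho>'] Lam.prems show ?case by simp
qed (auto split: if_splits)

lemma fbind_fsub:
  "z \<notin> ffv A \<Longrightarrow> wff_in (\<Delta> @ [\<pi>]) A \<Longrightarrow> fbind (length \<Delta>) z (fsub Free [Free z] (length \<Delta>) A) = A"
proof (induction A arbitrary: \<Delta>)
  case (Eq t u)
  then show ?case by (auto simp: has_type_iff intro: bind_sub)
next
  case (All \<kappa> A)
  then show ?case using All.IH[of "\<kappa> # \<Delta>"] by simp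
next
  case (Ex \<kappa> A)
  then show ?case using Ex.IH[of "\<kappa> # \<Delta>"] by simp
qed auto

lemma subst_sub:
  "subst z u (sub \<theta> e k b) = sub (\<lambda>x. subst z u (\<theta> x)) (map (subst z u) e) k b"
  by (induction b arbitrary: k) auto

lemma fsubst_fsub:
  "fsubst z u (fsub \<theta> e k A) = fsub (\<lambda>x. subst z u (\<theta> x)) (map (subst z u) e) k A"
  by (induction A arbitrary: k) (auto simp: subst_sub)

lemma sub_cong: "(\<And>x. x \<in> fv t \<Longrightarrow> \<theta> x = \<theta>' x) \<Longrightarrow> sub \<theta> e k t = sub \<theta>' e k t"
  by (induction t arbitrary: k) auto

lemma fsub_cong: "(\<And>x. x \<in> ffv A \<Longrightarrow> \<theta> x = \<theta>' x) \<Longrightarrow> fsub \<theta> e k A = fsub \<theta>' e k A"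
proof (induction A arbitrary: k)
  case (Eq t u)
  then show ?case by (auto intro: sub_cong)
qed auto

lemma sub_bind:
  "tyof \<Delta> t = Some \<rho> \<Longrightarrow> length \<Delta> \<le> k \<Longrightarrow> sub \<theta> (u # e) k (bind k x t) = sub (\<theta>(x := u)) [] k t"
proof (induction t arbitrary: \<Delta> \<rho> k)
  case (App t u)
  from App.prems(1) show ?case
    by (rule tyof_AppE) (simp add: App.IH(1)[OF _ App.prems(2)] App.IH(2)[OF _ App.prems(2)] del: fun_upd_apply)
next
  case (Lam \<pi> t)
  then obtain \<kappa> where "tyof (\<pi> # \<Delta>) t = Some \<kappa>" by auto
  with Lam.IH[of "\<pi> # \<Delta>" \<kappa> "Suc k"] Lam.prems show ?case by simp
qed (auto split: if_splits)

lemma fsub_fbind: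
  "wff_in \<Delta> A \<Longrightarrow> length \<Delta> \<le> k \<Longrightarrow> fsub \<theta> (u # e) k (fbind k x A) = fsub (\<theta>(x := u)) [] k A"
proof (induction A arbitrary: \<Delta> k)
  case (Eq t u)
  then show ?case by (auto simp: has_type_iff sub_bind simp del: fun_upd_apply)
next
  case (All \<pi> A)
  then show ?case using All.IH[of "\<pi> # \<Delta>" "Suc k"] by simp
next
  case (Ex \<pi> A)
  then show ?case using Ex.IH[of "\<pi> # \<Delta>" "Suc k"] by simp
qed auto

lemma sub_subst:
  "w :| \<rho> \<Longrightarrow> sub \<theta> [] k (subst x w t) = sub (\<theta>(x := sub \<theta> [] 0 w)) [] k t"
  by (induction t arbitrary: k) (auto intro: sub_bounded[of "[]"])

lemma fsub_fsubst:
  "w :| \<rho> \<Longrightarrow> fsub \<theta> [] k (fsubst x w A) = fsub (\<theta>(x := sub \<theta> [] 0 w)) [] k A"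
  by (induction A arbitrary: k) (auto simp: sub_subst)

lemma subst_fresh: "z \<notin> fv t \<Longrightarrow> subst z u t = t"
  by (induction t) auto

lemma tyof_bind:
  "tyof \<Delta> t = Some \<rho> \<Longrightarrow> length \<Delta> = k \<Longrightarrow> tyof (\<Delta> @ [snd x]) (bind k x t) = Some \<rho>"
proof (induction t arbitrary: \<Delta> \<rho> k)
  case (App t u)
  from App.prems(1) show ?case by (rule tyof_AppE) (use App in auto)
next
  case (Lam \<pi> t)
  then obtain \<kappa> where "tyof (\<pi> # \<Delta>) t = Some \<kappa>" "\<rho> = \<pi> \<rightarrow> \<kappa>" by auto
  with Lam.IH[of "\<pi> # \<Delta>" \<kappa> "Suc k"] Lam.prems show ?case by simp
qed (auto simp: nth_append split: if_splits)

lemma tyof_bind0: "t :| \<rho> \<Longrightarrow> tyof [snd x] (bind 0 x t) = Some \<rho>"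
  using tyof_bind[of "[]"] by simp

lemma tyof_lam [simp]: "tyof [] t \<noteq> None \<Longrightarrow> tyof [] (lam x t) = map_option (Fn (snd x)) (tyof [] t)"
  by (auto simp: lam_def dest: tyof_bind0)

lemma wff_fbind: "wff_in \<Delta> A \<Longrightarrow> length \<Delta> = k \<Longrightarrow> wff_in (\<Delta> @ [snd x]) (fbind k x A)"
proof (induction A arbitrary: \<Delta> k)
  case (Eq t u)
  then show ?case by (auto simp: has_type_iff dest: tyof_bind)
next
  case (All \<pi> A)
  then show ?case using All.IH[of "\<pi> # \<Delta>" "Suc k"] by simp
next
  case (Ex \<pi> A)
  then show ?case using Ex.IH[of "\<pi> # \<Delta>" "Suc k"] by simp
qed auto

lemma wff_fbind0: "wff A \<Longrightarrow> wff_in [snd x] (fbind 0 x A)"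
  using wff_fbind[of "[]"] by simp

lemma wff_all [simp]: "wff A \<Longrightarrow> wff (all x A)" "wff A \<Longrightarrow> wff (ex x A)"
  by (simp_all add: all_def ex_def wff_fbind0)

lemma tyof_subst: "tyof \<Delta> t = Some \<rho> \<Longrightarrow> w :| (snd x) \<Longrightarrow> tyof \<Delta> (subst x w t) = Some \<rho>"
proof (induction t arbitrary: \<Delta> \<rho>)
  case (App t u)
  from App.prems(1) show ?case by (rule tyof_AppE) (use App in auto)
qed (auto intro: tyof_weaken')

lemma wff_fsubst [simp]: "wff_in \<Delta> A \<Longrightarrow> w :| (snd x) \<Longrightarrow> wff_in \<Delta> (fsubst x w A)"
proof (induction A arbitrary: \<Delta>)
  case (Eq t u)
  then show ?case by (auto simp: has_type_iff dest: tyof_subst)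
qed auto


section \<open>Equational reasoning\<close>

lemma eq_refl: "t :| \<rho> \<Longrightarrow> W \<turnstile> t \<doteq> t"
  by (rule Refl[of _ \<rho>]) (simp add: has_type_iff)

lemma eq_subst:
  assumes "W \<turnstile> t \<doteq> u" "t :| (snd z)" "u :| (snd z)" "wff A"
    and "W \<turnstile> fsubst z t A"
  shows "W \<turnstile> fsubst z u A"
  using assms by (auto intro: Leibniz simp: has_type_iff)

lemma eq_sym:
  assumes "W \<turnstile> t \<doteq> u" "t :| \<rho>" "u :| \<rho>"
  shows "W \<turnstile> u \<doteq> t"
proof -
  obtain z where z: "z \<notin> fv t" "snd z = \<rho>" using ex_fresh[OF finite_fv] by blast
  show ?thesis
    using eq_subst[OF assms(1), of z "Free z \<doteq> t"] assms z by (auto simp: subst_fresh has_type_iff eq_refl)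
qed

lemma eq_trans:
  assumes "W \<turnstile> t \<doteq> u" "W \<turnstile> u \<doteq> v" "t :| \<rho>" "u :| \<rho>" "v :| \<rho>"
  shows "W \<turnstile> t \<doteq> v"
proof -
  obtain z where z: "z \<notin> fv t" "snd z = \<rho>" using ex_fresh[OF finite_fv] by blast
  show ?thesis
    using eq_subst[OF assms(2), of z "t \<doteq> Free z"] assms z by (auto simp: subst_fresh has_type_iff)
qed

lemma eq_app:
  assumes "W \<turnstile> f \<doteq> g" "W \<turnstile> a \<doteq> b" "f :| (\<pi> \<rightarrow> \<rho>)" "g :| (\<pi> \<rightarrow> \<rho>)"
    "a :| \<pi>" "b :| \<pi>"
  shows "W \<turnstile> f \<cdot> a \<doteq> g \<cdot> b"
proof -
  obtain z where z: "z \<notin> fv f \<union> fv a" "snd z = \<pi> \<rightarrow> \<rho>"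
    using ex_fresh[of "fv f \<union> fv a"] by auto
  obtain y where y: "y \<notin> fv f \<union> fv g \<union> fv a" "snd y = \<pi>"
    using ex_fresh[of "fv f \<union> fv g \<union> fv a"] by auto
  have "W \<turnstile> f \<cdot> a \<doteq> f \<cdot> a" using assms by (intro eq_refl[of _ \<rho>]) simp
  then have "W \<turnstile> f \<cdot> a \<doteq> g \<cdot> a"
    using eq_subst[OF assms(1), of z "f \<cdot> a \<doteq> Free z \<cdot> a"] assms z by (auto simp: subst_fresh has_type_iff)
  then show ?thesis
    using eq_subst[OF assms(2), of y "f \<cdot> a \<doteq> g \<cdot> Free y"] assms y by (auto simp: subst_fresh has_type_iff)
qed

text \<open>The conversion rule speaks of abstractions of a named variable. A raw \<open>Lam\<close>
  takes this form by opening its body with a fresh variable and binding that variable again.\<close>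

lemma eq_beta:
  assumes "tyof [\<pi>] b = Some \<rho>" "u :| \<pi>"
  shows "W \<turnstile> Lam \<pi> b \<cdot> u \<doteq> sub Free [u] 0 b"
proof -
  obtain z where z: "z \<notin> fv b" "snd z = \<pi>" using ex_fresh[OF finite_fv] by blast
  have t: "(sub Free [Free z] 0 b) :| \<rho>"
    using assms z by (intro tyof_sub0[of _ _ "[\<pi>]"]) auto
  have "lam z (sub Free [Free z] 0 b) = Lam \<pi> b"
    using bind_sub[of z b "[]" \<pi> \<rho>] z assms by (simp add: lam_def)
  moreover have "subst z u (sub Free [Free z] 0 b) = sub Free [u] 0 b"
    using z(1) by (auto simp: subst_sub intro: sub_cong)
  moreover have "W \<turnstile> lam z (sub Free [Free z] 0 b) \<cdot> u \<doteq> subst z u (sub Free [Free z] 0 b)"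
    using t assms z by (intro Beta) (auto simp: has_type_iff)
  ultimately show ?thesis by simp
qed

text \<open>Among the arguments \<open>u\<close> is a variable that is fresh for both functions and
  for the finite context; this one instance yields the premise of the extensionality rule.\<close>

lemma eq_ext:
  assumes "finite W" "f :| (\<pi> \<rightarrow> \<rho>)" "g :| (\<pi> \<rightarrow> \<rho>)"
    and "\<And>u. u :| \<pi> \<Longrightarrow> W \<turnstile> f \<cdot> u \<doteq> g \<cdot> u"
  shows "W \<turnstile> f \<doteq> g"
proof -
  obtain z where z: "z \<notin> fv f \<union> fv g \<union> \<Union> (ffv ` W)" "snd z = \<pi>"
    using ex_fresh[of "fv f \<union> fv g \<union> \<Union> (ffv ` W)"] assms(1) by auto
  have "W \<turnstile> all z (f \<cdot> Free z \<doteq> g \<cdot> Free z)" using assms z by (intro AllI) auto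
  then show ?thesis using assms z by (intro Extensionality[of f z \<rho> g]) (auto simp: has_type_iff)
qed


section \<open>The term model of a context\<close>

text \<open>
  An untyped term has the empty class, which is not the class of any typed term. Hence \<open>cls\<close> and the
  type of a class commute with application without side conditions.
\<close>

definition cls :: "fm set \<Rightarrow> tm \<Rightarrow> tm set" where
  "cls W t = {u. \<exists>\<rho>. t :| \<rho> \<and> u :| \<rho> \<and> W \<turnstile> t \<doteq> u}"

lemma cls_eq_iff: "t :| \<rho> \<Longrightarrow> u :| \<rho> \<Longrightarrow> cls W t = cls W u \<longleftrightarrow> W \<turnstile> t \<doteq> u"
proof
  assume t: "t :| \<rho>" and u: "u :| \<rho>"
  {
    assume "cls W t = cls W u"
    moreover have "u \<in> cls W u" using u eq_refl by (auto simp: cls_def)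
    ultimately show "W \<turnstile> t \<doteq> u" by (auto simp: cls_def)
  next
    assume "W \<turnstile> t \<doteq> u"
    then show "cls W t = cls W u" using t u unfolding cls_def by (auto intro: eq_sym eq_trans)
  }
qed

lemma cls_empty_iff: "cls W t = {} \<longleftrightarrow> tyof [] t = None"
  by (cases "tyof [] t") (auto simp: cls_def dest: eq_refl)

lemma tyof_cls_eq: "cls W t = cls W u \<Longrightarrow> tyof [] t = tyof [] u"
proof (cases "tyof [] t")
  case None
  assume "cls W t = cls W u"
  with None show ?thesis by (metis cls_empty_iff)
next
  case (Some \<rho>)
  assume "cls W t = cls W u"
  moreover have "t \<in> cls W t" using Some eq_refl by (auto simp: cls_def)
  ultimately show ?thesis by (auto simp: cls_def)
qed

lemma cls_mono:
  assumes "cls W t = cls W u" "W \<subseteq> W'" "finite W'"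
  shows "cls W' t = cls W' u"
proof (cases "tyof [] t")
  case None
  then show ?thesis using tyof_cls_eq[OF assms(1)] by (metis cls_empty_iff)
next
  case (Some \<rho>)
  then show ?thesis using tyof_cls_eq[OF assms(1)] assms(1) weakening[OF _ assms(2,3)] by (auto simp: cls_eq_iff)
qed

definition rep :: "fm set \<Rightarrow> tm set \<Rightarrow> tm" where
  "rep W A = (SOME t. A = cls W t \<and> tyof [] t \<noteq> None)"

definition tyc :: "fm set \<Rightarrow> tm set \<Rightarrow> ty option" where
  "tyc W A = (if \<exists>t. A = cls W t \<and> tyof [] t \<noteq> None then tyof [] (rep W A) else None)"

definition app :: "fm set \<Rightarrow> tm set \<Rightarrow> tm set \<Rightarrow> tm set" where
  "app W A B = (if tapp (tyc W A) (tyc W B) = None then {} else cls W (rep W A \<cdot> rep W B))"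

lemma rep_cls:
  assumes "tyof [] t \<noteq> None"
  shows "cls W (rep W (cls W t)) = cls W t"
  unfolding rep_def by (rule someI2[of _ t]) (use assms in auto)

lemma tyc_cls [simp]: "tyc W (cls W t) = tyof [] t"
proof (cases "tyof [] t = None")
  case True
  then have "tyof [] u = None" if "cls W t = cls W u" for u using tyof_cls_eq[OF that] by simp
  then show ?thesis using True by (auto simp: tyc_def)
next
  case False
  then show ?thesis using rep_cls[OF False, of W] by (auto simp: tyc_def dest: tyof_cls_eq)
qed

lemma tyc_repE:
  assumes "tyc W A = Some \<rho>"
  obtains t where "A = cls W t" "t :| \<rho>"
proof -
  from assms obtain t where "A = cls W t" by (auto simp: tyc_def split: if_splits)
  with assms that show thesis by auto
qed

lemma cls_rep: "tyc W A = Some \<rho> \<Longrightarrow> cls W (rep W A) = A"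
  by (elim tyc_repE) (auto simp: rep_cls)

lemma tyof_rep [simp]: "tyc W A = Some \<rho> \<Longrightarrow> (rep W A) :| \<rho>"
  by (metis cls_rep tyc_cls)

lemma tyc_app [simp]: "tyc W (app W A B) = tapp (tyc W A) (tyc W B)"
proof (cases "tapp (tyc W A) (tyc W B)")
  case None
  have "tyc W {} = None" unfolding tyc_def by (metis cls_empty_iff)
  with None show ?thesis by (simp add: app_def)
next
  case (Some \<rho>)
  then obtain \<pi> where "tyc W A = Some (\<pi> \<rightarrow> \<rho>)" "tyc W B = Some \<pi>" by (auto simp: tapp_Some)
  then show ?thesis by (simp add: app_def)
qed

lemma cls_app [simp]: "cls W (t \<cdot> u) = app W (cls W t) (cls W u)"
proof (cases "tapp (tyof [] t) (tyof [] u)")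
  case None
  then show ?thesis by (simp add: app_def cls_empty_iff)
next
  case (Some \<rho>)
  then obtain \<pi> where t: "t :| (\<pi> \<rightarrow> \<rho>)" and u: "u :| \<pi>" by (auto simp: tapp_Some)
  let ?t = "rep W (cls W t)" and ?u = "rep W (cls W u)"
  have tu: "?t :| (\<pi> \<rightarrow> \<rho>)" "?u :| \<pi>" using t u by auto
  have "W \<turnstile> t \<doteq> ?t" "W \<turnstile> u \<doteq> ?u"
    using t u tu rep_cls[of t W] rep_cls[of u W] cls_eq_iff[of t _ ?t W] cls_eq_iff[of u _ ?u W] by auto
  then have "W \<turnstile> t \<cdot> u \<doteq> ?t \<cdot> ?u" using t u tu by (intro eq_app)
  then show ?thesis using t u tu by (simp add: app_def cls_eq_iff[of _ \<rho>])
qed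

lemma app_ext:
  assumes "finite W" "tyc W f = Some (\<pi> \<rightarrow> \<rho>)" "tyc W g = Some (\<pi> \<rightarrow> \<rho>)"
    and "\<And>a. tyc W a = Some \<pi> \<Longrightarrow> app W f a = app W g a"
  shows "f = g"
proof -
  obtain t where t: "f = cls W t" "t :| (\<pi> \<rightarrow> \<rho>)" using assms(2) by (rule tyc_repE)
  obtain u where u: "g = cls W u" "u :| (\<pi> \<rightarrow> \<rho>)" using assms(3) by (rule tyc_repE)
  have "W \<turnstile> t \<doteq> u"
  proof (rule eq_ext[OF assms(1) t(2) u(2)])
    fix a assume a: "a :| \<pi>"
    then have "cls W (t \<cdot> a) = cls W (u \<cdot> a)" using assms(4)[of "cls W a"] t u by simp
    then show "W \<turnstile> t \<cdot> a \<doteq> u \<cdot> a" using t u a by (subst (asm) cls_eq_iff[of _ \<rho>]) auto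
  qed
  then show ?thesis using t u by (simp add: cls_eq_iff)
qed

lemma cls_beta:
  assumes "okt \<theta>" "typed_list e \<Delta>" "tyof (\<pi> # \<Delta>) b = Some \<rho>" "u :| \<pi>"
  shows "app W (cls W (sub \<theta> e 0 (Lam \<pi> b))) (cls W u) = cls W (sub \<theta> (u # e) 0 b)"
proof -
  have t: "tyof [\<pi>] (sub \<theta> e (Suc 0) b) = Some \<rho>" using assms by (intro tyof_sub1)
  have t': "(sub \<theta> (u # e) 0 b) :| \<rho>"
    using assms by (intro tyof_sub0[of _ _ "\<pi> # \<Delta>"]) auto
  have "W \<turnstile> Lam \<pi> (sub \<theta> e (Suc 0) b) \<cdot> u \<doteq> sub \<theta> (u # e) 0 b"
    using eq_beta[OF t assms(4)] sub_sub[OF assms(1,2), of u 0 b] by simp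
  then have "cls W (Lam \<pi> (sub \<theta> e (Suc 0) b) \<cdot> u) = cls W (sub \<theta> (u # e) 0 b)"
    using t t' assms(4) by (subst cls_eq_iff[of _ \<rho>]) auto
  then show ?thesis by simp
qed

text \<open>There is no primitive congruence rule under \<lambda>. At an abstraction the two values
  are compared at every argument, where \<open>cls_beta\<close> moves the argument into the
  environments, and extensionality concludes.\<close>

lemma cls_sub_cong:
  assumes "finite W" "okt \<theta>" "okt \<theta>'" and \<theta>: "\<And>x. cls W (\<theta> x) = cls W (\<theta>' x)"
  shows "tyof \<Delta> t = Some \<rho> \<Longrightarrow> typed_list e \<Delta> \<Longrightarrow> map (cls W) e = map (cls W) e' \<Longrightarrow>
    cls W (sub \<theta> e 0 t) = cls W (sub \<theta>' e' 0 t)"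
proof (induction t arbitrary: \<Delta> \<rho> e e')
  case (Free x)
  then show ?case using \<theta> by simp
next
  case (Bound i)
  then show ?case
    using map_eq_imp_length_eq[OF Bound(3)] by (auto simp: list_eq_iff_nth_eq list_all2_conv_all_nth split: if_splits)
next
  case (App t u)
  from App.prems(1) show ?case
    by (rule tyof_AppE) (simp add: App.IH(1)[OF _ App.prems(2,3)] App.IH(2)[OF _ App.prems(2,3)])
next
  case (Lam \<pi> t)
  then obtain \<kappa> where k: "tyof (\<pi> # \<Delta>) t = Some \<kappa>" "\<rho> = \<pi> \<rightarrow> \<kappa>" by auto
  have e': "typed_list e' \<Delta>"
    using Lam.prems(2,3) map_eq_imp_length_eq[OF Lam.prems(3)]
    by (auto simp: list_eq_iff_nth_eq list_all2_conv_all_nth) (metis tyof_cls_eq)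
  have ty: "(sub \<theta> e 0 (Lam \<pi> t)) :| \<rho>" "(sub \<theta>' e' 0 (Lam \<pi> t)) :| \<rho>"
    using assms Lam.prems e' by (auto intro!: tyof_sub0 simp del: sub.simps)
  show ?case
  proof (rule app_ext[OF assms(1)])
    fix a assume "tyc W a = Some \<pi>"
    then obtain u where u: "a = cls W u" "u :| \<pi>" by (rule tyc_repE)
    have "cls W (sub \<theta> (u # e) 0 t) = cls W (sub \<theta>' (u # e') 0 t)"
      using k u Lam.prems by (intro Lam.IH[of "\<pi> # \<Delta>" \<kappa>]) auto
    then show "app W (cls W (sub \<theta> e 0 (Lam \<pi> t))) a = app W (cls W (sub \<theta>' e' 0 (Lam \<pi> t))) a"
      using k u Lam.prems e' assms by (simp add: cls_beta del: sub.simps)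
  qed (use ty k in \<open>simp_all del: sub.simps\<close>)
qed simp


section \<open>Evaluation of terms in the term model\<close>

text \<open>Representatives of the assigned classes are substituted; by \<open>cls_sub_cong\<close>
  the choice of representatives does not affect the class of the result.\<close>

definition sem :: "fm set \<Rightarrow> (var \<Rightarrow> tm set) \<Rightarrow> tm \<Rightarrow> tm set" where
  "sem W \<rho> t = cls W (sub (\<lambda>x. rep W (\<rho> x)) [] 0 t)"

definition okv :: "fm set \<Rightarrow> (var \<Rightarrow> tm set) \<Rightarrow> bool" where
  "okv W \<rho> \<longleftrightarrow> (\<forall>x. tyc W (\<rho> x) = Some (snd x))"

definition env :: "fm set \<Rightarrow> (var \<Rightarrow> tm) \<Rightarrow> var \<Rightarrow> tm set" where
  "env W \<theta> x = cls W (\<theta> x)"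

lemma okvD [simp]: "okv W \<rho> \<Longrightarrow> tyc W (\<rho> x) = Some (snd x)"
  by (simp add: okv_def del: split_paired_All)

lemma okv_upd [simp]: "okv W \<rho> \<Longrightarrow> tyc W a = Some (snd x) \<Longrightarrow> okv W (\<rho>(x := a))"
  by (simp add: okv_def del: split_paired_All)

lemma env_upd [simp]: "env W (\<theta>(x := t)) = (env W \<theta>)(x := cls W t)"
  by (rule ext) (simp add: env_def)

lemma okv_env [simp]: "okt \<theta> \<Longrightarrow> okv W (env W \<theta>)"
  by (simp add: okv_def env_def del: split_paired_All)

lemma okt_rep [simp]: "okv W \<rho> \<Longrightarrow> okt (\<lambda>x. rep W (\<rho> x))"
  unfolding okt_def by (metis okvD tyof_rep)

lemma rep_upd: "(\<lambda>y. rep W ((\<rho>(x := a)) y)) = (\<lambda>y. rep W (\<rho> y))(x := rep W a)"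
  by auto

lemma sem_app [simp]: "sem W \<rho> (t \<cdot> u) = app W (sem W \<rho> t) (sem W \<rho> u)"
  by (simp add: sem_def)

lemma sem_Free [simp]: "okv W \<rho> \<Longrightarrow> sem W \<rho> (Free x) = \<rho> x"
  by (simp add: sem_def) (rule cls_rep, erule okvD)

lemma sem_Cn [simp]: "sem W \<rho> (Cn c) = cls W (Cn c)"
  by (simp add: sem_def)

text \<open>With \<open>sem_app\<close> and \<open>sem_Free\<close> this makes simp evaluate closed
  programs written with named variables, by updating an assignment instead of computing
  substitutions.\<close>

lemma sem_lam [simp]:
  assumes "okv W \<rho>" "tyof [] t \<noteq> None" "tyc W a = Some (snd x)"
  shows "app W (sem W \<rho> (lam x t)) a = sem W (\<rho>(x := a)) t"
proof -
  obtain \<kappa> where k: "t :| \<kappa>" using assms(2) by auto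
  have "app W (sem W \<rho> (lam x t)) a = cls W (sub (\<lambda>x. rep W (\<rho> x)) [rep W a] 0 (bind 0 x t))"
    using cls_beta[of "\<lambda>x. rep W (\<rho> x)" "[]" "[]" "snd x" "bind 0 x t" \<kappa> "rep W a" W] assms k
    by (simp add: sem_def lam_def cls_rep tyof_bind0)
  also have "\<dots> = sem W (\<rho>(x := a)) t"
    unfolding sem_def rep_upd using k by (simp add: sub_bind[of "[]"])
  finally show ?thesis .
qed

lemma sem_env:
  assumes "finite W" "okt \<theta>" "t :| \<rho>"
  shows "sem W (env W \<theta>) t = cls W (sub \<theta> [] 0 t)"
proof -
  have "cls W (\<theta> x) = cls W (rep W (env W \<theta> x))" for x
    using assms(2) by (simp add: env_def rep_cls)
  then show ?thesis
    unfolding sem_def using assms by (intro cls_sub_cong[symmetric, of _ _ _ "[]"]) simp_all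
qed

lemma cls_eq_sem:
  "finite W \<Longrightarrow> tyof [] t \<noteq> None \<Longrightarrow> cls W t = sem W (env W Free) t"
  using sem_env[of W Free t] by auto

lemma cls_lam [simp]:
  assumes "finite W" "tyof [] t \<noteq> None" "tyc W a = Some (snd x)"
  shows "app W (cls W (lam x t)) a = sem W ((env W Free)(x := a)) t"
  using assms by (subst cls_eq_sem) auto

lemma sem_closed:
  assumes "finite W" "okv W \<rho>" "fv t = {}" "tyof [] t \<noteq> None"
  shows "sem W \<rho> t = cls W t"
proof -
  have "sub (\<lambda>x. rep W (\<rho> x)) [] 0 t = sub Free [] 0 t"
    using assms(3) by (intro sub_cong) simp
  then show ?thesis by (simp add: sem_def)
qed

lemma tyc_sem [simp]: "okv W \<rho> \<Longrightarrow> tyof [] t \<noteq> None \<Longrightarrow> tyc W (sem W \<rho> t) = tyof [] t"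
  using tyof_sub0[of "\<lambda>x. rep W (\<rho> x)" "[]" "[]" t] by (auto simp: sem_def)


section \<open>Forcing of formulas\<close>

text \<open>The assignment \<theta> consists of terms and not of classes: a term keeps its identity
  when the world grows, while a class belongs to one world.\<close>

definition sat :: "fm set \<Rightarrow> (var \<Rightarrow> tm) \<Rightarrow> fm \<Rightarrow> bool" where
  "sat W \<theta> A \<longleftrightarrow> W \<turnstile> fsub \<theta> [] 0 A"

lemma sat_Free: "sat W Free A \<longleftrightarrow> W \<turnstile> A"
  by (simp add: sat_def)

lemma sat_mono: "sat W \<theta> A \<Longrightarrow> W \<subseteq> W' \<Longrightarrow> finite W' \<Longrightarrow> sat W' \<theta> A"
  by (auto simp: sat_def intro: weakening)

lemma sat_cong: "(\<And>x. x \<in> ffv A \<Longrightarrow> \<theta> x = \<theta>' x) \<Longrightarrow> sat W \<theta> A = sat W \<theta>' A"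
  unfolding sat_def by (metis fsub_cong)

lemma sat_Eq [simp]:
  assumes "finite W" "okt \<theta>" "tyof [] t \<noteq> None" "tyof [] u = tyof [] t"
  shows "sat W \<theta> (t \<doteq> u) \<longleftrightarrow> sem W (env W \<theta>) t = sem W (env W \<theta>) u"
proof -
  obtain \<kappa> where "t :| \<kappa>" "u :| \<kappa>" using assms by auto
  then show ?thesis
    using assms tyof_sub0[of \<theta> "[]" "[]"] by (simp add: sat_def sem_env cls_eq_iff)
qed

lemma sat_Conj [simp]: "sat W \<theta> (Conj A B) \<longleftrightarrow> sat W \<theta> A \<and> sat W \<theta> B"
  by (auto simp: sat_def intro: ConjI ConjE1 ConjE2)

text \<open>From right to left a single extension is decisive, the world enlarged by the instance of
  \<open>A\<close> itself.\<close>

lemma sat_Imp [simp]: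
  assumes "finite W" "okt \<theta>" "wff A"
  shows "sat W \<theta> (Imp A B) \<longleftrightarrow> (\<forall>W'. finite W' \<longrightarrow> W \<subseteq> W' \<longrightarrow> sat W' \<theta> A \<longrightarrow> sat W' \<theta> B)"
proof
  assume "sat W \<theta> (Imp A B)"
  then show "\<forall>W'. finite W' \<longrightarrow> W \<subseteq> W' \<longrightarrow> sat W' \<theta> A \<longrightarrow> sat W' \<theta> B"
    by (auto simp: sat_def intro: weakening ImpE)
next
  let ?W = "insert (fsub \<theta> [] 0 A) W"
  assume "\<forall>W'. finite W' \<longrightarrow> W \<subseteq> W' \<longrightarrow> sat W' \<theta> A \<longrightarrow> sat W' \<theta> B"
  moreover have "?W \<turnstile> fsub \<theta> [] 0 A" by (rule Assm) simp
  ultimately have "?W \<turnstile> fsub \<theta> [] 0 B" using assms unfolding sat_def by blast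
  then show "sat W \<theta> (Imp A B)" using assms by (simp add: sat_def wff_fsub0 ImpI)
qed

lemma deriv_All_iff:
  assumes "finite W" "wff_in [\<pi>] A"
  shows "W \<turnstile> All \<pi> A \<longleftrightarrow> (\<forall>u. u :| \<pi> \<longrightarrow> W \<turnstile> fsub Free [u] 0 A)"
proof -
  obtain z where z: "z \<notin> ffv A \<union> \<Union> (ffv ` W)" "snd z = \<pi>"
    using ex_fresh[of "ffv A \<union> \<Union> (ffv ` W)"] assms(1) by auto
  let ?A = "fsub Free [Free z] 0 A"
  have all: "all z ?A = All \<pi> A" using fbind_fsub[of z A "[]" \<pi>] z assms(2) by (simp add: all_def)
  have wff: "wff ?A" using wff_fsub[of Free "[Free z]" "[\<pi>]" "[]" A] z assms(2) by simp
  show ?thesis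
  proof
    assume "W \<turnstile> All \<pi> A"
    then have "W \<turnstile> fsubst z u ?A" if "u :| \<pi>" for u
      using that all wff z by (intro AllE) (auto simp: has_type_iff)
    moreover have "fsubst z u ?A = fsub Free [u] 0 A" for u
      using z(1) by (auto simp: fsubst_fsub intro: fsub_cong)
    ultimately show "\<forall>u. u :| \<pi> \<longrightarrow> W \<turnstile> fsub Free [u] 0 A" by simp
  next
    assume "\<forall>u. u :| \<pi> \<longrightarrow> W \<turnstile> fsub Free [u] 0 A"
    then have "W \<turnstile> all z ?A" using z by (intro AllI) auto
    then show "W \<turnstile> All \<pi> A" using all by simp
  qed
qed

lemma fsub_all_body:
  "okt \<theta> \<Longrightarrow> wff A \<Longrightarrow> fsub Free [u] 0 (fsub \<theta> [] (Suc 0) (fbind 0 x A)) = fsub (\<theta>(x := u)) [] 0 A"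
  by (simp add: fsub_fsub[of _ _ "[]"] fsub_fbind[of "[]"])

lemma wff_all_body: "okt \<theta> \<Longrightarrow> wff A \<Longrightarrow> wff_in [snd x] (fsub \<theta> [] (Suc 0) (fbind 0 x A))"
  using wff_fsub[of \<theta> "[]" "[]" "[snd x]" "fbind 0 x A"] wff_fbind0[of A x] by simp

lemma sat_all [simp]:
  assumes "finite W" "okt \<theta>" "wff A"
  shows "sat W \<theta> (all x A) \<longleftrightarrow> (\<forall>u. u :| (snd x) \<longrightarrow> sat W (\<theta>(x := u)) A)"
  using deriv_All_iff[OF assms(1) wff_all_body[OF assms(2,3)]] assms
  by (simp add: sat_def all_def fsub_all_body del: fun_upd_apply)

lemma sat_fsubst [simp]:
  assumes "finite W" "okt \<theta>" "w :| (snd x)"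
  shows "sat W \<theta> (fsubst x w A) \<longleftrightarrow> sat W (\<theta>(x := sub \<theta> [] 0 w)) A"
  using assms by (simp add: sat_def fsub_fsubst del: fun_upd_apply)

text \<open>The rules for quantifiers, equality and induction speak of one formula and its
  substitution instances. Here the family of instances at \<open>x\<close> is presented in this way
  by a variable \<open>z\<close> that also avoids the terms assigned by \<theta>, so that replacing
  \<open>z\<close> disturbs nothing else.\<close>

lemma generic:
  assumes "okt \<theta>" "wff A" "finite X"
  obtains z where "z \<notin> X" "snd z = snd x" "wff (fsub (\<theta>(x := Free z)) [] 0 A)"
    "\<And>u. fsubst z u (fsub (\<theta>(x := Free z)) [] 0 A) = fsub (\<theta>(x := u)) [] 0 A"
proof -
  obtain z where z: "z \<notin> X \<union> ffv A \<union> (\<Union>y\<in>ffv A. fv (\<theta> y))" "snd z = snd x"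
    using ex_fresh[of "X \<union> ffv A \<union> (\<Union>y\<in>ffv A. fv (\<theta> y))"] assms(3) by auto
  show thesis
  proof (rule that)
    show "fsubst z u (fsub (\<theta>(x := Free z)) [] 0 A) = fsub (\<theta>(x := u)) [] 0 A" for u
      using z(1) unfolding fsubst_fsub by (auto intro!: fsub_cong subst_fresh)
  qed (use z assms in \<open>auto intro: wff_fsub0\<close>)
qed

lemma sat_Leibniz:
  assumes "okt \<theta>" "wff A" "t :| (snd x)" "cls W t = cls W u" "sat W (\<theta>(x := t)) A"
  shows "sat W (\<theta>(x := u)) A"
proof -
  obtain z where z: "snd z = snd x" "wff (fsub (\<theta>(x := Free z)) [] 0 A)"
    "\<And>u. fsubst z u (fsub (\<theta>(x := Free z)) [] 0 A) = fsub (\<theta>(x := u)) [] 0 A"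
    using generic[OF assms(1,2), of "{}"] by blast
  have u: "u :| (snd x)" using assms(3) tyof_cls_eq[OF assms(4)] by simp
  show ?thesis
    using eq_subst[of W t u z "fsub (\<theta>(x := Free z)) [] 0 A"] z u assms by (simp add: sat_def cls_eq_iff del: fun_upd_apply)
qed

lemma ex_generic:
  assumes "okt \<theta>" "wff A" "finite X"
  obtains z where "z \<notin> X" "snd z = snd x" "wff (fsub (\<theta>(x := Free z)) [] 0 A)"
    "\<And>u. fsubst z u (fsub (\<theta>(x := Free z)) [] 0 A) = fsub (\<theta>(x := u)) [] 0 A"
    "fsub \<theta> [] 0 (ex x A) = ex z (fsub (\<theta>(x := Free z)) [] 0 A)"
    "fsub \<theta> [] 0 (all x A) = all z (fsub (\<theta>(x := Free z)) [] 0 A)"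
proof -
  let ?B = "fsub \<theta> [] (Suc 0) (fbind 0 x A)"
  obtain z where z: "z \<notin> X \<union> ffv ?B" "snd z = snd x" "wff (fsub (\<theta>(x := Free z)) [] 0 A)"
    "\<And>u. fsubst z u (fsub (\<theta>(x := Free z)) [] 0 A) = fsub (\<theta>(x := u)) [] 0 A"
    by (rule generic[OF assms(1,2), of "X \<union> ffv ?B"]) (use assms(3) in simp, blast)
  have "fbind 0 z (fsub (\<theta>(x := Free z)) [] 0 A) = ?B"
    using fbind_fsub[of z ?B "[]" "snd x"] wff_all_body[OF assms(1,2)] fsub_all_body[OF assms(1,2)] z by simp
  with z show thesis by (intro that) (auto simp: ex_def all_def simp del: fun_upd_apply)
qed

lemma sat_exI:
  assumes "okt \<theta>" "wff A" "u :| (snd x)" "sat W (\<theta>(x := u)) A"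
  shows "sat W \<theta> (ex x A)"
proof -
  obtain z where z: "snd z = snd x" "wff (fsub (\<theta>(x := Free z)) [] 0 A)"
    "\<And>u. fsubst z u (fsub (\<theta>(x := Free z)) [] 0 A) = fsub (\<theta>(x := u)) [] 0 A"
    "fsub \<theta> [] 0 (ex x A) = ex z (fsub (\<theta>(x := Free z)) [] 0 A)"
    using ex_generic[OF assms(1,2), of "{}"] by blast
  show ?thesis
    unfolding sat_def z(4) by (rule ExI[of _ _ u]) (use z assms in \<open>auto simp: sat_def has_type_iff simp del: fun_upd_apply\<close>)
qed

text \<open>A forced existential provides no witness in \<open>W\<close> itself. It may be used only
  towards a derivable \<open>C\<close>, with the generic variable as witness in the world enlarged
  by its defining formula.\<close>

lemma sat_exE:
  assumes "sat W \<theta> (ex x A)" "finite W" "okt \<theta>" "wff A"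
    and "\<And>W' u. finite W' \<Longrightarrow> W \<subseteq> W' \<Longrightarrow> u :| (snd x) \<Longrightarrow> sat W' (\<theta>(x := u)) A \<Longrightarrow> W' \<turnstile> C"
  shows "W \<turnstile> C"
proof -
  obtain z where z: "z \<notin> \<Union> (ffv ` W) \<union> ffv C" "snd z = snd x" "wff (fsub (\<theta>(x := Free z)) [] 0 A)"
    "fsub \<theta> [] 0 (ex x A) = ex z (fsub (\<theta>(x := Free z)) [] 0 A)"
    by (rule ex_generic[OF assms(3,4), of "\<Union> (ffv ` W) \<union> ffv C"]) (use assms(2) in simp, blast)
  show ?thesis
  proof (rule ExE[OF assms(1)[unfolded sat_def z(4)]])
    show "insert (fsub (\<theta>(x := Free z)) [] 0 A) W \<turnstile> C"
      using assms(2) z by (intro assms(5)[of _ "Free z"]) (auto simp: sat_def intro: Assm simp del: fun_upd_apply)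
  qed (use z in auto)
qed

text \<open>Replaces induction on \<open>m\<close> outside the system, which is impossible as
  \<open>m\<close> is an arbitrary term. The step is required in extensions of \<open>W\<close>
  because the induction hypothesis enters as an assumption of the context.\<close>

lemma sat_nat_induct:
  assumes "finite W" "okt \<theta>" "wff A" "snd n = N" "sat W (\<theta>(n := Cn Zero)) A"
    and step: "\<And>W' m. finite W' \<Longrightarrow> W \<subseteq> W' \<Longrightarrow> m :| N \<Longrightarrow>
      sat W' (\<theta>(n := m)) A \<Longrightarrow> sat W' (\<theta>(n := Cn Succ \<cdot> m)) A"
    and "m :| N"
  shows "sat W (\<theta>(n := m)) A"
proof -
  obtain z where z: "z \<notin> \<Union> (ffv ` W)" "snd z = snd n" "wff (fsub (\<theta>(n := Free z)) [] 0 A)"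
    "\<And>u. fsubst z u (fsub (\<theta>(n := Free z)) [] 0 A) = fsub (\<theta>(n := u)) [] 0 A"
    by (rule ex_generic[OF assms(2,3), of "\<Union> (ffv ` W)"]) (use assms(1) in simp, blast)
  let ?A = "fsub (\<theta>(n := Free z)) [] 0 A"
  have "insert ?A W \<turnstile> fsubst z (Cn Succ \<cdot> Free z) ?A"
    unfolding z(4) using assms z
    by (intro step[unfolded sat_def]) (auto intro: Assm simp del: fun_upd_apply)
  then have 1: "W \<turnstile> all z (Imp ?A (fsubst z (Cn Succ \<cdot> Free z) ?A))"
    by (intro AllI ImpI z(1,3))
  have 0: "W \<turnstile> fsubst z (Cn Zero) ?A" using assms(5) by (simp only: z(4) sat_def)
  have "W \<turnstile> all z ?A" by (rule Induction[OF _ z(3) 0 1]) (simp add: z(2) assms(4))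
  then have "W \<turnstile> fsubst z m ?A"
    by (rule AllE) (use z(2,3) assms in \<open>simp_all add: has_type_iff del: fun_upd_apply\<close>)
  then show ?thesis by (simp only: z(4) sat_def)
qed

lemma sat_seq_induct:
  assumes "finite W" "okt \<theta>" "wff A" "snd n = Seq \<tau>" "sat W (\<theta>(n := Cn (Empty \<tau>))) A"
    and step: "\<And>W' s x. finite W' \<Longrightarrow> W \<subseteq> W' \<Longrightarrow> s :| (Seq \<tau>) \<Longrightarrow> x :| \<tau> \<Longrightarrow>
      sat W' (\<theta>(n := s)) A \<Longrightarrow> sat W' (\<theta>(n := Cn (Snoc \<tau>) \<cdot> s \<cdot> x)) A"
    and "s :| (Seq \<tau>)"
  shows "sat W (\<theta>(n := s)) A"
proof -
  obtain z where z: "z \<notin> \<Union> (ffv ` W)" "snd z = snd n" "wff (fsub (\<theta>(n := Free z)) [] 0 A)"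
    "\<And>u. fsubst z u (fsub (\<theta>(n := Free z)) [] 0 A) = fsub (\<theta>(n := u)) [] 0 A"
    by (rule ex_generic[OF assms(2,3), of "\<Union> (ffv ` W)"]) (use assms(1) in simp, blast)
  let ?A = "fsub (\<theta>(n := Free z)) [] 0 A"
  obtain x where x: "x \<notin> ffv ?A \<union> \<Union> (ffv ` W)" "snd x = \<tau>"
    using ex_fresh[of "ffv ?A \<union> \<Union> (ffv ` W)"] assms(1) by auto
  let ?t = "Cn (Snoc (snd x)) \<cdot> Free z \<cdot> Free x"
  have "insert ?A W \<turnstile> fsubst z ?t ?A"
    unfolding z(4) x(2) using assms z x
    by (intro step[unfolded sat_def]) (auto intro: Assm simp del: fun_upd_apply)
  then have 1: "W \<turnstile> all z (all x (Imp ?A (fsubst z ?t ?A)))"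
    using x(1) by (intro AllI ImpI z(1,3)) auto
  have 0: "W \<turnstile> fsubst z (Cn (Empty (snd x))) ?A" using assms(5) by (simp only: z(4) sat_def x(2))
  have "W \<turnstile> all z ?A"
    by (rule Seq_Induction[OF _ _ z(3) 0 1]) (use z(2) x assms(4) in simp_all)
  then have "W \<turnstile> fsubst z s ?A"
    by (rule AllE) (use z(2,3) assms in \<open>simp_all add: has_type_iff del: fun_upd_apply\<close>)
  then show ?thesis by (simp only: z(4) sat_def)
qed


abbreviation app_infix ("_ \<bullet>[_] _" [90, 0, 91] 90) where
  "a \<bullet>[W] b \<equiv> app W a b"

section \<open>Equations of the term model\<close>

lemma cls_Rec_Zero [simp]:
  assumes "tyc W a = Some \<rho>" "tyc W f = Some (N \<rightarrow> \<rho> \<rightarrow> \<rho>)"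
  shows "cls W (Cn (Rec \<rho>)) \<bullet>[W] a \<bullet>[W] f \<bullet>[W] cls W (Cn Zero) = a"
proof -
  obtain t where t: "a = cls W t" "t :| \<rho>" using assms(1) by (rule tyc_repE)
  obtain u where u: "f = cls W u" "u :| (N \<rightarrow> \<rho> \<rightarrow> \<rho>)" using assms(2) by (rule tyc_repE)
  have "cls W (Cn (Rec \<rho>) \<cdot> t \<cdot> u \<cdot> Cn Zero) = cls W t"
    using t u by (subst cls_eq_iff[of _ \<rho>]) (auto intro!: Rec_Zero simp: has_type_iff)
  with t u show ?thesis by simp
qed

lemma cls_Rec_Succ [simp]:
  assumes "tyc W a = Some \<rho>" "tyc W f = Some (N \<rightarrow> \<rho> \<rightarrow> \<rho>)" "tyc W m = Some N"
  shows "cls W (Cn (Rec \<rho>)) \<bullet>[W] a \<bullet>[W] f \<bullet>[W] (cls W (Cn Succ) \<bullet>[W] m) =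
    f \<bullet>[W] m \<bullet>[W] (cls W (Cn (Rec \<rho>)) \<bullet>[W] a \<bullet>[W] f \<bullet>[W] m)"
proof -
  obtain t where t: "a = cls W t" "t :| \<rho>" using assms(1) by (rule tyc_repE)
  obtain u where u: "f = cls W u" "u :| (N \<rightarrow> \<rho> \<rightarrow> \<rho>)" using assms(2) by (rule tyc_repE)
  obtain v where v: "m = cls W v" "v :| N" using assms(3) by (rule tyc_repE)
  have "cls W (Cn (Rec \<rho>) \<cdot> t \<cdot> u \<cdot> (Cn Succ \<cdot> v)) = cls W (u \<cdot> v \<cdot> (Cn (Rec \<rho>) \<cdot> t \<cdot> u \<cdot> v))"
    using t u v by (subst cls_eq_iff[of _ \<rho>]) (auto intro!: Rec_Succ simp: has_type_iff)
  with t u v show ?thesis by simp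
qed

lemma cls_SeqRec_Empty [simp]:
  assumes "tyc W a = Some \<rho>" "tyc W f = Some (Seq \<tau> \<rightarrow> \<tau> \<rightarrow> \<rho> \<rightarrow> \<rho>)"
  shows "cls W (Cn (SeqRec \<tau> \<rho>)) \<bullet>[W] a \<bullet>[W] f \<bullet>[W] cls W (Cn (Empty \<tau>)) = a"
proof -
  obtain t where t: "a = cls W t" "t :| \<rho>" using assms(1) by (rule tyc_repE)
  obtain u where u: "f = cls W u" "u :| (Seq \<tau> \<rightarrow> \<tau> \<rightarrow> \<rho> \<rightarrow> \<rho>)" using assms(2) by (rule tyc_repE)
  have "cls W (Cn (SeqRec \<tau> \<rho>) \<cdot> t \<cdot> u \<cdot> Cn (Empty \<tau>)) = cls W t"
    using t u by (subst cls_eq_iff[of _ \<rho>]) (auto intro!: SeqRec_Empty simp: has_type_iff)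
  with t u show ?thesis by simp
qed

lemma cls_SeqRec_Snoc [simp]:
  assumes "tyc W a = Some \<rho>" "tyc W f = Some (Seq \<tau> \<rightarrow> \<tau> \<rightarrow> \<rho> \<rightarrow> \<rho>)"
    "tyc W s = Some (Seq \<tau>)" "tyc W b = Some \<tau>"
  shows "cls W (Cn (SeqRec \<tau> \<rho>)) \<bullet>[W] a \<bullet>[W] f \<bullet>[W] (cls W (Cn (Snoc \<tau>)) \<bullet>[W] s \<bullet>[W] b) =
    f \<bullet>[W] s \<bullet>[W] b \<bullet>[W] (cls W (Cn (SeqRec \<tau> \<rho>)) \<bullet>[W] a \<bullet>[W] f \<bullet>[W] s)"
proof -
  obtain t where t: "a = cls W t" "t :| \<rho>" using assms(1) by (rule tyc_repE)
  obtain u where u: "f = cls W u" "u :| (Seq \<tau> \<rightarrow> \<tau> \<rightarrow> \<rho> \<rightarrow> \<rho>)" using assms(2) by (rule tyc_repE)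
  obtain v where v: "s = cls W v" "v :| (Seq \<tau>)" using assms(3) by (rule tyc_repE)
  obtain w where w: "b = cls W w" "w :| \<tau>" using assms(4) by (rule tyc_repE)
  have "cls W (Cn (SeqRec \<tau> \<rho>) \<cdot> t \<cdot> u \<cdot> (Cn (Snoc \<tau>) \<cdot> v \<cdot> w)) = cls W (u \<cdot> v \<cdot> w \<cdot> (Cn (SeqRec \<tau> \<rho>) \<cdot> t \<cdot> u \<cdot> v))"
    using t u v w by (subst cls_eq_iff[of _ \<rho>]) (auto intro!: SeqRec_Snoc simp: has_type_iff)
  with t u v w show ?thesis by simp
qed

lemma cls_Fst_Pair [simp]:
  assumes "tyc W a = Some \<tau>" "tyc W b = Some \<rho>"
  shows "cls W (Cn (Fst \<tau> \<rho>)) \<bullet>[W] (cls W (Cn (MkPair \<tau> \<rho>)) \<bullet>[W] a \<bullet>[W] b) = a"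
    "cls W (Cn (Snd \<tau> \<rho>)) \<bullet>[W] (cls W (Cn (MkPair \<tau> \<rho>)) \<bullet>[W] a \<bullet>[W] b) = b"
proof -
  obtain t where t: "a = cls W t" "t :| \<tau>" using assms(1) by (rule tyc_repE)
  obtain u where u: "b = cls W u" "u :| \<rho>" using assms(2) by (rule tyc_repE)
  have "cls W (Cn (Fst \<tau> \<rho>) \<cdot> (Cn (MkPair \<tau> \<rho>) \<cdot> t \<cdot> u)) = cls W t"
    using t u by (subst cls_eq_iff[of _ \<tau>]) (auto intro!: Fst_Pair simp: has_type_iff)
  with t u show "cls W (Cn (Fst \<tau> \<rho>)) \<bullet>[W] (cls W (Cn (MkPair \<tau> \<rho>)) \<bullet>[W] a \<bullet>[W] b) = a" by simp
  have "cls W (Cn (Snd \<tau> \<rho>) \<cdot> (Cn (MkPair \<tau> \<rho>) \<cdot> t \<cdot> u)) = cls W u"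
    using t u by (subst cls_eq_iff[of _ \<rho>]) (auto intro!: Snd_Pair simp: has_type_iff)
  with t u show "cls W (Cn (Snd \<tau> \<rho>)) \<bullet>[W] (cls W (Cn (MkPair \<tau> \<rho>)) \<bullet>[W] a \<bullet>[W] b) = b" by simp
qed

text \<open>A world in which zero equals a successor is inconsistent and forces every well-formed
  formula. All impossible cases below end here.\<close>

lemma cls_Zero_Succ:
  assumes "cls W (Cn Zero) = cls W (Cn Succ \<cdot> m)" "m :| N" "wff C"
  shows "W \<turnstile> C"
proof -
  have "W \<turnstile> Cn Succ \<cdot> m \<doteq> Cn Zero" using assms cls_eq_iff[of "Cn Succ \<cdot> m" N "Cn Zero" W] by simp
  then show ?thesis using assms Succ_not_Zero[of m W] by (auto simp: has_type_iff intro: BotE ImpE)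
qed

lemma cls_Zero_Succ_eq:
  assumes "cls W (Cn Zero) = cls W (Cn Succ \<cdot> m)" "m :| N"
    "t :| \<rho>" "u :| \<rho>"
  shows "cls W t = cls W u"
  using cls_Zero_Succ[OF assms(1,2), of "t \<doteq> u"] assms by (auto simp: cls_eq_iff has_type_iff)

lemma cls_Succ_inject:
  assumes "cls W (Cn Succ \<cdot> m) = cls W (Cn Succ \<cdot> n)" "m :| N" "n :| N"
  shows "cls W m = cls W n"
proof -
  have "W \<turnstile> Cn Succ \<cdot> m \<doteq> Cn Succ \<cdot> n"
    using assms cls_eq_iff[of "Cn Succ \<cdot> m" N "Cn Succ \<cdot> n" W] by simp
  then show ?thesis using assms Succ_inject[of m n W] by (auto simp: has_type_iff cls_eq_iff intro: ImpE)
qed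

lemma sat_DisjI:
  assumes "okt \<theta>" "wff A" "wff B" "sat W \<theta> A \<or> sat W \<theta> B"
  shows "sat W \<theta> (Disj A B)"
  using assms by (auto simp: sat_def wff_fsub0 intro: DisjI1 DisjI2)

text \<open>Being zero or a successor is proved as a disjunction by induction in the system, and
  then eliminated towards \<open>C\<close>.\<close>

lemma num_cases:
  assumes "finite W" "n :| N"
    and zero: "\<And>W'. finite W' \<Longrightarrow> W \<subseteq> W' \<Longrightarrow> cls W' n = cls W' (Cn Zero) \<Longrightarrow> W' \<turnstile> C"
    and succ: "\<And>W' m. finite W' \<Longrightarrow> W \<subseteq> W' \<Longrightarrow> m :| N \<Longrightarrow>
      cls W' n = cls W' (Cn Succ \<cdot> m) \<Longrightarrow> W' \<turnstile> C"
  shows "W \<turnstile> C"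
proof -
  let ?n = "(''n'', N)" and ?m = "(''m'', N)"
  let ?Z = "Free ?n \<doteq> Cn Zero" and ?S = "ex ?m (Free ?n \<doteq> Cn Succ \<cdot> Free ?m)"
  have wff: "wff ?Z" "wff ?S" "wff (Free ?n \<doteq> Cn Succ \<cdot> Free ?m)" by (simp_all add: has_type_iff)
  have "sat W (Free(?n := n)) (Disj ?Z ?S)"
  proof (rule sat_nat_induct[where n = ?n and \<theta> = Free])
    show "sat W (Free(?n := Cn Zero)) (Disj ?Z ?S)"
      by (rule sat_DisjI) (use wff assms(1) in simp_all)
  next
    fix W' m assume G: "finite W'" "W \<subseteq> W'" "m :| N"
    have "sat W' (Free(?n := Cn Succ \<cdot> m)) ?S"
      by (rule sat_exI[where u = m]) (use wff G in simp_all)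
    then show "sat W' (Free(?n := Cn Succ \<cdot> m)) (Disj ?Z ?S)"
      using wff G by (intro sat_DisjI) simp_all
  qed (use wff assms in simp_all)
  then have "W \<turnstile> Disj (fsub (Free(?n := n)) [] 0 ?Z) (fsub (Free(?n := n)) [] 0 ?S)"
    by (simp add: sat_def del: fun_upd_apply)
  then show ?thesis
  proof (rule DisjE)
    let ?G = "insert (fsub (Free(?n := n)) [] 0 ?Z) W"
    have "sat ?G (Free(?n := n)) ?Z" unfolding sat_def by (rule Assm) simp
    then have "cls ?G n = cls ?G (Cn Zero)" using assms by simp
    then show "?G \<turnstile> C" using assms(1) by (intro zero) auto
  next
    let ?G = "insert (fsub (Free(?n := n)) [] 0 ?S) W"
    have "sat ?G (Free(?n := n)) ?S" unfolding sat_def by (rule Assm) simp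
    then show "?G \<turnstile> C"
    proof (rule sat_exE)
      fix W' u
      assume G: "finite W'" "?G \<subseteq> W'" "u :| (snd ?m)"
        "sat W' (Free(?n := n, ?m := u)) (Free ?n \<doteq> Cn Succ \<cdot> Free ?m)"
      then have "cls W' n = cls W' (Cn Succ \<cdot> u)" using assms by simp
      with G show "W' \<turnstile> C" by (intro succ) auto
    qed (use wff assms in simp_all)
  qed
qed

text \<open>Equality of classes of typed terms is derivability of an equation, so it is an
  admissible goal for a case distinction, and the result returns to the original world.\<close>

lemma num_cases_eq:
  assumes "finite W" "n :| N" "t :| \<rho>" "u :| \<rho>"
    and "\<And>W'. finite W' \<Longrightarrow> W \<subseteq> W' \<Longrightarrow> cls W' n = cls W' (Cn Zero) \<Longrightarrow> cls W' t = cls W' u"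
    and "\<And>W' m. finite W' \<Longrightarrow> W \<subseteq> W' \<Longrightarrow> m :| N \<Longrightarrow>
      cls W' n = cls W' (Cn Succ \<cdot> m) \<Longrightarrow> cls W' t = cls W' u"
  shows "cls W t = cls W u"
proof -
  have "W \<turnstile> t \<doteq> u"
    by (rule num_cases[OF assms(1,2)]) (use assms(3-6) in \<open>simp_all add: cls_eq_iff\<close>)
  then show ?thesis using assms by (simp add: cls_eq_iff)
qed

lemma sem_cong: "(\<And>x. x \<in> fv t \<Longrightarrow> \<rho> x = \<rho>' x) \<Longrightarrow> sem W \<rho> t = sem W \<rho>' t"
  unfolding sem_def by (auto intro!: arg_cong[where f = "cls W"] sub_cong)


section \<open>Sequences\<close>

declare snoc_def [simp]

lemma len_closed [simp]: "len :| (Seq N \<rightarrow> N)" "fv len = {}"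
  by (auto simp: len_def Let_def)

lemma append_closed [simp]: "append :| (Seq N \<rightarrow> Seq N \<rightarrow> Seq N)" "fv append = {}"
  by (auto simp: append_def Let_def)

lemma prepend_closed [simp]: "prepend :| (Seq N \<rightarrow> (N \<rightarrow> N) \<rightarrow> N \<rightarrow> N)" "fv prepend = {}"
  by (auto simp: prepend_def Let_def)

lemma hat_closed [simp]: "hat :| (Seq N \<rightarrow> N \<rightarrow> N)" "fv hat = {}"
  by (auto simp: hat_def Let_def)

lemma initial_closed [simp]: "initial :| ((N \<rightarrow> N) \<rightarrow> N \<rightarrow> Seq N)" "fv initial = {}"
  by (auto simp: initial_def Let_def)

lemma predecessor_closed [simp]: "predecessor :| (N \<rightarrow> N)" "fv predecessor = {}"
  by (auto simp: predecessor_def Let_def)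

lemma monus_closed [simp]: "monus :| (N \<rightarrow> N \<rightarrow> N)" "fv monus = {}"
  by (auto simp: monus_def Let_def)

lemma if_zero_closed [simp]: "(if_zero \<rho>) :| (N \<rightarrow> \<rho> \<rightarrow> \<rho> \<rightarrow> \<rho>)" "fv (if_zero \<rho>) = {}"
  by (auto simp: if_zero_def Let_def)

lemma phi_closed [simp]: "(phi \<sigma>) :| (GT \<sigma> \<rightarrow> HT \<sigma> \<rightarrow> N \<rightarrow> Seq N \<rightarrow> \<sigma>)" "fv (phi \<sigma>) = {}"
  by (auto simp: phi_def Let_def)

lemma Psi_closed [simp]: "(Psi \<sigma>) :| (N \<rightarrow> GT \<sigma> \<rightarrow> HT \<sigma> \<rightarrow> Seq N \<rightarrow> \<sigma>)" "fv (Psi \<sigma>) = {}"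
  by (auto simp: Psi_def Let_def)

text \<open>The sequence x, \<beta>(0), \<beta>(1), ... that occurs inlined in
  \<open>prepend\<close>. As a closed term it can serve as an instance in induction
  hypotheses.\<close>

definition cons :: tm where
  "cons = (let x = (''x'', N); \<beta> = (''b'', N \<rightarrow> N); m = (''m'', N); p = (''p'', N) in
     lam x (lam \<beta> (Cn (Rec N) \<cdot> Free x \<cdot> lam m (lam p (Free \<beta> \<cdot> Free m)))))"

text \<open>The continuation \<lambda>x. b(s * x) of bar recursion as a closed combinator, so that
  its uses are compared by application alone.\<close>

definition shift :: "ty \<Rightarrow> tm" where
  "shift \<sigma> = (let b = (''b'', Seq N \<rightarrow> \<sigma>); s = (''s'', Seq N); x = (''x'', N) in
     lam b (lam s (lam x (Free b \<cdot> (snoc \<cdot> Free s \<cdot> Free x)))))"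

text \<open>Serves to name a common upper bound of two lengths of initial segments.\<close>

definition plus :: tm where
  "plus = (let n = (''n'', N); m = (''m'', N); r = (''r'', N) in
     lam n (Cn (Rec N) \<cdot> Free n \<cdot> lam m (lam r (Cn Succ \<cdot> Free r))))"

lemma cons_closed [simp]: "cons :| (N \<rightarrow> (N \<rightarrow> N) \<rightarrow> N \<rightarrow> N)" "fv cons = {}"
  by (auto simp: cons_def Let_def)

lemma shift_closed [simp]: "(shift \<sigma>) :| ((Seq N \<rightarrow> \<sigma>) \<rightarrow> Seq N \<rightarrow> N \<rightarrow> \<sigma>)" "fv (shift \<sigma>) = {}"
  by (auto simp: shift_def Let_def)

lemma plus_closed [simp]: "plus :| (N \<rightarrow> N \<rightarrow> N)" "fv plus = {}"
  by (auto simp: plus_def Let_def)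

context
  fixes W :: "fm set" assumes fin [simp]: "finite W"
begin

lemma sem_consts [simp]:
  assumes "okv W \<rho>"
  shows "sem W \<rho> len = cls W len" "sem W \<rho> append = cls W append"
    "sem W \<rho> prepend = cls W prepend" "sem W \<rho> hat = cls W hat"
    "sem W \<rho> initial = cls W initial" "sem W \<rho> predecessor = cls W predecessor"
    "sem W \<rho> monus = cls W monus" "sem W \<rho> (if_zero \<kappa>) = cls W (if_zero \<kappa>)"
    "sem W \<rho> (phi \<sigma>) = cls W (phi \<sigma>)" "sem W \<rho> (Psi \<sigma>) = cls W (Psi \<sigma>)"
    "sem W \<rho> cons = cls W cons" "sem W \<rho> (shift \<sigma>) = cls W (shift \<sigma>)"
    "sem W \<rho> plus = cls W plus"
  using assms by (simp_all add: sem_closed)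

lemma len_simps [simp]:
  "cls W len \<bullet>[W] cls W (Cn (Empty N)) = cls W (Cn Zero)"
  "tyc W s = Some (Seq N) \<Longrightarrow> tyc W x = Some N \<Longrightarrow>
    cls W len \<bullet>[W] (cls W (Cn (Snoc N)) \<bullet>[W] s \<bullet>[W] x) = cls W (Cn Succ) \<bullet>[W] (cls W len \<bullet>[W] s)"
  by (simp_all add: len_def Let_def)

lemma append_simps [simp]:
  "tyc W s = Some (Seq N) \<Longrightarrow> cls W append \<bullet>[W] s \<bullet>[W] cls W (Cn (Empty N)) = s"
  "tyc W s = Some (Seq N) \<Longrightarrow> tyc W t = Some (Seq N) \<Longrightarrow> tyc W x = Some N \<Longrightarrow>
    cls W append \<bullet>[W] s \<bullet>[W] (cls W (Cn (Snoc N)) \<bullet>[W] t \<bullet>[W] x) =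
    cls W (Cn (Snoc N)) \<bullet>[W] (cls W append \<bullet>[W] s \<bullet>[W] t) \<bullet>[W] x"
  by (simp_all add: append_def Let_def)

lemma cons_simps [simp]:
  "tyc W x = Some N \<Longrightarrow> tyc W b = Some (N \<rightarrow> N) \<Longrightarrow>
    cls W cons \<bullet>[W] x \<bullet>[W] b \<bullet>[W] cls W (Cn Zero) = x"
  "tyc W x = Some N \<Longrightarrow> tyc W b = Some (N \<rightarrow> N) \<Longrightarrow> tyc W m = Some N \<Longrightarrow>
    cls W cons \<bullet>[W] x \<bullet>[W] b \<bullet>[W] (cls W (Cn Succ) \<bullet>[W] m) = b \<bullet>[W] m"
  by (simp_all add: cons_def Let_def)

lemma prepend_simps [simp]:
  "tyc W b = Some (N \<rightarrow> N) \<Longrightarrow> cls W prepend \<bullet>[W] cls W (Cn (Empty N)) \<bullet>[W] b = b"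
  "tyc W s = Some (Seq N) \<Longrightarrow> tyc W x = Some N \<Longrightarrow> tyc W b = Some (N \<rightarrow> N) \<Longrightarrow>
    cls W prepend \<bullet>[W] (cls W (Cn (Snoc N)) \<bullet>[W] s \<bullet>[W] x) \<bullet>[W] b =
    cls W prepend \<bullet>[W] s \<bullet>[W] (cls W cons \<bullet>[W] x \<bullet>[W] b)"
  \<comment> \<open>After evaluation the two sides differ only in assignments to variables that do
    not occur in the remaining abstraction.\<close>
  by (simp_all add: prepend_def cons_def Let_def, rule arg_cong2[where f = "app W", OF refl],
      rule arg_cong2[where f = "app W", OF refl], rule sem_cong, simp)

lemma hat_simps [simp]:
  "tyc W s = Some (Seq N) \<Longrightarrow>
    cls W hat \<bullet>[W] s = cls W prepend \<bullet>[W] s \<bullet>[W] cls W (lam (''m'', N) (Cn Zero))"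
  by (simp add: hat_def Let_def sem_closed)

lemma initial_simps [simp]:
  "tyc W a = Some (N \<rightarrow> N) \<Longrightarrow> cls W initial \<bullet>[W] a \<bullet>[W] cls W (Cn Zero) = cls W (Cn (Empty N))"
  "tyc W a = Some (N \<rightarrow> N) \<Longrightarrow> tyc W n = Some N \<Longrightarrow>
    cls W initial \<bullet>[W] a \<bullet>[W] (cls W (Cn Succ) \<bullet>[W] n) =
    cls W (Cn (Snoc N)) \<bullet>[W] (cls W initial \<bullet>[W] a \<bullet>[W] n) \<bullet>[W] (a \<bullet>[W] n)"
  by (simp_all add: initial_def Let_def)

lemma predecessor_simps [simp]:
  "cls W predecessor \<bullet>[W] cls W (Cn Zero) = cls W (Cn Zero)"
  "tyc W n = Some N \<Longrightarrow> cls W predecessor \<bullet>[W] (cls W (Cn Succ) \<bullet>[W] n) = n"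
  by (simp_all add: predecessor_def Let_def)

lemma monus_simps [simp]:
  "tyc W k = Some N \<Longrightarrow> cls W monus \<bullet>[W] k \<bullet>[W] cls W (Cn Zero) = k"
  "tyc W k = Some N \<Longrightarrow> tyc W n = Some N \<Longrightarrow>
    cls W monus \<bullet>[W] k \<bullet>[W] (cls W (Cn Succ) \<bullet>[W] n) = cls W predecessor \<bullet>[W] (cls W monus \<bullet>[W] k \<bullet>[W] n)"
  by (simp_all add: monus_def Let_def)

lemma plus_simps [simp]:
  "tyc W k = Some N \<Longrightarrow> cls W plus \<bullet>[W] k \<bullet>[W] cls W (Cn Zero) = k"
  "tyc W k = Some N \<Longrightarrow> tyc W n = Some N \<Longrightarrow>
    cls W plus \<bullet>[W] k \<bullet>[W] (cls W (Cn Succ) \<bullet>[W] n) = cls W (Cn Succ) \<bullet>[W] (cls W plus \<bullet>[W] k \<bullet>[W] n)"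
  by (simp_all add: plus_def Let_def)

lemma if_zero_simps [simp]:
  "tyc W a = Some \<rho> \<Longrightarrow> tyc W b = Some \<rho> \<Longrightarrow>
    cls W (if_zero \<rho>) \<bullet>[W] cls W (Cn Zero) \<bullet>[W] a \<bullet>[W] b = a"
  "tyc W a = Some \<rho> \<Longrightarrow> tyc W b = Some \<rho> \<Longrightarrow> tyc W n = Some N \<Longrightarrow>
    cls W (if_zero \<rho>) \<bullet>[W] (cls W (Cn Succ) \<bullet>[W] n) \<bullet>[W] a \<bullet>[W] b = b"
  by (simp_all add: if_zero_def Let_def)

lemma shift_simps [simp]:
  "tyc W b = Some (Seq N \<rightarrow> \<sigma>) \<Longrightarrow> tyc W s = Some (Seq N) \<Longrightarrow> tyc W x = Some N \<Longrightarrow>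
    cls W (shift \<sigma>) \<bullet>[W] b \<bullet>[W] s \<bullet>[W] x = b \<bullet>[W] (cls W (Cn (Snoc N)) \<bullet>[W] s \<bullet>[W] x)"
  by (simp add: shift_def Let_def)

lemma eq_shift:
  assumes f: "tyc W f = Some (N \<rightarrow> \<sigma>)" and b: "tyc W b = Some (Seq N \<rightarrow> \<sigma>)"
    and s: "tyc W s = Some (Seq N)"
    and eq: "\<And>x. tyc W x = Some N \<Longrightarrow> f \<bullet>[W] x = b \<bullet>[W] (cls W (Cn (Snoc N)) \<bullet>[W] s \<bullet>[W] x)"
  shows "f = cls W (shift \<sigma>) \<bullet>[W] b \<bullet>[W] s"
proof (rule app_ext[OF fin f])
  show "tyc W (cls W (shift \<sigma>) \<bullet>[W] b \<bullet>[W] s) = Some (N \<rightarrow> \<sigma>)" using b s by simp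
  show "f \<bullet>[W] x = cls W (shift \<sigma>) \<bullet>[W] b \<bullet>[W] s \<bullet>[W] x" if "tyc W x = Some N" for x
    using b s eq that by simp
qed

lemma phi_simps [simp]:
  "tyc W G = Some (GT \<sigma>) \<Longrightarrow> tyc W H = Some (HT \<sigma>) \<Longrightarrow>
    cls W (phi \<sigma>) \<bullet>[W] G \<bullet>[W] H \<bullet>[W] cls W (Cn Zero) = G"
  "tyc W G = Some (GT \<sigma>) \<Longrightarrow> tyc W H = Some (HT \<sigma>) \<Longrightarrow> tyc W n = Some N \<Longrightarrow> tyc W s = Some (Seq N) \<Longrightarrow>
    cls W (phi \<sigma>) \<bullet>[W] G \<bullet>[W] H \<bullet>[W] (cls W (Cn Succ) \<bullet>[W] n) \<bullet>[W] s =
    H \<bullet>[W] s \<bullet>[W] (cls W (shift \<sigma>) \<bullet>[W] (cls W (phi \<sigma>) \<bullet>[W] G \<bullet>[W] H \<bullet>[W] n) \<bullet>[W] s)"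
  by (simp_all add: phi_def Let_def, rule arg_cong2[where f = "app W", OF refl], rule eq_shift, simp_all)

end


section \<open>Arithmetic of lengths, initial segments and entries\<close>

text \<open>Addition recurses on its second argument, so the equations for the first one need an
  induction inside the system.\<close>

lemma plus_left [simp]:
  assumes "finite W" "n :| N" "m :| N"
  shows "cls W plus \<bullet>[W] cls W (Cn Zero) \<bullet>[W] cls W m = cls W m"
    and "cls W plus \<bullet>[W] (cls W (Cn Succ) \<bullet>[W] cls W n) \<bullet>[W] cls W m =
      cls W (Cn Succ) \<bullet>[W] (cls W plus \<bullet>[W] cls W n \<bullet>[W] cls W m)"
proof -
  let ?n = "(''n'', N)" and ?m = "(''m'', N)"
  have "sat W (Free(?m := m)) (plus \<cdot> Cn Zero \<cdot> Free ?m \<doteq> Free ?m)"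
    by (rule sat_nat_induct) (use assms in \<open>simp_all add: has_type_iff\<close>)
  then show "cls W plus \<bullet>[W] cls W (Cn Zero) \<bullet>[W] cls W m = cls W m"
    using assms by simp
  have "sat W (Free(?n := n, ?m := m)) (plus \<cdot> (Cn Succ \<cdot> Free ?n) \<cdot> Free ?m \<doteq> Cn Succ \<cdot> (plus \<cdot> Free ?n \<cdot> Free ?m))"
    by (rule sat_nat_induct) (use assms in \<open>simp_all add: has_type_iff\<close>)
  then show "cls W plus \<bullet>[W] (cls W (Cn Succ) \<bullet>[W] cls W n) \<bullet>[W] cls W m =
      cls W (Cn Succ) \<bullet>[W] (cls W plus \<bullet>[W] cls W n \<bullet>[W] cls W m)"
    using assms by simp
qed

lemma monus_Succ_Succ:
  assumes "finite W" "k :| N" "m :| N"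
  shows "cls W predecessor \<bullet>[W] (cls W monus \<bullet>[W] (cls W (Cn Succ) \<bullet>[W] cls W k) \<bullet>[W] cls W m) =
    cls W monus \<bullet>[W] cls W k \<bullet>[W] cls W m"
proof -
  let ?k = "(''k'', N)" and ?m = "(''m'', N)"
  have "sat W (Free(?k := k, ?m := m))
    (predecessor \<cdot> (monus \<cdot> (Cn Succ \<cdot> Free ?k) \<cdot> Free ?m) \<doteq> monus \<cdot> Free ?k \<cdot> Free ?m)"
    by (rule sat_nat_induct) (use assms in \<open>simp_all add: has_type_iff\<close>)
  then show ?thesis using assms by simp
qed

lemma monus_self [simp]:
  assumes "finite W" "k :| N"
  shows "cls W monus \<bullet>[W] cls W k \<bullet>[W] cls W k = cls W (Cn Zero)"
proof -
  let ?k = "(''k'', N)"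
  have "sat W (Free(?k := k)) (monus \<cdot> Free ?k \<cdot> Free ?k \<doteq> Cn Zero)"
    by (rule sat_nat_induct) (use assms in \<open>simp_all add: has_type_iff monus_Succ_Succ\<close>)
  then show ?thesis using assms by simp
qed

lemma len_initial [simp]:
  assumes "finite W" "a :| (N \<rightarrow> N)" "n :| N"
  shows "cls W len \<bullet>[W] (cls W initial \<bullet>[W] cls W a \<bullet>[W] cls W n) = cls W n"
proof -
  let ?a = "(''a'', N \<rightarrow> N)" and ?n = "(''n'', N)"
  have "sat W (Free(?a := a, ?n := n)) (len \<cdot> (initial \<cdot> Free ?a \<cdot> Free ?n) \<doteq> Free ?n)"
    by (rule sat_nat_induct) (use assms in \<open>simp_all add: has_type_iff\<close>)
  then show ?thesis using assms by simp
qed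

text \<open>Two initial segments of \<open>a\<close> are brought to the common length
  \<open>n + m\<close>: a property that survives one further entry passes from either of them to the
  longer one. The property is coded as an equation \<open>c t = r\<close>, which keeps it a formula
  with parameters and so admits induction, on \<open>m\<close> in the first part and on
  \<open>n\<close> in the second.\<close>

lemma initial_plus:
  assumes "finite W" "c :| (Seq N \<rightarrow> \<rho>)" "a :| (N \<rightarrow> N)"
    "n :| N" "m :| N" "r :| \<rho>"
    and step: "\<And>W' t x. finite W' \<Longrightarrow> W \<subseteq> W' \<Longrightarrow> t :| (Seq N) \<Longrightarrow> x :| N \<Longrightarrow>
      cls W' (c \<cdot> t) = cls W' r \<Longrightarrow> cls W' (c \<cdot> (Cn (Snoc N) \<cdot> t \<cdot> x)) = cls W' r"
  shows "cls W (c \<cdot> (initial \<cdot> a \<cdot> n)) = cls W r \<Longrightarrow> cls W (c \<cdot> (initial \<cdot> a \<cdot> (plus \<cdot> n \<cdot> m))) = cls W r"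
    and "cls W (c \<cdot> (initial \<cdot> a \<cdot> m)) = cls W r \<Longrightarrow> cls W (c \<cdot> (initial \<cdot> a \<cdot> (plus \<cdot> n \<cdot> m))) = cls W r"
proof -
  let ?c = "(''c'', Seq N \<rightarrow> \<rho>)" and ?a = "(''a'', N \<rightarrow> N)" and ?r = "(''r'', \<rho>)"
    and ?n = "(''n'', N)" and ?m = "(''m'', N)"
  let ?A = "Free ?c \<cdot> (initial \<cdot> Free ?a \<cdot> (plus \<cdot> Free ?n \<cdot> Free ?m)) \<doteq> Free ?r"
  {
    assume 0: "cls W (c \<cdot> (initial \<cdot> a \<cdot> n)) = cls W r"
    have "sat W (Free(?c := c, ?a := a, ?r := r, ?n := n, ?m := m)) ?A"
    proof (rule sat_nat_induct)
      fix W' m assume G: "finite W'" "W \<subseteq> W'" "m :| N"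
        "sat W' (Free(?c := c, ?a := a, ?r := r, ?n := n, ?m := m)) ?A"
      then show "sat W' (Free(?c := c, ?a := a, ?r := r, ?n := n, ?m := Cn Succ \<cdot> m)) ?A"
        using step[of W' "initial \<cdot> a \<cdot> (plus \<cdot> n \<cdot> m)" "a \<cdot> (plus \<cdot> n \<cdot> m)"] assms by simp
    qed (use assms 0 in \<open>simp_all add: has_type_iff\<close>)
    then show "cls W (c \<cdot> (initial \<cdot> a \<cdot> (plus \<cdot> n \<cdot> m))) = cls W r" using assms by simp
  next
    assume 0: "cls W (c \<cdot> (initial \<cdot> a \<cdot> m)) = cls W r"
    have "sat W (Free(?c := c, ?a := a, ?r := r, ?m := m, ?n := n)) ?A"
    proof (rule sat_nat_induct)
      fix W' n assume G: "finite W'" "W \<subseteq> W'" "n :| N"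
        "sat W' (Free(?c := c, ?a := a, ?r := r, ?m := m, ?n := n)) ?A"
      then show "sat W' (Free(?c := c, ?a := a, ?r := r, ?m := m, ?n := Cn Succ \<cdot> n)) ?A"
        using step[of W' "initial \<cdot> a \<cdot> (plus \<cdot> n \<cdot> m)" "a \<cdot> (plus \<cdot> n \<cdot> m)"] assms by simp
    qed (use assms 0 in \<open>simp_all add: has_type_iff\<close>)
    then show "cls W (c \<cdot> (initial \<cdot> a \<cdot> (plus \<cdot> n \<cdot> m))) = cls W r" using assms by simp
  }
qed

text \<open>The number (k + 1) - |s| has two readings: it is zero exactly if |s| > k, and otherwise
  it is the recursion depth that \<Psi>(k) still has at s.\<close>

abbreviation excess :: "tm \<Rightarrow> tm \<Rightarrow> tm" where
  "excess k s \<equiv> monus \<cdot> (Cn Succ \<cdot> k) \<cdot> (len \<cdot> s)"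

text \<open>The assumption says |s| + m = k. Both \<open>m\<close> and \<open>b\<close> must vary in
  the induction on \<open>s\<close>, because the last entry of \<open>s\<close> moves over to the
  infinite part.\<close>

lemma prepend_beyond:
  assumes "finite W" "k :| N" "s :| (Seq N)" "m :| N"
    "b :| (N \<rightarrow> N)" "cls W (excess k s) = cls W (Cn Succ \<cdot> m)"
  shows "cls W (prepend \<cdot> s \<cdot> b \<cdot> k) = cls W (b \<cdot> m)"
proof -
  let ?k = "(''k'', N)" and ?s = "(''s'', Seq N)" and ?m = "(''m'', N)" and ?b = "(''b'', N \<rightarrow> N)"
  let ?A = "all ?m (all ?b (Imp (excess (Free ?k) (Free ?s) \<doteq> Cn Succ \<cdot> Free ?m)
    (prepend \<cdot> Free ?s \<cdot> Free ?b \<cdot> Free ?k \<doteq> Free ?b \<cdot> Free ?m)))"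
  have "sat W (Free(?k := k, ?s := s)) ?A"
  proof (rule sat_seq_induct)
    show "sat W (Free(?k := k, ?s := Cn (Empty N))) ?A"
      using assms by (auto simp: has_type_iff dest: cls_Succ_inject[simplified])
  next
    fix W' s x assume G: "finite W'" "W \<subseteq> W'" "s :| (Seq N)" "x :| N"
      and IH: "sat W' (Free(?k := k, ?s := s)) ?A"
    have "cls W'' (prepend \<cdot> (Cn (Snoc N) \<cdot> s \<cdot> x) \<cdot> b \<cdot> k) = cls W'' (b \<cdot> m)"
      if "finite W''" "W' \<subseteq> W''" "m :| N" "b :| (N \<rightarrow> N)"
        "cls W'' (predecessor \<cdot> excess k s) = cls W'' (Cn Succ \<cdot> m)" for W'' m b
    proof (rule num_cases_eq[of W'' "excess k s" _ N])
      \<comment> \<open>The predecessor of zero is zero, so here the assumption on the longer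
        sequence becomes 0 = m + 1.\<close>
      fix D assume D: "finite D" "W'' \<subseteq> D" "cls D (excess k s) = cls D (Cn Zero)"
      have "cls D (predecessor \<cdot> excess k s) = cls D (Cn Succ \<cdot> m)"
        by (rule cls_mono[of W'']) (use that D in auto)
      with D have "cls D (Cn Zero) = cls D (Cn Succ \<cdot> m)" by simp
      then show "cls D (prepend \<cdot> (Cn (Snoc N) \<cdot> s \<cdot> x) \<cdot> b \<cdot> k) = cls D (b \<cdot> m)"
        by (rule cls_Zero_Succ_eq) (use that G assms in simp_all)
    next
      fix D m' assume D: "finite D" "W'' \<subseteq> D" "m' :| N" "cls D (excess k s) = cls D (Cn Succ \<cdot> m')"
      have "cls D (predecessor \<cdot> excess k s) = cls D (Cn Succ \<cdot> m)"
        by (rule cls_mono[of W'']) (use that D in auto)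
      with D have "cls D m' = cls D (Cn Succ \<cdot> m)" by simp
      with D have *: "cls D (excess k s) = cls D (Cn Succ \<cdot> (Cn Succ \<cdot> m))" by simp
      have "sat D (Free(?k := k, ?s := s)) ?A" using IH by (rule sat_mono) (use D that in auto)
      then have "\<forall>m b. m :| N \<longrightarrow> b :| (N \<rightarrow> N) \<longrightarrow>
        cls D (excess k s) = cls D (Cn Succ \<cdot> m) \<longrightarrow> cls D (prepend \<cdot> s \<cdot> b \<cdot> k) = cls D (b \<cdot> m)"
        using G D assms by (simp add: has_type_iff)
      \<comment> \<open>Prepending s * x to b is prepending s to the sequence x, b(0), b(1), ...,
        whose entry at m + 1 is b(m).\<close>
      from this[rule_format, of "Cn Succ \<cdot> m" "cons \<cdot> x \<cdot> b"] * show
        "cls D (prepend \<cdot> (Cn (Snoc N) \<cdot> s \<cdot> x) \<cdot> b \<cdot> k) = cls D (b \<cdot> m)"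
        using G D that assms by simp
    qed (use that G assms in simp_all)
    then show "sat W' (Free(?k := k, ?s := Cn (Snoc N) \<cdot> s \<cdot> x)) ?A"
      using G assms by (auto simp: has_type_iff)
  qed (use assms in \<open>simp_all add: has_type_iff\<close>)
  then show ?thesis using assms by (auto simp: has_type_iff)
qed

lemma prepend_within:
  assumes "finite W" "k :| N" "s :| (Seq N)"
    "b :| (N \<rightarrow> N)" "c :| (N \<rightarrow> N)" "cls W (excess k s) = cls W (Cn Zero)"
  shows "cls W (prepend \<cdot> s \<cdot> b \<cdot> k) = cls W (prepend \<cdot> s \<cdot> c \<cdot> k)"
proof -
  let ?k = "(''k'', N)" and ?s = "(''s'', Seq N)" and ?b = "(''b'', N \<rightarrow> N)" and ?c = "(''c'', N \<rightarrow> N)"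
  let ?A = "all ?b (all ?c (Imp (excess (Free ?k) (Free ?s) \<doteq> Cn Zero)
    (prepend \<cdot> Free ?s \<cdot> Free ?b \<cdot> Free ?k \<doteq> prepend \<cdot> Free ?s \<cdot> Free ?c \<cdot> Free ?k)))"
  have A_iff: "sat D (Free(?k := k, ?s := s)) ?A \<longleftrightarrow>
      (\<forall>b. b :| (N \<rightarrow> N) \<longrightarrow> (\<forall>c. c :| (N \<rightarrow> N) \<longrightarrow>
        (\<forall>D'. finite D' \<longrightarrow> D \<subseteq> D' \<longrightarrow> cls D' (excess k s) = cls D' (Cn Zero) \<longrightarrow>
          cls D' (prepend \<cdot> s \<cdot> b \<cdot> k) = cls D' (prepend \<cdot> s \<cdot> c \<cdot> k))))"
    if "finite D" "s :| (Seq N)" for D s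
    using that assms(2) by (simp add: has_type_iff)
  have "sat W (Free(?k := k, ?s := s)) ?A"
  proof (rule sat_seq_induct)
    \<comment> \<open>For the empty sequence the excess is k + 1, and its vanishing is
      absurd.\<close>
    have *: "cls W' (b \<cdot> k) = cls W' (c \<cdot> k)"
      if "b :| (N \<rightarrow> N)" "c :| (N \<rightarrow> N)" "cls W' (Cn Succ \<cdot> k) = cls W' (Cn Zero)" for W' b c
      by (rule cls_Zero_Succ_eq[OF that(3)[symmetric]]) (use that assms in simp_all)
    show "sat W (Free(?k := k, ?s := Cn (Empty N))) ?A"
      using assms by (simp add: has_type_iff) (use *[simplified] in blast)
  next
    fix W' s x assume G: "finite W'" "W \<subseteq> W'" "s :| (Seq N)" "x :| N"
      and IH: "sat W' (Free(?k := k, ?s := s)) ?A"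
    let ?s' = "Cn (Snoc N) \<cdot> s \<cdot> x"
    have main: "cls W'' (prepend \<cdot> ?s' \<cdot> b \<cdot> k) = cls W'' (prepend \<cdot> ?s' \<cdot> c \<cdot> k)"
      if "finite W''" "W' \<subseteq> W''" "b :| (N \<rightarrow> N)" "c :| (N \<rightarrow> N)"
        "cls W'' (predecessor \<cdot> excess k s) = cls W'' (Cn Zero)" for W'' b c
    proof (rule num_cases_eq[of W'' "excess k s" _ N])
      fix D assume D: "finite D" "W'' \<subseteq> D" "cls D (excess k s) = cls D (Cn Zero)"
      have "sat D (Free(?k := k, ?s := s)) ?A" using IH by (rule sat_mono) (use D that in auto)
      note IH' = this[unfolded A_iff[OF D(1) G(3)], rule_format, OF _ _ D(1) subset_refl D(3)]
      from IH'[of "cons \<cdot> x \<cdot> b" "cons \<cdot> x \<cdot> c"] show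
        "cls D (prepend \<cdot> ?s' \<cdot> b \<cdot> k) = cls D (prepend \<cdot> ?s' \<cdot> c \<cdot> k)"
        using G D(1) that(3,4) assms(2) by simp
    next
      \<comment> \<open>The excess is a successor with predecessor zero, so |s| = k. Entry
        \<open>k\<close> is then the new element \<open>x\<close>, whatever follows it.\<close>
      fix D m' assume D: "finite D" "W'' \<subseteq> D" "m' :| N" "cls D (excess k s) = cls D (Cn Succ \<cdot> m')"
      have "cls D (predecessor \<cdot> excess k s) = cls D (Cn Zero)"
        by (rule cls_mono[of W'']) (use that D in auto)
      with D have "cls D m' = cls D (Cn Zero)" by simp
      with D have "cls D (excess k s) = cls D (Cn Succ \<cdot> Cn Zero)" by simp
      from prepend_beyond[OF D(1) assms(2) G(3) _ _ this, of "cons \<cdot> x \<cdot> b"]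
        prepend_beyond[OF D(1) assms(2) G(3) _ _ this, of "cons \<cdot> x \<cdot> c"]
      show "cls D (prepend \<cdot> ?s' \<cdot> b \<cdot> k) = cls D (prepend \<cdot> ?s' \<cdot> c \<cdot> k)"
        using G D that assms by simp
    qed (use that G assms in simp_all)
    have s': "?s' :| (Seq N)" using G by simp
    show "sat W' (Free(?k := k, ?s := ?s')) ?A"
      unfolding A_iff[OF G(1) s'] using G(3,4) assms(2) by (intro allI impI, intro main) simp_all
  qed (use assms in \<open>simp_all add: has_type_iff\<close>)
  from this[unfolded A_iff[OF assms(1,3)]] show ?thesis using assms by blast
qed

text \<open>Both branches in the definition of \<Psi> are covered by \<phi>, because \<phi>(G, H)(0)
  is G and the test succeeds exactly at depth zero. The case distinction disappears from all later
  computations.\<close>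

lemma Psi_simps:
  assumes "finite W" "k :| N" "G :| (GT \<sigma>)" "H :| (HT \<sigma>)"
    "s :| (Seq N)"
  shows "cls W (Psi \<sigma> \<cdot> k \<cdot> G \<cdot> H \<cdot> s) = cls W (phi \<sigma> \<cdot> G \<cdot> H \<cdot> excess k s \<cdot> s)"
proof (rule num_cases_eq[of W "excess k s" _ \<sigma>])
  have *: "cls D (Psi \<sigma> \<cdot> k \<cdot> G \<cdot> H \<cdot> s) =
      cls D (if_zero \<sigma> \<cdot> excess k s \<cdot> (G \<cdot> s) \<cdot> (phi \<sigma> \<cdot> G \<cdot> H \<cdot> excess k s \<cdot> s))" if "finite D" for D
    using assms that by (simp add: Psi_def Let_def)
  show "cls D (Psi \<sigma> \<cdot> k \<cdot> G \<cdot> H \<cdot> s) = cls D (phi \<sigma> \<cdot> G \<cdot> H \<cdot> excess k s \<cdot> s)"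
    if "finite D" "cls D (excess k s) = cls D (Cn Zero)" for D
    unfolding *[OF that(1)] using that assms by simp
  show "cls D (Psi \<sigma> \<cdot> k \<cdot> G \<cdot> H \<cdot> s) = cls D (phi \<sigma> \<cdot> G \<cdot> H \<cdot> excess k s \<cdot> s)"
    if "finite D" "cls D (excess k s) = cls D (Cn Succ \<cdot> m)" "m :| N" for D m
    unfolding *[OF that(1)] using that assms by simp
qed (use assms in simp_all)


section \<open>Securing bars\<close>

text \<open>That every infinite sequence meets the bar is stated by the elimination rule of the existential quantifier.\<close>

locale good =
  fixes \<sigma> :: ty and W :: "fm set" and \<chi> v b :: tm
  assumes bar: "\<And>W' a C. \<lbrakk>finite W'; W \<subseteq> W'; a :| (N \<rightarrow> N);
      \<And>W'' n. \<lbrakk>finite W''; W' \<subseteq> W''; n :| N;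
        cls W'' (\<chi> \<cdot> (initial \<cdot> a \<cdot> n)) = cls W'' (Cn Zero)\<rbrakk> \<Longrightarrow> W'' \<turnstile> C\<rbrakk> \<Longrightarrow> W' \<turnstile> C"
    and monotone: "\<And>W' s x. \<lbrakk>finite W'; W \<subseteq> W'; s :| (Seq N); x :| N;
      cls W' (\<chi> \<cdot> s) = cls W' (Cn Zero)\<rbrakk> \<Longrightarrow> cls W' (\<chi> \<cdot> (Cn (Snoc N) \<cdot> s \<cdot> x)) = cls W' (Cn Zero)"
    and secures: "\<And>W' s c. \<lbrakk>finite W'; W \<subseteq> W'; s :| (Seq N); c :| (N \<rightarrow> N);
      cls W' (\<chi> \<cdot> s) = cls W' (Cn Zero)\<rbrakk> \<Longrightarrow> cls W' (v \<cdot> (prepend \<cdot> s \<cdot> c)) = cls W' (v \<cdot> (hat \<cdot> s))"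
    and stop: "\<And>W' G H s. \<lbrakk>finite W'; W \<subseteq> W';
      G :| (GT \<sigma>); H :| (HT \<sigma>); s :| (Seq N);
      cls W' (\<chi> \<cdot> s) = cls W' (Cn Zero)\<rbrakk> \<Longrightarrow> cls W' (b \<cdot> G \<cdot> H \<cdot> s) = cls W' (G \<cdot> s)"
    and continue: "\<And>W' G H s m. \<lbrakk>finite W'; W \<subseteq> W';
      G :| (GT \<sigma>); H :| (HT \<sigma>); s :| (Seq N); m :| N;
      cls W' (\<chi> \<cdot> s) = cls W' (Cn Succ \<cdot> m)\<rbrakk> \<Longrightarrow>
      cls W' (b \<cdot> G \<cdot> H \<cdot> s) = cls W' (H \<cdot> s \<cdot> (shift \<sigma> \<cdot> (b \<cdot> G \<cdot> H) \<cdot> s))"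

text \<open>Every clause already ranges over the extensions of the world.\<close>

lemma good_mono: "good \<sigma> W \<chi> v b \<Longrightarrow> W \<subseteq> W' \<Longrightarrow> good \<sigma> W' \<chi> v b"
  unfolding good_def by (elim conjE, intro conjI) (meson subset_trans)+

text \<open>Extending \<open>s\<close> by \<open>x\<close> and then by zeros is one way of
  continuing the secured sequence \<open>s\<close>. Hence the number selected at a point of the bar
  stays the same above it, which is what composition relies on.\<close>

lemma good_hat_snoc:
  assumes "good \<sigma> W \<chi> v b" "finite W'" "W \<subseteq> W'" "s :| (Seq N)" "x :| N"
    "cls W' (\<chi> \<cdot> s) = cls W' (Cn Zero)"
  shows "cls W' (v \<cdot> (hat \<cdot> (Cn (Snoc N) \<cdot> s \<cdot> x))) = cls W' (v \<cdot> (hat \<cdot> s))"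
  using good.secures[OF assms(1-4) _ assms(6), of "cons \<cdot> x \<cdot> lam (''m'', N) (Cn Zero)"] assms by simp

lemma good_cong:
  assumes "good \<sigma> W \<chi> v b" "cls W \<chi> = cls W \<chi>'" "cls W v = cls W v'" "cls W b = cls W b'"
  shows "good \<sigma> W \<chi>' v' b'"
proof -
  have eq: "cls W' \<chi>' = cls W' \<chi>" "cls W' v' = cls W' v" "cls W' b' = cls W' b"
    if "W \<subseteq> W'" "finite W'" for W'
    using cls_mono[OF assms(2) that] cls_mono[OF assms(3) that] cls_mono[OF assms(4) that] by simp_all
  show ?thesis
  proof (rule good.intro, goal_cases)
    case (1 W' a C)
    show ?case
    proof (rule good.bar[OF assms(1) 1(1-3)])
      fix W'' n assume G: "finite W''" "W' \<subseteq> W''" "n :| N"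
        "cls W'' (\<chi> \<cdot> (initial \<cdot> a \<cdot> n)) = cls W'' (Cn Zero)"
      moreover have "W \<subseteq> W''" using 1 G by blast
      ultimately show "W'' \<turnstile> C" by (intro 1(4)[OF G(1-3)]) (simp add: eq)
    qed
  next
    case (2 W' s x)
    then show ?case using good.monotone[OF assms(1) 2(1-4)] by (simp add: eq)
  next
    case (3 W' s c)
    then show ?case using good.secures[OF assms(1) 3(1-4)] by (simp add: eq)
  next
    case (4 W' G H s)
    then show ?case using good.stop[OF assms(1) 4(1-5)] by (simp add: eq)
  next
    case (5 W' G H s m)
    then show ?case using good.continue[OF assms(1) 5(1-6)] by (simp add: eq)
  qed
qed


section \<open>The bar read off from its recursor\<close>

declare Val_def [simp] BB_def [simp] pair_def [simp]

primrec zero_tm :: "ty \<Rightarrow> tm" where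
  "zero_tm N = Cn Zero"
| "zero_tm (\<rho> \<rightarrow> \<eta>) = lam (''x'', \<rho>) (zero_tm \<eta>)"
| "zero_tm (Seq \<tau>) = Cn (Empty \<tau>)"
| "zero_tm (Prod \<tau> \<rho>) = Cn (MkPair \<tau> \<rho>) \<cdot> zero_tm \<tau> \<cdot> zero_tm \<rho>"

primrec one_tm :: "ty \<Rightarrow> tm" where
  "one_tm N = Cn Succ \<cdot> Cn Zero"
| "one_tm (\<rho> \<rightarrow> \<eta>) = lam (''x'', \<rho>) (one_tm \<eta>)"
| "one_tm (Seq \<tau>) = Cn (Snoc \<tau>) \<cdot> Cn (Empty \<tau>) \<cdot> zero_tm \<tau>"
| "one_tm (Prod \<tau> \<rho>) = Cn (MkPair \<tau> \<rho>) \<cdot> one_tm \<tau> \<cdot> zero_tm \<rho>"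

text \<open>Maps \<open>zero_tm\<close> to 0 and \<open>one_tm\<close> to 1 by conversion alone:
  functions are tested at the zero argument, sequences for being empty, pairs in the first
  component. Thus a result of bar recursion of any type \<sigma> becomes a numerical test.\<close>

primrec discr :: "ty \<Rightarrow> tm" where
  "discr N = lam (''n'', N) (Free (''n'', N))"
| "discr (\<rho> \<rightarrow> \<eta>) = lam (''f'', \<rho> \<rightarrow> \<eta>) (discr \<eta> \<cdot> (Free (''f'', \<rho> \<rightarrow> \<eta>) \<cdot> zero_tm \<rho>))"
| "discr (Seq \<tau>) = Cn (SeqRec \<tau> N) \<cdot> Cn Zero \<cdot>
    lam (''s'', Seq \<tau>) (lam (''x'', \<tau>) (lam (''n'', N) (Cn Succ \<cdot> Cn Zero)))"
| "discr (Prod \<tau> \<rho>) = lam (''p'', Prod \<tau> \<rho>) (discr \<tau> \<cdot> (Cn (Fst \<tau> \<rho>) \<cdot> Free (''p'', Prod \<tau> \<rho>)))"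

lemma zero_tm_closed [simp]: "(zero_tm \<rho>) :| \<rho>" "fv (zero_tm \<rho>) = {}"
  by (induction \<rho>) auto

lemma one_tm_closed [simp]: "(one_tm \<rho>) :| \<rho>" "fv (one_tm \<rho>) = {}"
  by (induction \<rho>) auto

lemma discr_closed [simp]: "(discr \<rho>) :| (\<rho> \<rightarrow> N)" "fv (discr \<rho>) = {}"
  by (induction \<rho>) auto

lemma sem_zero_one [simp]:
  assumes "finite W" "okv W \<rho>"
  shows "sem W \<rho> (zero_tm \<kappa>) = cls W (zero_tm \<kappa>)" "sem W \<rho> (one_tm \<kappa>) = cls W (one_tm \<kappa>)"
    "sem W \<rho> (discr \<kappa>) = cls W (discr \<kappa>)"
  using assms by (simp_all add: sem_closed)

lemma discr_simps [simp]:
  assumes "finite W"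
  shows "app W (cls W (discr \<rho>)) (cls W (zero_tm \<rho>)) = cls W (Cn Zero)"
    "app W (cls W (discr \<rho>)) (cls W (one_tm \<rho>)) = app W (cls W (Cn Succ)) (cls W (Cn Zero))"
  by (induction \<rho>) (use assms in simp_all)

text \<open>A single closed term with parameter \<open>u\<close>, so that a family of translated
  numbers yields a family of bars by application.\<close>

definition chi :: "ty \<Rightarrow> tm" where
  "chi \<sigma> = (let u = (''u'', ty_tr \<sigma> N); s = (''s'', Seq N) in
     lam u (lam s (discr \<sigma> \<cdot> (BB \<sigma> (Free u) \<cdot> lam s (zero_tm \<sigma>) \<cdot> lam s (lam (''f'', N \<rightarrow> \<sigma>) (one_tm \<sigma>)) \<cdot> Free s))))"

lemma chi_closed [simp]: "(chi \<sigma>) :| (ty_tr \<sigma> N \<rightarrow> Seq N \<rightarrow> N)" "fv (chi \<sigma>) = {}"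
  by (auto simp: chi_def Let_def)

lemma sem_chi [simp]: "finite W \<Longrightarrow> okv W \<rho> \<Longrightarrow> sem W \<rho> (chi \<sigma>) = cls W (chi \<sigma>)"
  by (simp add: sem_closed)

text \<open>On the bar \<chi> the recursor returns its first argument, hence 0; off the bar it
  returns a value of the second argument, which ignores its continuation, hence 1. So
  \<open>chi\<close> has the same members as \<chi>, and any convenient bar may be used to establish
  goodness.\<close>

lemma good_chi:
  assumes good: "good \<sigma> W \<chi> v b" and fin: "finite W" and ty: "\<chi> :| (Seq N \<rightarrow> N)"
    "u :| (ty_tr \<sigma> N)" and eq: "cls W v = cls W (Val \<sigma> u)" "cls W b = cls W (BB \<sigma> u)"
  shows "good \<sigma> W (chi \<sigma> \<cdot> u) (Val \<sigma> u) (BB \<sigma> u)"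
proof -
  let ?\<chi> = "chi \<sigma> \<cdot> u" and ?v = "Val \<sigma> u" and ?b = "BB \<sigma> u"
  let ?G = "lam (''s'', Seq N) (zero_tm \<sigma>)" and ?H = "lam (''s'', Seq N) (lam (''f'', N \<rightarrow> \<sigma>) (one_tm \<sigma>))"
  have g: "good \<sigma> W \<chi> ?v ?b" using good_cong[OF good refl eq] .
  have chi: "cls D (?\<chi> \<cdot> s) = cls D (discr \<sigma> \<cdot> (?b \<cdot> ?G \<cdot> ?H \<cdot> s))" if "finite D" "s :| (Seq N)" for D s
    using that ty by (simp add: chi_def Let_def sem_closed)
  have zero: "cls D (?\<chi> \<cdot> s) = cls D (Cn Zero)"
    if "finite D" "W \<subseteq> D" "s :| (Seq N)" "cls D (\<chi> \<cdot> s) = cls D (Cn Zero)" for D s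
    using good.stop[OF g that(1,2) _ _ that(3,4), of ?G ?H] chi[OF that(1,3)] that ty by simp
  have one: "cls D (?\<chi> \<cdot> s) = cls D (Cn Succ \<cdot> Cn Zero)"
    if "finite D" "W \<subseteq> D" "s :| (Seq N)" "m :| N" "cls D (\<chi> \<cdot> s) = cls D (Cn Succ \<cdot> m)" for D s m
    using good.continue[OF g that(1,2) _ _ that(3-5), of ?G ?H] chi[OF that(1,3)] that ty by simp
  \<comment> \<open>If \<chi> were a successor at \<open>s\<close>, the test would give both 0 and
    1.\<close>
  have zero': "cls D (\<chi> \<cdot> s) = cls D (Cn Zero)"
    if D: "finite D" "W \<subseteq> D" "s :| (Seq N)" "cls D (?\<chi> \<cdot> s) = cls D (Cn Zero)" for D s
  proof (rule num_cases_eq[of D "\<chi> \<cdot> s" _ N])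
    fix D' m assume D': "finite D'" "D \<subseteq> D'" "m :| N" "cls D' (\<chi> \<cdot> s) = cls D' (Cn Succ \<cdot> m)"
    have "cls D' (?\<chi> \<cdot> s) = cls D' (Cn Succ \<cdot> Cn Zero)" using D D' by (intro one[of _ _ m]) auto
    with cls_mono[OF D(4) D'(2,1)] have "cls D' (Cn Zero) = cls D' (Cn Succ \<cdot> Cn Zero)" by simp
    then show "cls D' (\<chi> \<cdot> s) = cls D' (Cn Zero)" by (rule cls_Zero_Succ_eq) (use D ty in simp_all)
  qed (use D ty in simp_all)
  show ?thesis
  proof (rule good.intro, goal_cases)
    case (1 W' a C)
    show ?case
    proof (rule good.bar[OF g 1(1-3)])
      fix W'' n assume G: "finite W''" "W' \<subseteq> W''" "n :| N"
        "cls W'' (\<chi> \<cdot> (initial \<cdot> a \<cdot> n)) = cls W'' (Cn Zero)"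
      then show "W'' \<turnstile> C" using 1(2,3) by (intro 1(4)[OF G(1-3)] zero) auto
    qed
  next
    case (2 W' s x)
    from good.monotone[OF g 2(1-4) zero'[OF 2(1-3,5)]] show ?case by (intro zero) (use 2 in simp_all)
  next
    case (3 W' s c)
    then show ?case using good.secures[OF g 3(1-4)] zero' by simp
  next
    case (4 W' G H s)
    then show ?case using good.stop[OF g 4(1-5)] zero' by simp
  next
    case (5 W' G H s m)
    show ?case
    proof (rule num_cases_eq[of W' "\<chi> \<cdot> s" _ \<sigma>])
      fix D assume D: "finite D" "W' \<subseteq> D" "cls D (\<chi> \<cdot> s) = cls D (Cn Zero)"
      have "cls D (?\<chi> \<cdot> s) = cls D (Cn Zero)" using 5 D by (intro zero) auto
      with cls_mono[OF 5(7) D(2,1)] have "cls D (Cn Zero) = cls D (Cn Succ \<cdot> m)" by simp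
      then show "cls D (?b \<cdot> G \<cdot> H \<cdot> s) = cls D (H \<cdot> s \<cdot> (shift \<sigma> \<cdot> (?b \<cdot> G \<cdot> H) \<cdot> s))"
        by (rule cls_Zero_Succ_eq) (use 5 ty in simp_all)
    next
      fix D m' assume D: "finite D" "W' \<subseteq> D" "m' :| N" "cls D (\<chi> \<cdot> s) = cls D (Cn Succ \<cdot> m')"
      show "cls D (?b \<cdot> G \<cdot> H \<cdot> s) = cls D (H \<cdot> s \<cdot> (shift \<sigma> \<cdot> (?b \<cdot> G \<cdot> H) \<cdot> s))"
        using 5 D by (intro good.continue[OF g, of D G H s m']) auto
    qed (use 5 ty in simp_all)
  qed
qed

text \<open>The bar consists of all sequences: a constant is secured by the empty sequence, and a
  recursor that returns \<open>G\<close> never continues.\<close>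

lemma good_const:
  assumes "finite W" "k :| N"
    and v: "\<And>W' a. finite W' \<Longrightarrow> W \<subseteq> W' \<Longrightarrow> a :| (N \<rightarrow> N) \<Longrightarrow> cls W' (v \<cdot> a) = cls W' k"
    and b: "\<And>W' G H. finite W' \<Longrightarrow> W \<subseteq> W' \<Longrightarrow> G :| (GT \<sigma>) \<Longrightarrow> H :| (HT \<sigma>) \<Longrightarrow>
      cls W' (b \<cdot> G \<cdot> H) = cls W' G"
    and "b :| (BT \<sigma>)"
  shows "good \<sigma> W (lam (''s'', Seq N) (Cn Zero)) v b"
proof (rule good.intro, goal_cases)
  case (1 W' a C)
  show ?case by (rule 1(4)[of _ "Cn Zero"]) (use 1 in simp_all)
next
  case (3 W' s c)
  then show ?case using v[of W' "prepend \<cdot> s \<cdot> c"] v[of W' "hat \<cdot> s"] by simp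
next
  case (4 W' G H s)
  then show ?case using b by simp
next
  case (5 W' G H s m)
  then have "cls W' (Cn Zero) = cls W' (Cn Succ \<cdot> m)" by simp
  then show ?case by (rule cls_Zero_Succ_eq) (use 5 assms in simp_all)
qed simp

text \<open>Where \<open>v\<close> is constant, so is any function of it; the recursor and its bar
  are kept unchanged.\<close>

lemma good_fun:
  assumes g: "good \<sigma> W \<chi> v b" and ty: "v :| ValT"
    and v': "\<And>W' a. finite W' \<Longrightarrow> W \<subseteq> W' \<Longrightarrow> a :| (N \<rightarrow> N) \<Longrightarrow> cls W' (v' \<cdot> a) = cls W' (f \<cdot> (v \<cdot> a))"
  shows "good \<sigma> W \<chi> v' b"
proof (rule good.intro, goal_cases)
  case (1 W' a C)
  then show ?case by (intro good.bar[OF g 1(1-3)]) 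
next
  case (2 W' s x)
  then show ?case by (rule good.monotone[OF g])
next
  case (3 W' s c)
  then show ?case
    using v'[of W' "prepend \<cdot> s \<cdot> c"] v'[of W' "hat \<cdot> s"] good.secures[OF g 3(1-5)] by simp
next
  case (4 W' G H s)
  then show ?case by (rule good.stop[OF g])
next
  case (5 W' G H s m)
  then show ?case by (rule good.continue[OF g])
qed


section \<open>Composition of bars\<close>

text \<open>Outside the first bar the value is 1, which stands for any number other than zero.
  Inside it the test of the second bar is used, with index the value secured at
  \<open>s\<close>.\<close>

definition comp_bar :: tm where
  "comp_bar = (let c = (''c'', Seq N \<rightarrow> N); v = (''v'', ValT); q = (''q'', N \<rightarrow> Seq N \<rightarrow> N); s = (''s'', Seq N) in
     lam c (lam v (lam q (lam s (if_zero N \<cdot> (Free c \<cdot> Free s) \<cdot>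
       (Free q \<cdot> (Free v \<cdot> (hat \<cdot> Free s)) \<cdot> Free s) \<cdot> (Cn Succ \<cdot> Cn Zero))))))"

definition comp_val :: tm where
  "comp_val = (let v = (''v'', ValT); w = (''w'', N \<rightarrow> ValT); a = (''a'', N \<rightarrow> N) in
     lam v (lam w (lam a (Free w \<cdot> (Free v \<cdot> Free a) \<cdot> Free a))))"

definition comp_stop :: "ty \<Rightarrow> tm" where
  "comp_stop \<sigma> = (let v = (''v'', ValT); c = (''c'', N \<rightarrow> BT \<sigma>); G = (''G'', GT \<sigma>); H = (''H'', HT \<sigma>);
       s = (''s'', Seq N) in
     lam v (lam c (lam G (lam H (lam s (Free c \<cdot> (Free v \<cdot> (hat \<cdot> Free s)) \<cdot> Free G \<cdot> Free H \<cdot> Free s))))))"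

definition comp_rec :: "ty \<Rightarrow> tm" where
  "comp_rec \<sigma> = (let v = (''v'', ValT); b = (''b'', BT \<sigma>); c = (''c'', N \<rightarrow> BT \<sigma>); G = (''G'', GT \<sigma>); H = (''H'', HT \<sigma>) in
     lam v (lam b (lam c (lam G (lam H (Free b \<cdot>
       (comp_stop \<sigma> \<cdot> Free v \<cdot> Free c \<cdot> Free G \<cdot> Free H) \<cdot> Free H))))))"

text \<open>Pairs the test of the first bar with the value secured there, so that being in the bar
  with a given value is one equation, as \<open>initial_plus\<close> requires.\<close>

definition bar_val :: tm where
  "bar_val = (let c = (''c'', Seq N \<rightarrow> N); v = (''v'', ValT); s = (''s'', Seq N) in
     lam c (lam v (lam s (Cn (MkPair N N) \<cdot> (Free c \<cdot> Free s) \<cdot> (Free v \<cdot> (hat \<cdot> Free s))))))"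

lemma comp_closed [simp]:
  "comp_bar :| ((Seq N \<rightarrow> N) \<rightarrow> ValT \<rightarrow> (N \<rightarrow> Seq N \<rightarrow> N) \<rightarrow> Seq N \<rightarrow> N)" "fv comp_bar = {}"
  "comp_val :| (ValT \<rightarrow> (N \<rightarrow> ValT) \<rightarrow> ValT)" "fv comp_val = {}"
  "(comp_stop \<sigma>) :| (ValT \<rightarrow> (N \<rightarrow> BT \<sigma>) \<rightarrow> GT \<sigma> \<rightarrow> HT \<sigma> \<rightarrow> Seq N \<rightarrow> \<sigma>)" "fv (comp_stop \<sigma>) = {}"
  "bar_val :| ((Seq N \<rightarrow> N) \<rightarrow> ValT \<rightarrow> Seq N \<rightarrow> Prod N N)" "fv bar_val = {}"
  by (auto simp: comp_bar_def comp_val_def comp_stop_def bar_val_def Let_def)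

lemma comp_rec_closed [simp]:
  "(comp_rec \<sigma>) :| (ValT \<rightarrow> BT \<sigma> \<rightarrow> (N \<rightarrow> BT \<sigma>) \<rightarrow> BT \<sigma>)" "fv (comp_rec \<sigma>) = {}"
  by (auto simp: comp_rec_def Let_def)

lemma sem_comp [simp]:
  assumes "finite W" "okv W \<rho>"
  shows "sem W \<rho> comp_bar = cls W comp_bar" "sem W \<rho> comp_val = cls W comp_val"
    "sem W \<rho> (comp_stop \<sigma>) = cls W (comp_stop \<sigma>)" "sem W \<rho> (comp_rec \<sigma>) = cls W (comp_rec \<sigma>)"
    "sem W \<rho> bar_val = cls W bar_val"
  using assms by (simp_all add: sem_closed)

context
  fixes W :: "fm set" assumes fin [simp]: "finite W"
begin

lemma comp_bar_simps [simp]: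
  "tyc W c = Some (Seq N \<rightarrow> N) \<Longrightarrow> tyc W v = Some ValT \<Longrightarrow> tyc W q = Some (N \<rightarrow> Seq N \<rightarrow> N) \<Longrightarrow> tyc W s = Some (Seq N) \<Longrightarrow>
    cls W comp_bar \<bullet>[W] c \<bullet>[W] v \<bullet>[W] q \<bullet>[W] s = cls W (if_zero N) \<bullet>[W] (c \<bullet>[W] s) \<bullet>[W]
      (q \<bullet>[W] (v \<bullet>[W] (cls W hat \<bullet>[W] s)) \<bullet>[W] s) \<bullet>[W] (cls W (Cn Succ) \<bullet>[W] cls W (Cn Zero))"
  by (simp add: comp_bar_def Let_def)

lemma comp_val_simps [simp]:
  "tyc W v = Some ValT \<Longrightarrow> tyc W w = Some (N \<rightarrow> ValT) \<Longrightarrow> tyc W a = Some (N \<rightarrow> N) \<Longrightarrow>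
    cls W comp_val \<bullet>[W] v \<bullet>[W] w \<bullet>[W] a = w \<bullet>[W] (v \<bullet>[W] a) \<bullet>[W] a"
  by (simp add: comp_val_def Let_def)

lemma comp_stop_simps [simp]:
  "tyc W v = Some ValT \<Longrightarrow> tyc W c = Some (N \<rightarrow> BT \<sigma>) \<Longrightarrow> tyc W G = Some (GT \<sigma>) \<Longrightarrow> tyc W H = Some (HT \<sigma>) \<Longrightarrow>
    tyc W s = Some (Seq N) \<Longrightarrow>
    cls W (comp_stop \<sigma>) \<bullet>[W] v \<bullet>[W] c \<bullet>[W] G \<bullet>[W] H \<bullet>[W] s =
    c \<bullet>[W] (v \<bullet>[W] (cls W hat \<bullet>[W] s)) \<bullet>[W] G \<bullet>[W] H \<bullet>[W] s"
  by (simp add: comp_stop_def Let_def)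

lemma comp_rec_simps [simp]:
  "tyc W v = Some ValT \<Longrightarrow> tyc W b = Some (BT \<sigma>) \<Longrightarrow> tyc W c = Some (N \<rightarrow> BT \<sigma>) \<Longrightarrow>
    tyc W G = Some (GT \<sigma>) \<Longrightarrow> tyc W H = Some (HT \<sigma>) \<Longrightarrow>
    cls W (comp_rec \<sigma>) \<bullet>[W] v \<bullet>[W] b \<bullet>[W] c \<bullet>[W] G \<bullet>[W] H =
    b \<bullet>[W] (cls W (comp_stop \<sigma>) \<bullet>[W] v \<bullet>[W] c \<bullet>[W] G \<bullet>[W] H) \<bullet>[W] H"
  by (simp add: comp_rec_def Let_def)

lemma bar_val_simps [simp]:
  "tyc W c = Some (Seq N \<rightarrow> N) \<Longrightarrow> tyc W v = Some ValT \<Longrightarrow> tyc W s = Some (Seq N) \<Longrightarrow>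
    cls W bar_val \<bullet>[W] c \<bullet>[W] v \<bullet>[W] s =
    cls W (Cn (MkPair N N)) \<bullet>[W] (c \<bullet>[W] s) \<bullet>[W] (v \<bullet>[W] (cls W hat \<bullet>[W] s))"
  by (simp add: bar_val_def Let_def)

lemma pair_inject:
  assumes "cls W (Cn (MkPair \<tau> \<rho>) \<cdot> a \<cdot> b) = cls W (Cn (MkPair \<tau> \<rho>) \<cdot> c \<cdot> d)"
    "a :| \<tau>" "b :| \<rho>" "c :| \<tau>" "d :| \<rho>"
  shows "cls W a = cls W c" "cls W b = cls W d"
  using arg_cong[OF assms(1), of "app W (cls W (Cn (Fst \<tau> \<rho>)))"]
    arg_cong[OF assms(1), of "app W (cls W (Cn (Snd \<tau> \<rho>)))"] assms by simp_all

end

text \<open>An infinite sequence first meets the bar of \<open>v\<close>, which selects an index,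
  and then the bar with this index; both facts persist to a common longer segment. For the recursion
  equation the only delicate sequences lie in the first bar but not in the second. There the
  recursor \<open>c\<close> with the selected index has taken over, and it must be seen that it
  continues with the composite recursor.\<close>

lemma good_comp:
  assumes g: "good \<sigma> W \<chi> v b" and gq: "\<And>n. n :| N \<Longrightarrow> good \<sigma> W (q \<cdot> n) (w \<cdot> n) (c \<cdot> n)"
    and fin: "finite W" and ty [simp]: "\<chi> :| (Seq N \<rightarrow> N)" "v :| ValT" "b :| (BT \<sigma>)"
      "q :| (N \<rightarrow> Seq N \<rightarrow> N)" "w :| (N \<rightarrow> ValT)" "c :| (N \<rightarrow> BT \<sigma>)"
  shows "good \<sigma> W (comp_bar \<cdot> \<chi> \<cdot> v \<cdot> q) (comp_val \<cdot> v \<cdot> w) (comp_rec \<sigma> \<cdot> v \<cdot> b \<cdot> c)"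
proof -
  let ?k = "\<lambda>s. v \<cdot> (hat \<cdot> s)" and ?\<chi> = "comp_bar \<cdot> \<chi> \<cdot> v \<cdot> q"
  have split1: "cls D (\<chi> \<cdot> s) = cls D (Cn Zero)"
    if D: "finite D" "s :| (Seq N)" "cls D (?\<chi> \<cdot> s) = cls D (Cn Zero)" for D s
  proof (rule num_cases_eq[of D "\<chi> \<cdot> s" _ N])
    fix D' m assume D': "finite D'" "D \<subseteq> D'" "m :| N" "cls D' (\<chi> \<cdot> s) = cls D' (Cn Succ \<cdot> m)"
    with cls_mono[OF D(3) D'(2,1)] D have "cls D' (Cn Zero) = cls D' (Cn Succ \<cdot> Cn Zero)" by simp
    then show "cls D' (\<chi> \<cdot> s) = cls D' (Cn Zero)" by (rule cls_Zero_Succ_eq) (use D in simp_all)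
  qed (use D in simp_all)
  have bar0: "cls D (?\<chi> \<cdot> s) = cls D (q \<cdot> ?k s \<cdot> s)"
    if "finite D" "s :| (Seq N)" "cls D (\<chi> \<cdot> s) = cls D (Cn Zero)" for D s
    using that by simp
  \<comment> \<open>Terms are the same in all worlds, so the secured value is already covered by
    \<open>gq\<close> at \<open>W\<close>, and goodness passes upwards.\<close>
  have gk: "good \<sigma> D (q \<cdot> ?k s) (w \<cdot> ?k s) (c \<cdot> ?k s)" if "W \<subseteq> D" "s :| (Seq N)" for D s
    using gq[of "?k s"] that by (simp add: good_mono)
  show ?thesis
  proof (rule good.intro, goal_cases)
    case (1 W' a C)
    show ?case
    proof (rule good.bar[OF g 1(1-3)])
      fix D n assume D: "finite D" "W' \<subseteq> D" "n :| N"
        "cls D (\<chi> \<cdot> (initial \<cdot> a \<cdot> n)) = cls D (Cn Zero)"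
      let ?s = "initial \<cdot> a \<cdot> n"
      have s: "?s :| (Seq N)" using D 1 by simp
      have GD: "W \<subseteq> D" using 1 D by blast
      note gk' = gk[OF GD s]
      show "D \<turnstile> C"
      proof (rule good.bar[OF gk' D(1) subset_refl 1(3)])
        fix D' m assume D': "finite D'" "D \<subseteq> D'" "m :| N"
          "cls D' (q \<cdot> ?k ?s \<cdot> (initial \<cdot> a \<cdot> m)) = cls D' (Cn Zero)"
        let ?s' = "initial \<cdot> a \<cdot> (plus \<cdot> n \<cdot> m)"
        \<comment> \<open>Beyond length \<open>n\<close> the sequence stays in the first bar and
          selects the same index, so the bar met at length \<open>m\<close> is still the right one
          at \<open>n + m\<close>.\<close>
        have "cls D' (bar_val \<cdot> \<chi> \<cdot> v \<cdot> ?s') = cls D' (Cn (MkPair N N) \<cdot> Cn Zero \<cdot> ?k ?s)"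
        proof (rule initial_plus(1)[OF D'(1)])
          fix D'' t x assume D'': "finite D''" "D' \<subseteq> D''" "t :| (Seq N)" "x :| N"
            "cls D'' (bar_val \<cdot> \<chi> \<cdot> v \<cdot> t) = cls D'' (Cn (MkPair N N) \<cdot> Cn Zero \<cdot> ?k ?s)"
          have "cls D'' (Cn (MkPair N N) \<cdot> (\<chi> \<cdot> t) \<cdot> ?k t) = cls D'' (Cn (MkPair N N) \<cdot> Cn Zero \<cdot> ?k ?s)"
            using D'' by simp
          note * = pair_inject[OF D''(1) this]
          have t: "cls D'' (\<chi> \<cdot> t) = cls D'' (Cn Zero)" "cls D'' (?k t) = cls D'' (?k ?s)"
            using * D'' D 1 by simp_all
          have GD'': "W \<subseteq> D''" using GD D' D'' by blast
          show "cls D'' (bar_val \<cdot> \<chi> \<cdot> v \<cdot> (Cn (Snoc N) \<cdot> t \<cdot> x)) = cls D'' (Cn (MkPair N N) \<cdot> Cn Zero \<cdot> ?k ?s)"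
            using good.monotone[OF g D''(1) GD'' D''(3,4) t(1)] good_hat_snoc[OF g D''(1) GD'' D''(3,4) t(1)] t D'' D 1
            by simp
        next
          show "cls D' (bar_val \<cdot> \<chi> \<cdot> v \<cdot> ?s) = cls D' (Cn (MkPair N N) \<cdot> Cn Zero \<cdot> ?k ?s)"
            using cls_mono[OF D(4) D'(2,1)] D' D 1 by simp
        qed (use D D' 1 in simp_all)
        then have "cls D' (Cn (MkPair N N) \<cdot> (\<chi> \<cdot> ?s') \<cdot> ?k ?s') = cls D' (Cn (MkPair N N) \<cdot> Cn Zero \<cdot> ?k ?s)"
          using D D' 1 by simp
        from pair_inject[OF D'(1) this]
        have s': "cls D' (\<chi> \<cdot> ?s') = cls D' (Cn Zero)" "cls D' (?k ?s') = cls D' (?k ?s)"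
          using D D' 1 by simp_all
        have "cls D' (q \<cdot> ?k ?s \<cdot> ?s') = cls D' (Cn Zero)"
        proof (rule initial_plus(2)[OF D'(1)])
          fix D'' t x assume D'': "finite D''" "D' \<subseteq> D''" "t :| (Seq N)" "x :| N"
            "cls D'' (q \<cdot> ?k ?s \<cdot> t) = cls D'' (Cn Zero)"
          show "cls D'' (q \<cdot> ?k ?s \<cdot> (Cn (Snoc N) \<cdot> t \<cdot> x)) = cls D'' (Cn Zero)"
            by (rule good.monotone[OF gk' D''(1) _ D''(3-5)]) (use D' D'' in blast)
        qed (use D D' 1 s' in simp_all)
        then have "cls D' (?\<chi> \<cdot> ?s') = cls D' (Cn Zero)"
          using bar0[of D' ?s'] s' D' D 1 by simp
        moreover have "W' \<subseteq> D'" using D D' by blast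
        ultimately show "D' \<turnstile> C" using D D' by (intro 1(4)[of D' "plus \<cdot> n \<cdot> m"]) simp_all
      qed
    qed
  next
    case (2 D s x)
    note \<chi> = split1[OF 2(1,3,5)]
    have q: "cls D (q \<cdot> ?k s \<cdot> s) = cls D (Cn Zero)" using bar0[OF 2(1,3) \<chi>] 2(5) by simp
    show ?case
      using good.monotone[OF g 2(1-4) \<chi>] good_hat_snoc[OF g 2(1-4) \<chi>]
        good.monotone[OF gk[OF 2(2,3)] 2(1) subset_refl 2(3,4) q]
        bar0[OF 2(1), of "Cn (Snoc N) \<cdot> s \<cdot> x"] 2(1-4) by simp
  next
    case (3 D s a)
    note \<chi> = split1[OF 3(1,3,5)]
    have q: "cls D (q \<cdot> ?k s \<cdot> s) = cls D (Cn Zero)" using bar0[OF 3(1,3) \<chi>] 3(5) by simp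
    show ?case
      using good.secures[OF g 3(1-4) \<chi>] good.secures[OF gk[OF 3(2,3)] 3(1) subset_refl 3(3,4) q] 3(1-4)
      by simp
  next
    case (4 D G H s)
    note \<chi> = split1[OF 4(1,5,6)]
    have q: "cls D (q \<cdot> ?k s \<cdot> s) = cls D (Cn Zero)" using bar0[OF 4(1,5) \<chi>] 4(6) by simp
    show ?case
      using good.stop[OF g 4(1,2) _ 4(4,5) \<chi>, of "comp_stop \<sigma> \<cdot> v \<cdot> c \<cdot> G \<cdot> H"]
        good.stop[OF gk[OF 4(2,5)] 4(1) subset_refl 4(3-5) q] 4(1-5) by simp
  next
    case (5 W' G H s m)
    let ?G = "comp_stop \<sigma> \<cdot> v \<cdot> c \<cdot> G \<cdot> H" and ?b = "comp_rec \<sigma> \<cdot> v \<cdot> b \<cdot> c"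
    have b: "cls D (?b \<cdot> G \<cdot> H \<cdot> s) = cls D (b \<cdot> ?G \<cdot> H \<cdot> s)" if "finite D" "s :| (Seq N)" for D s
      using 5 that by simp
    show ?case
    proof (rule num_cases_eq[of W' "\<chi> \<cdot> s" _ \<sigma>])
      fix D assume D: "finite D" "W' \<subseteq> D" "cls D (\<chi> \<cdot> s) = cls D (Cn Zero)"
      have GD: "W \<subseteq> D" using 5 D by blast
      have q: "cls D (q \<cdot> ?k s \<cdot> s) = cls D (Cn Succ \<cdot> m)"
        using bar0[OF D(1) 5(5) D(3)] cls_mono[OF 5(7) D(2,1)] by simp
      \<comment> \<open>Every one-element extension of \<open>s\<close> is in the first bar with the
        same index. So the composite agrees there with the recursor \<open>c\<close> of that index,
        and the two continuations coincide.\<close>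
      have "cls D (shift \<sigma> \<cdot> (?b \<cdot> G \<cdot> H) \<cdot> s) = cls D (shift \<sigma> \<cdot> (c \<cdot> ?k s \<cdot> G \<cdot> H) \<cdot> s)"
      proof (rule app_ext[OF D(1), where \<pi> = N and \<rho> = \<sigma>])
        fix y assume "tyc D y = Some N"
        then obtain x where x: "y = cls D x" "x :| N" by (rule tyc_repE)
        let ?s = "Cn (Snoc N) \<cdot> s \<cdot> x"
        have s: "?s :| (Seq N)" using 5 x by simp
        have "cls D (?b \<cdot> G \<cdot> H \<cdot> ?s) = cls D (?G \<cdot> ?s)"
          using b[OF D(1) s] good.stop[OF g D(1) GD _ 5(4) s good.monotone[OF g D(1) GD 5(5) x(2) D(3)], of ?G] 5
          by simp
        also have "\<dots> = cls D (c \<cdot> ?k s \<cdot> G \<cdot> H \<cdot> ?s)"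
          using good_hat_snoc[OF g D(1) GD 5(5) x(2) D(3)] D 5 x by simp
        finally show "app D (cls D (shift \<sigma> \<cdot> (?b \<cdot> G \<cdot> H) \<cdot> s)) y = app D (cls D (shift \<sigma> \<cdot> (c \<cdot> ?k s \<cdot> G \<cdot> H) \<cdot> s)) y"
          using D 5 x by simp
      qed (use D 5 in simp_all)
      then show "cls D (?b \<cdot> G \<cdot> H \<cdot> s) = cls D (H \<cdot> s \<cdot> (shift \<sigma> \<cdot> (?b \<cdot> G \<cdot> H) \<cdot> s))"
        using b[OF D(1) 5(5)] good.stop[OF g D(1) GD _ 5(4,5) D(3), of ?G]
          good.continue[OF gk[OF GD 5(5)] D(1) subset_refl 5(3-6) q] D 5 by simp
    next
      fix D m' assume D: "finite D" "W' \<subseteq> D" "m' :| N" "cls D (\<chi> \<cdot> s) = cls D (Cn Succ \<cdot> m')"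
      have GD: "W \<subseteq> D" using 5 D by blast
      show "cls D (?b \<cdot> G \<cdot> H \<cdot> s) = cls D (H \<cdot> s \<cdot> (shift \<sigma> \<cdot> (?b \<cdot> G \<cdot> H) \<cdot> s))"
        using b[OF D(1) 5(5)] good.continue[OF g D(1) GD _ 5(4,5) D(3,4), of ?G] D 5 by simp
    qed (use 5 in simp_all)
  qed
qed

section \<open>The bar for evaluation at a fixed argument\<close>

definition excess_tm :: tm where
  "excess_tm = (let k = (''k'', N); s = (''s'', Seq N) in lam k (lam s (excess (Free k) (Free s))))"

definition apply_tm :: tm where
  "apply_tm = (let k = (''k'', N); a = (''a'', N \<rightarrow> N) in lam k (lam a (Free a \<cdot> Free k)))"

lemma excess_closed [simp]: "excess_tm :| (N \<rightarrow> Seq N \<rightarrow> N)" "fv excess_tm = {}"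
  by (auto simp: excess_tm_def Let_def)

lemma apply_closed [simp]: "apply_tm :| (N \<rightarrow> ValT)" "fv apply_tm = {}"
  by (auto simp: apply_tm_def Let_def)

lemma excess_simps [simp]:
  "finite W \<Longrightarrow> tyc W k = Some N \<Longrightarrow> tyc W s = Some (Seq N) \<Longrightarrow>
    cls W excess_tm \<bullet>[W] k \<bullet>[W] s = cls W monus \<bullet>[W] (cls W (Cn Succ) \<bullet>[W] k) \<bullet>[W] (cls W len \<bullet>[W] s)"
  by (simp add: excess_tm_def Let_def)

lemma apply_simps [simp]:
  "finite W \<Longrightarrow> tyc W k = Some N \<Longrightarrow> tyc W a = Some (N \<rightarrow> N) \<Longrightarrow> cls W apply_tm \<bullet>[W] k \<bullet>[W] a = a \<bullet>[W] k"
  by (simp add: apply_tm_def Let_def)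

text \<open>A segment longer than k determines \<alpha>(k), and below that length the depth of
  \<phi> drops by one with each further entry.\<close>

lemma good_Psi:
  assumes fin: "finite W" and k: "k :| N"
  shows "good \<sigma> W (excess_tm \<cdot> k) (apply_tm \<cdot> k) (Psi \<sigma> \<cdot> k)"
proof (rule good.intro, goal_cases)
  case (1 D a C)
  \<comment> \<open>Length \<open>k + 1\<close> is needed, as the segment of length \<open>k\<close>
    does not yet contain the entry at \<open>k\<close>.\<close>
  show ?case by (rule 1(4)[of _ "Cn Succ \<cdot> k"]) (use 1(1-3) k in \<open>simp_all add: monus_Succ_Succ\<close>)
next
  case (2 D s x)
  then show ?case using k by simp
next
  case (3 D s a)
  then show ?case using k prepend_within[of D k s a "lam (''m'', N) (Cn Zero)"] by simp
next
  case (4 D G H s)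
  then show ?case using k Psi_simps[of D k G \<sigma> H s] by simp
next
  case (5 D G H s m)
  \<comment> \<open>With excess m + 1 at \<open>s\<close> the excess at \<open>s * x\<close> is m.
    For m = 0 this is the level at which \<phi> is \<open>G\<close>, so stopping needs no separate
    case.\<close>
  have "cls D (shift \<sigma> \<cdot> (Psi \<sigma> \<cdot> k \<cdot> G \<cdot> H) \<cdot> s) = cls D (shift \<sigma> \<cdot> (phi \<sigma> \<cdot> G \<cdot> H \<cdot> m) \<cdot> s)"
  proof (rule app_ext[OF 5(1), where \<pi> = N and \<rho> = \<sigma>])
    fix y assume "tyc D y = Some N"
    then obtain x where x: "y = cls D x" "x :| N" by (rule tyc_repE)
    then show "app D (cls D (shift \<sigma> \<cdot> (Psi \<sigma> \<cdot> k \<cdot> G \<cdot> H) \<cdot> s)) y = app D (cls D (shift \<sigma> \<cdot> (phi \<sigma> \<cdot> G \<cdot> H \<cdot> m) \<cdot> s)) y"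
      using Psi_simps[of D k G \<sigma> H "Cn (Snoc N) \<cdot> s \<cdot> x"] 5 k by simp
  qed (use 5 k in simp_all)
  then show ?case using Psi_simps[of D k G \<sigma> H s] 5 k by simp
qed


section \<open>The logical relation\<close>

text \<open>An object of type \<rho> depending on \<alpha> is a function from
  \<open>N \<rightarrow> N\<close> to \<rho>; this is pointwise application of such objects, the S
  combinator.\<close>

definition comp_app :: "ty \<Rightarrow> ty \<Rightarrow> tm" where
  "comp_app \<rho> \<eta> = (let f = (''f'', (N \<rightarrow> N) \<rightarrow> \<rho> \<rightarrow> \<eta>); x = (''x'', (N \<rightarrow> N) \<rightarrow> \<rho>); a = (''a'', N \<rightarrow> N) in
     lam f (lam x (lam a (Free f \<cdot> Free a \<cdot> (Free x \<cdot> Free a)))))"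

lemma comp_app_closed [simp]:
  "(comp_app \<rho> \<eta>) :| (((N \<rightarrow> N) \<rightarrow> \<rho> \<rightarrow> \<eta>) \<rightarrow> ((N \<rightarrow> N) \<rightarrow> \<rho>) \<rightarrow> (N \<rightarrow> N) \<rightarrow> \<eta>)"
  "fv (comp_app \<rho> \<eta>) = {}"
  by (auto simp: comp_app_def Let_def)

lemma comp_app_simps [simp]:
  "finite W \<Longrightarrow> tyc W f = Some ((N \<rightarrow> N) \<rightarrow> \<rho> \<rightarrow> \<eta>) \<Longrightarrow> tyc W x = Some ((N \<rightarrow> N) \<rightarrow> \<rho>) \<Longrightarrow> tyc W a = Some (N \<rightarrow> N) \<Longrightarrow>
    cls W (comp_app \<rho> \<eta>) \<bullet>[W] f \<bullet>[W] x \<bullet>[W] a = f \<bullet>[W] a \<bullet>[W] (x \<bullet>[W] a)"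
  by (simp add: comp_app_def Let_def)

lemma sub_closed: "fv t = {} \<Longrightarrow> t :| \<rho> \<Longrightarrow> sub \<theta> e k t = t"
  using sub_cong[of t \<theta> Free e k] sub_Free_closed[of "[]" t \<rho> k e] by simp

lemma fv_subst: "fv (subst x w t) \<subseteq> (fv t - {x}) \<union> fv w"
  by (induction t) auto

lemma ffv_fsubst: "ffv (fsubst x w A) \<subseteq> (ffv A - {x}) \<union> fv w"
proof (induction A)
  case (Eq t u)
  then show ?case using fv_subst[of x w t] fv_subst[of x w u] by auto
qed auto

definition rel_f :: "ty \<Rightarrow> var" where
  "rel_f \<rho> = (''f'', (N \<rightarrow> N) \<rightarrow> \<rho>)"

definition rel_u :: "ty \<Rightarrow> ty \<Rightarrow> var" where
  "rel_u \<sigma> \<rho> = (''u'', ty_tr \<sigma> \<rho>)"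

lemma rel_vars [simp]: "rel_f \<rho> \<noteq> rel_u \<sigma> \<eta>" "rel_u \<sigma> \<eta> \<noteq> rel_f \<rho>" "snd (rel_f \<rho>) = (N \<rightarrow> N) \<rightarrow> \<rho>"
  "snd (rel_u \<sigma> \<rho>) = ty_tr \<sigma> \<rho>"
  by (auto simp: rel_f_def rel_u_def)

text \<open>The internal form of \<open>good\<close> at the bar \<open>chi\<close>. Only a formula
  can be the subject of the induction that treats the recursor.\<close>

definition good_fm :: "ty \<Rightarrow> fm" where
  "good_fm \<sigma> = (let f = rel_f N; u = rel_u \<sigma> N; s = (''s'', Seq N); x = (''x'', N); c = (''c'', N \<rightarrow> N);
       a = (''a'', N \<rightarrow> N); n = (''n'', N); G = (''G'', GT \<sigma>); H = (''H'', HT \<sigma>);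
       \<chi> = chi \<sigma> \<cdot> Free u; v = Val \<sigma> (Free u); b = BB \<sigma> (Free u) in
     Conj (Free f \<doteq> v)
    (Conj (all a (ex n (\<chi> \<cdot> (initial \<cdot> Free a \<cdot> Free n) \<doteq> Cn Zero)))
    (Conj (all s (all x (Imp (\<chi> \<cdot> Free s \<doteq> Cn Zero) (\<chi> \<cdot> (Cn (Snoc N) \<cdot> Free s \<cdot> Free x) \<doteq> Cn Zero))))
    (Conj (all s (all c (Imp (\<chi> \<cdot> Free s \<doteq> Cn Zero) (v \<cdot> (prepend \<cdot> Free s \<cdot> Free c) \<doteq> v \<cdot> (hat \<cdot> Free s)))))
    (Conj (all G (all H (all s (Imp (\<chi> \<cdot> Free s \<doteq> Cn Zero) (b \<cdot> Free G \<cdot> Free H \<cdot> Free s \<doteq> Free G \<cdot> Free s)))))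
          (all G (all H (all s (all n (Imp (\<chi> \<cdot> Free s \<doteq> Cn Succ \<cdot> Free n)
             (b \<cdot> Free G \<cdot> Free H \<cdot> Free s \<doteq> Free H \<cdot> Free s \<cdot> (shift \<sigma> \<cdot> (b \<cdot> Free G \<cdot> Free H) \<cdot> Free s))))))))))))"

text \<open>The usual clause for function types. Implication already supplies the passage to later
  worlds, so the formula mentions no worlds. The last clause is a default for types that are not
  translated.\<close>

fun rel_fm :: "ty \<Rightarrow> ty \<Rightarrow> fm" where
  "rel_fm \<sigma> N = good_fm \<sigma>"
| "rel_fm \<sigma> (\<rho> \<rightarrow> \<eta>) = (let x = (''x'', (N \<rightarrow> N) \<rightarrow> \<rho>); y = (''y'', ty_tr \<sigma> \<rho>) in
     all x (all y (Imp
       (fsubst (rel_f \<rho>) (Free x) (fsubst (rel_u \<sigma> \<rho>) (Free y) (rel_fm \<sigma> \<rho>)))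
       (fsubst (rel_f \<eta>) (comp_app \<rho> \<eta> \<cdot> Free (rel_f (\<rho> \<rightarrow> \<eta>)) \<cdot> Free x)
         (fsubst (rel_u \<sigma> \<eta>) (Free (rel_u \<sigma> (\<rho> \<rightarrow> \<eta>)) \<cdot> Free y) (rel_fm \<sigma> \<eta>))))))"
| "rel_fm \<sigma> _ = Bot"

lemma wff_good_fm [simp]: "wff (good_fm \<sigma>)"
  by (simp add: good_fm_def Let_def has_type_iff)

lemma ffv_good_fm: "ffv (good_fm \<sigma>) \<subseteq> {rel_f N, rel_u \<sigma> N}"
  by (auto simp: good_fm_def Let_def)

lemma wff_rel_fm [simp]: "wff (rel_fm \<sigma> \<rho>)"
  by (induction \<sigma> \<rho> rule: rel_fm.induct) (simp_all add: Let_def)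

lemma ffv_rel_fm: "ffv (rel_fm \<sigma> \<rho>) \<subseteq> {rel_f \<rho>, rel_u \<sigma> \<rho>}"
proof (induction \<sigma> \<rho> rule: rel_fm.induct)
  case (1 \<sigma>)
  then show ?case using ffv_good_fm by simp
next
  case (2 \<sigma> \<rho> \<eta>)
  let ?x = "(''x'', (N \<rightarrow> N) \<rightarrow> \<rho>)" and ?y = "(''y'', ty_tr \<sigma> \<rho>)"
  let ?A = "fsubst (rel_u \<sigma> \<rho>) (Free ?y) (rel_fm \<sigma> \<rho>)"
    and ?B = "fsubst (rel_u \<sigma> \<eta>) (Free (rel_u \<sigma> (\<rho> \<rightarrow> \<eta>)) \<cdot> Free ?y) (rel_fm \<sigma> \<eta>)"
  have "ffv ?A \<subseteq> {rel_f \<rho>, ?y}" using ffv_fsubst[of "rel_u \<sigma> \<rho>" "Free ?y" "rel_fm \<sigma> \<rho>"] 2(1)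
    by fastforce
  then have 1: "ffv (fsubst (rel_f \<rho>) (Free ?x) ?A) \<subseteq> {?x, ?y}"
    using ffv_fsubst[of "rel_f \<rho>" "Free ?x" ?A] by fastforce
  have "ffv ?B \<subseteq> {rel_f \<eta>, rel_u \<sigma> (\<rho> \<rightarrow> \<eta>), ?y}"
    using ffv_fsubst[of "rel_u \<sigma> \<eta>" "Free (rel_u \<sigma> (\<rho> \<rightarrow> \<eta>)) \<cdot> Free ?y" "rel_fm \<sigma> \<eta>"] 2(2) by fastforce
  then have 2: "ffv (fsubst (rel_f \<eta>) (comp_app \<rho> \<eta> \<cdot> Free (rel_f (\<rho> \<rightarrow> \<eta>)) \<cdot> Free ?x) ?B)
      \<subseteq> {rel_f (\<rho> \<rightarrow> \<eta>), rel_u \<sigma> (\<rho> \<rightarrow> \<eta>), ?x, ?y}"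
    using ffv_fsubst[of "rel_f \<eta>" "comp_app \<rho> \<eta> \<cdot> Free (rel_f (\<rho> \<rightarrow> \<eta>)) \<cdot> Free ?x" ?B] by fastforce
  show ?case using 1 2 by (auto simp: Let_def simp del: ty_tr.simps)
qed simp_all

lemma sat_good_fm:
  assumes fin: "finite W" and ok: "okt \<theta>"
  shows "sat W \<theta> (good_fm \<sigma>) \<longleftrightarrow>
    cls W (\<theta> (rel_f N)) = cls W (Val \<sigma> (\<theta> (rel_u \<sigma> N))) \<and>
    good \<sigma> W (chi \<sigma> \<cdot> \<theta> (rel_u \<sigma> N)) (Val \<sigma> (\<theta> (rel_u \<sigma> N))) (BB \<sigma> (\<theta> (rel_u \<sigma> N)))"
proof -
  let ?u = "\<theta> (rel_u \<sigma> N)"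
  let ?\<chi> = "chi \<sigma> \<cdot> ?u"
  let ?a = "(''a'', N \<rightarrow> N)" and ?n = "(''n'', N)"
  let ?A = "chi \<sigma> \<cdot> Free (rel_u \<sigma> N) \<cdot> (initial \<cdot> Free ?a \<cdot> Free ?n) \<doteq> Cn Zero"
  have ne: "rel_u \<sigma> N \<noteq> ?a" "rel_u \<sigma> N \<noteq> ?n" "?a \<noteq> rel_u \<sigma> N" "?n \<noteq> rel_u \<sigma> N"
    "rel_f N \<noteq> ?a" "rel_f N \<noteq> ?n" by (simp_all add: rel_u_def rel_f_def)
  have wff: "wff ?A" by (simp add: has_type_iff)
  have A: "sat D (\<theta>(?a := a, ?n := n)) ?A \<longleftrightarrow> cls D (?\<chi> \<cdot> (initial \<cdot> a \<cdot> n)) = cls D (Cn Zero)"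
    if "finite D" "a :| (N \<rightarrow> N)" "n :| N" for D a n
    using that ok ne by (simp add: env_def)
  have bar: "sat W \<theta> (all ?a (ex ?n ?A)) \<longleftrightarrow>
    (\<forall>W' a C. finite W' \<longrightarrow> W \<subseteq> W' \<longrightarrow> a :| (N \<rightarrow> N) \<longrightarrow>
      (\<forall>W'' n. finite W'' \<longrightarrow> W' \<subseteq> W'' \<longrightarrow> n :| N \<longrightarrow>
        cls W'' (?\<chi> \<cdot> (initial \<cdot> a \<cdot> n)) = cls W'' (Cn Zero) \<longrightarrow> W'' \<turnstile> C) \<longrightarrow> W' \<turnstile> C)" (is "_ = ?R")
  proof
    assume "sat W \<theta> (all ?a (ex ?n ?A))"
    then have *: "sat W (\<theta>(?a := a)) (ex ?n ?A)" if "a :| (N \<rightarrow> N)" for a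
      using fin ok wff that by (subst (asm) sat_all) (auto simp del: fun_upd_apply)
    show ?R
    proof (intro allI impI)
      fix W' a C
      assume G: "finite W'" "W \<subseteq> W'" "a :| (N \<rightarrow> N)"
        and C: "\<forall>W'' n. finite W'' \<longrightarrow> W' \<subseteq> W'' \<longrightarrow> n :| N \<longrightarrow>
          cls W'' (?\<chi> \<cdot> (initial \<cdot> a \<cdot> n)) = cls W'' (Cn Zero) \<longrightarrow> W'' \<turnstile> C"
      show "W' \<turnstile> C"
        using sat_mono[OF *[OF G(3)] G(2,1)]
      proof (rule sat_exE)
        fix D n assume D: "finite D" "W' \<subseteq> D" "n :| (snd ?n)" "sat D (\<theta>(?a := a, ?n := n)) ?A"
        then have "cls D (?\<chi> \<cdot> (initial \<cdot> a \<cdot> n)) = cls D (Cn Zero)" using A[OF D(1) G(3)] by simp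
        with C D show "D \<turnstile> C" by simp
      qed (use G ok wff in simp_all)
    qed
  next
    assume R: ?R
    have "sat W (\<theta>(?a := a)) (ex ?n ?A)" if a: "a :| (N \<rightarrow> N)" for a
      unfolding sat_def
    \<comment> \<open>The elimination principle is applied with the existential statement itself as
      goal.\<close>
    proof (rule R[rule_format, OF fin subset_refl a])
      fix D n assume D: "finite D" "W \<subseteq> D" "n :| N"
        "cls D (?\<chi> \<cdot> (initial \<cdot> a \<cdot> n)) = cls D (Cn Zero)"
      then have "sat D (\<theta>(?a := a, ?n := n)) ?A" using A[OF D(1) a D(3)] by simp
      then show "D \<turnstile> fsub (\<theta>(?a := a)) [] 0 (ex ?n ?A)"
        unfolding sat_def[symmetric] using D ok a wff by (intro sat_exI[of _ _ n]) simp_all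
    qed
    then show "sat W \<theta> (all ?a (ex ?n ?A))"
      using fin ok wff by (subst sat_all) (auto simp del: fun_upd_apply)
  qed
  have split: "sat W \<theta> (good_fm \<sigma>) \<longleftrightarrow>
    cls W (\<theta> (rel_f N)) = cls W (Val \<sigma> ?u) \<and> sat W \<theta> (all ?a (ex ?n ?A)) \<and>
    (\<forall>s x W'. s :| (Seq N) \<longrightarrow> x :| N \<longrightarrow> finite W' \<longrightarrow> W \<subseteq> W' \<longrightarrow>
      cls W' (?\<chi> \<cdot> s) = cls W' (Cn Zero) \<longrightarrow> cls W' (?\<chi> \<cdot> (Cn (Snoc N) \<cdot> s \<cdot> x)) = cls W' (Cn Zero)) \<and>
    (\<forall>s c W'. s :| (Seq N) \<longrightarrow> c :| (N \<rightarrow> N) \<longrightarrow> finite W' \<longrightarrow> W \<subseteq> W' \<longrightarrow>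
      cls W' (?\<chi> \<cdot> s) = cls W' (Cn Zero) \<longrightarrow> cls W' (Val \<sigma> ?u \<cdot> (prepend \<cdot> s \<cdot> c)) = cls W' (Val \<sigma> ?u \<cdot> (hat \<cdot> s))) \<and>
    (\<forall>G H s W'. G :| (GT \<sigma>) \<longrightarrow> H :| (HT \<sigma>) \<longrightarrow> s :| (Seq N) \<longrightarrow> finite W' \<longrightarrow> W \<subseteq> W' \<longrightarrow>
      cls W' (?\<chi> \<cdot> s) = cls W' (Cn Zero) \<longrightarrow> cls W' (BB \<sigma> ?u \<cdot> G \<cdot> H \<cdot> s) = cls W' (G \<cdot> s)) \<and>
    (\<forall>G H s m W'. G :| (GT \<sigma>) \<longrightarrow> H :| (HT \<sigma>) \<longrightarrow> s :| (Seq N) \<longrightarrow> m :| N \<longrightarrow>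
      finite W' \<longrightarrow> W \<subseteq> W' \<longrightarrow> cls W' (?\<chi> \<cdot> s) = cls W' (Cn Succ \<cdot> m) \<longrightarrow>
      cls W' (BB \<sigma> ?u \<cdot> G \<cdot> H \<cdot> s) = cls W' (H \<cdot> s \<cdot> (shift \<sigma> \<cdot> (BB \<sigma> ?u \<cdot> G \<cdot> H) \<cdot> s)))"
    using fin ok by (simp add: good_fm_def Let_def has_type_iff env_def rel_u_def rel_f_def)
  show ?thesis
    unfolding split bar good_def conj_assoc by (intro arg_cong2[where f = "(\<and>)"] refl; blast)
qed

definition rel :: "ty \<Rightarrow> fm set \<Rightarrow> ty \<Rightarrow> tm \<Rightarrow> tm \<Rightarrow> bool" where
  "rel \<sigma> W \<rho> f u \<longleftrightarrow> sat W (Free(rel_f \<rho> := f, rel_u \<sigma> \<rho> := u)) (rel_fm \<sigma> \<rho>)"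

lemma sat_rel_fm: "sat W \<theta> (rel_fm \<sigma> \<rho>) \<longleftrightarrow> rel \<sigma> W \<rho> (\<theta> (rel_f \<rho>)) (\<theta> (rel_u \<sigma> \<rho>))"
  unfolding rel_def using ffv_rel_fm by (intro sat_cong) fastforce

lemma rel_mono: "rel \<sigma> W \<rho> f u \<Longrightarrow> W \<subseteq> W' \<Longrightarrow> finite W' \<Longrightarrow> rel \<sigma> W' \<rho> f u"
  unfolding rel_def by (rule sat_mono)

lemma rel_cong:
  assumes "rel \<sigma> W \<rho> f u" "f :| ((N \<rightarrow> N) \<rightarrow> \<rho>)" "u :| (ty_tr \<sigma> \<rho>)"
    "cls W f = cls W f'" "cls W u = cls W u'"
  shows "rel \<sigma> W \<rho> f' u'"
proof -
  have ty: "f' :| ((N \<rightarrow> N) \<rightarrow> \<rho>)" using tyof_cls_eq[OF assms(4)] assms by simp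
  have "sat W (Free(rel_f \<rho> := f, rel_u \<sigma> \<rho> := u')) (rel_fm \<sigma> \<rho>)"
    by (rule sat_Leibniz[where t = u]) (use assms in \<open>simp_all add: rel_def\<close>)
  then have "sat W (Free(rel_u \<sigma> \<rho> := u', rel_f \<rho> := f)) (rel_fm \<sigma> \<rho>)" by (simp add: fun_upd_twist)
  then have "sat W (Free(rel_u \<sigma> \<rho> := u', rel_f \<rho> := f')) (rel_fm \<sigma> \<rho>)"
    by (rule sat_Leibniz[where t = f, rotated -1]) (use assms tyof_cls_eq[OF assms(5)] in simp_all)
  then show ?thesis by (simp add: rel_def fun_upd_twist)
qed

lemma rel_N:
  assumes "finite W" "f :| ValT" "u :| (ty_tr \<sigma> N)"
  shows "rel \<sigma> W N f u \<longleftrightarrow> cls W f = cls W (Val \<sigma> u) \<and> good \<sigma> W (chi \<sigma> \<cdot> u) (Val \<sigma> u) (BB \<sigma> u)"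
  using sat_good_fm[of W "Free(rel_f N := f, rel_u \<sigma> N := u)" \<sigma>] assms by (simp add: rel_def)

lemma rel_Fn:
  assumes "finite W" "f :| ((N \<rightarrow> N) \<rightarrow> \<rho> \<rightarrow> \<eta>)" "u :| (ty_tr \<sigma> (\<rho> \<rightarrow> \<eta>))"
  shows "rel \<sigma> W (\<rho> \<rightarrow> \<eta>) f u \<longleftrightarrow> (\<forall>x y W'. x :| ((N \<rightarrow> N) \<rightarrow> \<rho>) \<longrightarrow> y :| (ty_tr \<sigma> \<rho>) \<longrightarrow>
    finite W' \<longrightarrow> W \<subseteq> W' \<longrightarrow> rel \<sigma> W' \<rho> x y \<longrightarrow> rel \<sigma> W' \<eta> (comp_app \<rho> \<eta> \<cdot> f \<cdot> x) (u \<cdot> y))"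
proof -
  let ?x = "(''x'', (N \<rightarrow> N) \<rightarrow> \<rho>)" and ?y = "(''y'', ty_tr \<sigma> \<rho>)"
  let ?\<theta> = "Free(rel_f (\<rho> \<rightarrow> \<eta>) := f, rel_u \<sigma> (\<rho> \<rightarrow> \<eta>) := u)"
  have ne: "rel_f \<kappa> \<noteq> ?x" "rel_f \<kappa> \<noteq> ?y" "rel_u \<sigma> \<kappa> \<noteq> ?x" "rel_u \<sigma> \<kappa> \<noteq> ?y"
    "?x \<noteq> rel_f \<kappa>" "?y \<noteq> rel_f \<kappa>" "?x \<noteq> rel_u \<sigma> \<kappa>" "?y \<noteq> rel_u \<sigma> \<kappa>" for \<kappa>
    by (simp_all add: rel_f_def rel_u_def)
  have ok: "okt ?\<theta>" using assms by simp
  have "sat W ?\<theta> (rel_fm \<sigma> (\<rho> \<rightarrow> \<eta>)) \<longleftrightarrow> (\<forall>x. x :| ((N \<rightarrow> N) \<rightarrow> \<rho>) \<longrightarrow> (\<forall>y. y :| (ty_tr \<sigma> \<rho>) \<longrightarrow>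
    (\<forall>W'. finite W' \<longrightarrow> W \<subseteq> W' \<longrightarrow> rel \<sigma> W' \<rho> x y \<longrightarrow> rel \<sigma> W' \<eta> (comp_app \<rho> \<eta> \<cdot> f \<cdot> x) (u \<cdot> y))))"
    using assms ok ne by (simp add: Let_def sat_rel_fm sub_closed)
  then show ?thesis unfolding rel_def[of _ _ "\<rho> \<rightarrow> \<eta>"] by blast
qed


section \<open>The translation respects the relation\<close>

lemma snd_alpha [simp]: "snd alpha = N \<rightarrow> N"
  by (simp add: alpha_def)

lemma num_tr_closed [simp]:
  "k :| N \<Longrightarrow> (num_tr \<sigma> k) :| (ty_tr \<sigma> N)" "fv (num_tr \<sigma> k) = fv k - {alpha}"
  by (auto simp: num_tr_def Let_def alpha_def)

lemma Succ_tr_closed [simp]: "(Succ_tr \<sigma>) :| (ty_tr \<sigma> (N \<rightarrow> N))" "fv (Succ_tr \<sigma>) = {}"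
  by (auto simp: Succ_tr_def Let_def alpha_def)

lemma alpha_tr_closed [simp]: "(alpha_tr \<sigma>) :| (ty_tr \<sigma> (N \<rightarrow> N))" "fv (alpha_tr \<sigma>) = {}"
  by (auto simp: alpha_tr_def Let_def alpha_def)

text \<open>Needed because \<open>num_tr\<close> abstracts \<open>alpha\<close> over its argument
  and would capture it in an arbitrary term. Applying a closed function to the term avoids this, and
  also gives a term that depends on the number as a parameter.\<close>

definition num_fun :: "ty \<Rightarrow> tm" where
  "num_fun \<sigma> = lam (''k'', N) (num_tr \<sigma> (Free (''k'', N)))"

definition const_tm :: "tm" where
  "const_tm = lam (''k'', N) (lam (''a'', N \<rightarrow> N) (Free (''k'', N)))"

lemma num_fun_closed [simp]: "(num_fun \<sigma>) :| (N \<rightarrow> ty_tr \<sigma> N)" "fv (num_fun \<sigma>) = {}"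
  by (simp_all add: num_fun_def)

lemma const_tm_closed [simp]: "const_tm :| (N \<rightarrow> ValT)" "fv const_tm = {}"
  by (auto simp: const_tm_def)

lemma const_tm_simps [simp]:
  "finite W \<Longrightarrow> tyc W k = Some N \<Longrightarrow> tyc W a = Some (N \<rightarrow> N) \<Longrightarrow> cls W const_tm \<bullet>[W] k \<bullet>[W] a = k"
  by (simp add: const_tm_def)

lemma cls_ext:
  assumes "finite W" "f :| (\<pi> \<rightarrow> \<rho>)" "g :| (\<pi> \<rightarrow> \<rho>)"
    "\<And>a. a :| \<pi> \<Longrightarrow> cls W (f \<cdot> a) = cls W (g \<cdot> a)"
  shows "cls W f = cls W g"
proof (rule app_ext[OF assms(1), where \<pi> = \<pi> and \<rho> = \<rho>])
  fix a assume "tyc W a = Some \<pi>"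
  then obtain t where "a = cls W t" "t :| \<pi>" by (rule tyc_repE)
  then show "app W (cls W f) a = app W (cls W g) a" using assms(4) by simp
qed (use assms in simp_all)

text \<open>The bar \<chi> and the components \<open>v\<close>, \<open>b\<close> may be chosen
  freely up to provable equality; \<open>good_chi\<close> replaces the bar by the one fixed in the
  relation.\<close>

lemma rel_NI:
  assumes "finite W" "f :| ValT" "u :| (ty_tr \<sigma> N)" "good \<sigma> W \<chi> v b"
    "\<chi> :| (Seq N \<rightarrow> N)" "cls W (Val \<sigma> u) = cls W v" "cls W (BB \<sigma> u) = cls W b"
    "\<And>a. a :| (N \<rightarrow> N) \<Longrightarrow> cls W (f \<cdot> a) = cls W (v \<cdot> a)"
  shows "rel \<sigma> W N f u"
proof -
  have "good \<sigma> W (chi \<sigma> \<cdot> u) (Val \<sigma> u) (BB \<sigma> u)"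
    by (rule good_chi[OF assms(4)]) (use assms in simp_all)
  moreover have "cls W f = cls W (Val \<sigma> u)"
    by (rule cls_ext) (use assms in simp_all)
  ultimately show ?thesis using assms by (subst rel_N) auto
qed

lemma num_fun_simps:
  assumes "finite W" "tyc W k = Some N"
  shows "tyc W a = Some (N \<rightarrow> N) \<Longrightarrow>
      cls W (Cn (Fst ValT (BT \<sigma>))) \<bullet>[W] (cls W (num_fun \<sigma>) \<bullet>[W] k) \<bullet>[W] a = k"
    and "tyc W G = Some (GT \<sigma>) \<Longrightarrow> tyc W H = Some (HT \<sigma>) \<Longrightarrow>
      cls W (Cn (Snd ValT (BT \<sigma>))) \<bullet>[W] (cls W (num_fun \<sigma>) \<bullet>[W] k) \<bullet>[W] G \<bullet>[W] H = G"
  using assms by (simp_all add: num_fun_def num_tr_def Let_def alpha_def)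

lemma rel_num:
  assumes "finite W" "k :| N"
  shows "rel \<sigma> W N (const_tm \<cdot> k) (num_fun \<sigma> \<cdot> k)"
proof (rule rel_NI)
  show "good \<sigma> W (lam (''s'', Seq N) (Cn Zero)) (Val \<sigma> (num_fun \<sigma> \<cdot> k)) (BB \<sigma> (num_fun \<sigma> \<cdot> k))"
    by (rule good_const) (use assms in \<open>simp_all add: num_fun_simps\<close>)
qed (use assms in \<open>simp_all add: num_fun_simps\<close>)

lemma rel_Zero:
  assumes "finite W" "f :| ValT" "\<And>a. a :| (N \<rightarrow> N) \<Longrightarrow> cls W (f \<cdot> a) = cls W (Cn Zero)"
  shows "rel \<sigma> W N f (num_tr \<sigma> (Cn Zero))"
proof (rule rel_cong[OF rel_num])
  show "cls W (const_tm \<cdot> Cn Zero) = cls W f"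
    by (rule cls_ext[where \<pi> = "N \<rightarrow> N" and \<rho> = N]) (use assms in simp_all)
  have "sem W ((env W Free)((''k'', N) := cls W (Cn Zero))) (lam alpha (Free (''k'', N))) = cls W (lam alpha (Cn Zero))"
    by (rule app_ext[OF assms(1), where \<pi> = "N \<rightarrow> N" and \<rho> = N]) (use assms in \<open>simp_all add: alpha_def\<close>)
  then show "cls W (num_fun \<sigma> \<cdot> Cn Zero) = cls W (num_tr \<sigma> (Cn Zero))"
    using assms(1) by (simp add: num_fun_def num_tr_def Let_def sem_closed)
qed (use assms in simp_all)

lemma rel_Succ:
  assumes "finite W" "f :| ((N \<rightarrow> N) \<rightarrow> N \<rightarrow> N)"
    and f: "\<And>W' a. finite W' \<Longrightarrow> W \<subseteq> W' \<Longrightarrow> a :| (N \<rightarrow> N) \<Longrightarrow> cls W' (f \<cdot> a) = cls W' (Cn Succ)"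
  shows "rel \<sigma> W (N \<rightarrow> N) f (Succ_tr \<sigma>)"
proof -
  have "rel \<sigma> D N (comp_app N N \<cdot> f \<cdot> x) (Succ_tr \<sigma> \<cdot> y)"
    if D: "x :| ValT" "y :| (ty_tr \<sigma> N)" "finite D" "W \<subseteq> D" "rel \<sigma> D N x y" for x y D
  proof -
    from D have x: "cls D x = cls D (Val \<sigma> y)" and g: "good \<sigma> D (chi \<sigma> \<cdot> y) (Val \<sigma> y) (BB \<sigma> y)"
      by (auto simp: rel_N)
    show ?thesis
    proof (rule rel_NI)
      show "good \<sigma> D (chi \<sigma> \<cdot> y) (Val \<sigma> (Succ_tr \<sigma> \<cdot> y)) (BB \<sigma> y)"
        by (rule good_fun[OF g, where f = "Cn Succ"]) (use D in \<open>simp_all add: Succ_tr_def Let_def alpha_def\<close>)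
    qed (use D x f assms(2) in \<open>simp_all add: Succ_tr_def Let_def alpha_def\<close>)
  qed
  then show ?thesis using assms by (subst rel_Fn) auto
qed

lemma rel_alpha:
  assumes "finite W" "f :| ((N \<rightarrow> N) \<rightarrow> N \<rightarrow> N)"
    and f: "\<And>W' a. finite W' \<Longrightarrow> W \<subseteq> W' \<Longrightarrow> a :| (N \<rightarrow> N) \<Longrightarrow> cls W' (f \<cdot> a) = cls W' a"
  shows "rel \<sigma> W (N \<rightarrow> N) f (alpha_tr \<sigma>)"
proof -
  have "rel \<sigma> D N (comp_app N N \<cdot> f \<cdot> x) (alpha_tr \<sigma> \<cdot> y)"
    if D: "x :| ValT" "y :| (ty_tr \<sigma> N)" "finite D" "W \<subseteq> D" "rel \<sigma> D N x y" for x y D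
  proof -
    from D have x: "cls D x = cls D (Val \<sigma> y)" and g: "good \<sigma> D (chi \<sigma> \<cdot> y) (Val \<sigma> y) (BB \<sigma> y)"
      by (auto simp: rel_N)
    let ?v = "comp_val \<cdot> Val \<sigma> y \<cdot> apply_tm" and ?b = "comp_rec \<sigma> \<cdot> Val \<sigma> y \<cdot> BB \<sigma> y \<cdot> Psi \<sigma>"
    show ?thesis
    proof (rule rel_NI)
      show "good \<sigma> D (comp_bar \<cdot> (chi \<sigma> \<cdot> y) \<cdot> Val \<sigma> y \<cdot> excess_tm) ?v ?b"
        by (rule good_comp[OF g good_Psi]) (use D in simp_all)
      show "cls D (Val \<sigma> (alpha_tr \<sigma> \<cdot> y)) = cls D ?v"
        by (rule cls_ext[where \<pi> = "N \<rightarrow> N" and \<rho> = N]) (use D in \<open>simp_all add: alpha_tr_def Let_def alpha_def\<close>)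
      show "cls D (BB \<sigma> (alpha_tr \<sigma> \<cdot> y)) = cls D ?b"
      proof (rule cls_ext[where \<pi> = "GT \<sigma>" and \<rho> = "HT \<sigma> \<rightarrow> Seq N \<rightarrow> \<sigma>"])
        fix G assume G: "G :| (GT \<sigma>)"
        show "cls D (BB \<sigma> (alpha_tr \<sigma> \<cdot> y) \<cdot> G) = cls D (?b \<cdot> G)"
        proof (rule cls_ext[where \<pi> = "HT \<sigma>" and \<rho> = "Seq N \<rightarrow> \<sigma>"])
          fix H assume H: "H :| (HT \<sigma>)"
          let ?\<rho> = "(env D Free)((''x'', ty_tr \<sigma> N) := cls D y, (''G'', GT \<sigma>) := cls D G, (''H'', HT \<sigma>) := cls D H)"
          let ?L = "lam (''s'', Seq N) (Psi \<sigma> \<cdot> (Val \<sigma> (Free (''x'', ty_tr \<sigma> N)) \<cdot> (hat \<cdot> Free (''s'', Seq N))) \<cdot>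
            Free (''G'', GT \<sigma>) \<cdot> Free (''H'', HT \<sigma>) \<cdot> Free (''s'', Seq N))"
          \<comment> \<open>The stopping function of the translation is an abstraction evaluated in
            an assignment for its free variables; extensionality identifies it with
            \<open>comp_stop\<close> for the family \<Psi>.\<close>
          have "sem D ?\<rho> ?L = cls D (comp_stop \<sigma> \<cdot> Val \<sigma> y \<cdot> Psi \<sigma> \<cdot> G \<cdot> H)"
            by (rule app_ext[OF D(3), where \<pi> = "Seq N" and \<rho> = \<sigma>]) (use D G H in simp_all)
          then show "cls D (BB \<sigma> (alpha_tr \<sigma> \<cdot> y) \<cdot> G \<cdot> H) = cls D (?b \<cdot> G \<cdot> H)"
            using D G H by (simp add: alpha_tr_def Let_def alpha_def)
        qed (use D G in simp_all)
      qed (use D in simp_all)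
    qed (use D x f assms(2) in simp_all)
  qed
  then show ?thesis using assms by (subst rel_Fn) auto
qed


section \<open>Argument tuples and the translated recursor\<close>

fun upds :: "(var \<Rightarrow> 'a) \<Rightarrow> var list \<Rightarrow> 'a list \<Rightarrow> var \<Rightarrow> 'a" where
  "upds \<rho> (x # xs) (a # as) = upds (\<rho>(x := a)) xs as"
| "upds \<rho> _ _ = \<rho>"

lemma upds_notin: "y \<notin> set xs \<Longrightarrow> upds \<rho> xs as y = \<rho> y"
  by (induction \<rho> xs as rule: upds.induct) auto

lemma map_upds: "distinct xs \<Longrightarrow> length xs = length as \<Longrightarrow> map (upds \<rho> xs as) xs = as"
  by (induction \<rho> xs as rule: upds.induct) (auto simp: upds_notin)

lemma lams_simps [simp]: "lams [] t = t" "lams (x # xs) t = lam x (lams xs t)"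
  by (simp_all add: lams_def)

lemma apps_simps [simp]: "apps t [] = t" "apps t (u # us) = apps (t \<cdot> u) us"
  by (simp_all add: apps_def)

lemma tyof_lams [simp]:
  "tyof [] t \<noteq> None \<Longrightarrow> tyof [] (lams xs t) = map_option (foldr Fn (map snd xs)) (tyof [] t)"
  by (induction xs) auto

lemma fv_lams [simp]: "fv (lams xs t) = fv t - set xs"
  by (induction xs) auto

lemma tyof_apps:
  "t :| (foldr Fn \<Delta> \<rho>) \<Longrightarrow> typed_list us \<Delta> \<Longrightarrow> (apps t us) :| \<rho>"
proof (induction us arbitrary: t \<Delta>)
  case (Cons u us)
  then obtain \<pi> \<Delta>' where "\<Delta> = \<pi> # \<Delta>'" "u :| \<pi>" "typed_list us \<Delta>'"
    by (auto simp: list_all2_Cons1)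
  with Cons.IH[of "t \<cdot> u" \<Delta>'] Cons.prems show ?case by simp
qed simp

lemma fv_apps [simp]: "fv (apps t us) = fv t \<union> (\<Union>u\<in>set us. fv u)"
  by (induction us arbitrary: t) auto

lemma cls_apps: "cls W (apps t us) = foldl (app W) (cls W t) (map (cls W) us)"
  by (induction us arbitrary: t) auto

lemma sem_apps: "sem W \<rho> (apps t us) = foldl (app W) (sem W \<rho> t) (map (sem W \<rho>) us)"
  by (induction us arbitrary: t) auto

lemma sem_lams:
  assumes "okv W \<rho>" "list_all2 (\<lambda>x a. tyc W a = Some (snd x)) xs as" "tyof [] t \<noteq> None"
  shows "foldl (app W) (sem W \<rho> (lams xs t)) as = sem W (upds \<rho> xs as) t \<and> okv W (upds \<rho> xs as)"
  using assms by (induction \<rho> xs as rule: upds.induct) auto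

text \<open>A type built from \<open>N\<close> and arrows ends in \<open>N\<close>, so after all its
  arguments the translated type is that of a translated number. This is what makes the body of
  \<open>Rec_tr\<close> typable as a pair.\<close>

lemma ty_tr_foldr: "simple \<eta> \<Longrightarrow> ty_tr \<sigma> \<eta> = foldr Fn (map (ty_tr \<sigma>) (arg_types \<eta>)) (ty_tr \<sigma> N)"
proof (induction \<eta>)
  case (Fn \<rho> \<eta>)
  then have "ty_tr \<sigma> \<eta> = foldr Fn (map (ty_tr \<sigma>) (arg_types \<eta>)) (ty_tr \<sigma> N)" by simp
  then show ?case by (simp del: ty_tr.simps(1))
qed auto

lemma snd_arg_vars [simp]: "map snd (arg_vars \<sigma> \<eta>) = map (ty_tr \<sigma>) (arg_types \<eta>)"
  by (rule nth_equalityI) (simp_all add: arg_vars_def)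

lemma arg_vars_nth [simp]: "length (arg_vars \<sigma> \<eta>) = length (arg_types \<eta>)"
  "i < length (arg_types \<eta>) \<Longrightarrow> snd (arg_vars \<sigma> \<eta> ! i) = ty_tr \<sigma> (arg_types \<eta> ! i)"
  by (simp_all add: arg_vars_def)

lemma distinct_arg_vars [simp]: "distinct (arg_vars \<sigma> \<eta>)"
  by (auto simp: arg_vars_def distinct_map inj_on_def replicate_eq_replicate)

lemma notin_arg_vars [simp]: "c \<noteq> CHR ''v'' \<Longrightarrow> (c # cs, \<tau>) \<notin> set (arg_vars \<sigma> \<eta>)"
  by (auto simp: arg_vars_def)

text \<open>The family r[n] before it is applied to the tuple v, with \<open>a\<close> and
  \<open>F\<close> as parameters of a closed term.\<close>

definition iter_tm :: "ty \<Rightarrow> ty \<Rightarrow> tm" where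
  "iter_tm \<sigma> \<eta> = (let a = (''a'', ty_tr \<sigma> \<eta>); F = (''F'', ty_tr \<sigma> N \<rightarrow> ty_tr \<sigma> \<eta> \<rightarrow> ty_tr \<sigma> \<eta>); k = (''k'', N) in
     lam a (lam F (Cn (Rec (ty_tr \<sigma> \<eta>)) \<cdot> Free a \<cdot> lam k (Free F \<cdot> num_tr \<sigma> (Free k)))))"

lemma iter_tm_closed [simp]:
  "tyof [] (iter_tm \<sigma> \<eta>) =
    Some (ty_tr \<sigma> \<eta> \<rightarrow> (ty_tr \<sigma> N \<rightarrow> ty_tr \<sigma> \<eta> \<rightarrow> ty_tr \<sigma> \<eta>) \<rightarrow> N \<rightarrow> ty_tr \<sigma> \<eta>)"
  "fv (iter_tm \<sigma> \<eta>) = {}"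
  by (auto simp: iter_tm_def Let_def)

lemma sem_num_tr:
  assumes "finite W" "okv W \<rho>"
  shows "sem W \<rho> (num_tr \<sigma> (Free (''k'', N))) = cls W (num_fun \<sigma>) \<bullet>[W] \<rho> (''k'', N)"
proof -
  have "sem W \<rho> (num_tr \<sigma> (Free (''k'', N))) =
      sem W ((env W Free)((''k'', N) := \<rho> (''k'', N))) (num_tr \<sigma> (Free (''k'', N)))"
    by (rule sem_cong) simp
  then show ?thesis using assms by (simp add: num_fun_def)
qed

lemma iter_tm_simps [simp]:
  assumes "finite W" "tyc W a = Some (ty_tr \<sigma> \<eta>)" "tyc W F = Some (ty_tr \<sigma> N \<rightarrow> ty_tr \<sigma> \<eta> \<rightarrow> ty_tr \<sigma> \<eta>)"
  shows "cls W (iter_tm \<sigma> \<eta>) \<bullet>[W] a \<bullet>[W] F \<bullet>[W] cls W (Cn Zero) = a"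
    "tyc W n = Some N \<Longrightarrow> cls W (iter_tm \<sigma> \<eta>) \<bullet>[W] a \<bullet>[W] F \<bullet>[W] (cls W (Cn Succ) \<bullet>[W] n) =
      F \<bullet>[W] (cls W (num_fun \<sigma>) \<bullet>[W] n) \<bullet>[W] (cls W (iter_tm \<sigma> \<eta>) \<bullet>[W] a \<bullet>[W] F \<bullet>[W] n)"
  using assms by (simp_all add: iter_tm_def Let_def sem_num_tr)

definition val_fun :: "ty \<Rightarrow> tm" where
  "val_fun \<sigma> = (let q = (''q'', N \<rightarrow> ty_tr \<sigma> N); n = (''n'', N) in lam q (lam n (Val \<sigma> (Free q \<cdot> Free n))))"

definition rec_fun :: "ty \<Rightarrow> tm" where
  "rec_fun \<sigma> = (let q = (''q'', N \<rightarrow> ty_tr \<sigma> N); n = (''n'', N) in lam q (lam n (BB \<sigma> (Free q \<cdot> Free n))))"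

definition bar_fun :: "ty \<Rightarrow> tm" where
  "bar_fun \<sigma> = (let q = (''q'', N \<rightarrow> ty_tr \<sigma> N); n = (''n'', N) in lam q (lam n (chi \<sigma> \<cdot> (Free q \<cdot> Free n))))"

lemma fun_closed [simp]:
  "(val_fun \<sigma>) :| ((N \<rightarrow> ty_tr \<sigma> N) \<rightarrow> N \<rightarrow> ValT)" "fv (val_fun \<sigma>) = {}"
  "(rec_fun \<sigma>) :| ((N \<rightarrow> ty_tr \<sigma> N) \<rightarrow> N \<rightarrow> BT \<sigma>)" "fv (rec_fun \<sigma>) = {}"
  "(bar_fun \<sigma>) :| ((N \<rightarrow> ty_tr \<sigma> N) \<rightarrow> N \<rightarrow> Seq N \<rightarrow> N)" "fv (bar_fun \<sigma>) = {}"
  by (auto simp: val_fun_def rec_fun_def bar_fun_def Let_def)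

lemma fun_simps [simp]:
  assumes "finite W" "tyc W q = Some (N \<rightarrow> ty_tr \<sigma> N)" "tyc W n = Some N"
  shows "cls W (val_fun \<sigma>) \<bullet>[W] q \<bullet>[W] n = cls W (Cn (Fst ValT (BT \<sigma>))) \<bullet>[W] (q \<bullet>[W] n)"
    "cls W (rec_fun \<sigma>) \<bullet>[W] q \<bullet>[W] n = cls W (Cn (Snd ValT (BT \<sigma>))) \<bullet>[W] (q \<bullet>[W] n)"
    "cls W (bar_fun \<sigma>) \<bullet>[W] q \<bullet>[W] n = cls W (chi \<sigma>) \<bullet>[W] (q \<bullet>[W] n)"
  using assms by (simp_all add: val_fun_def rec_fun_def bar_fun_def Let_def)

text \<open>The pair that composition produces from a translated number \<open>x\<close> and a
  family \<open>q\<close> of translated numbers.\<close>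

definition comp_pair :: "ty \<Rightarrow> tm \<Rightarrow> tm \<Rightarrow> tm" where
  "comp_pair \<sigma> x q = pair \<sigma> (comp_val \<cdot> Val \<sigma> x \<cdot> (val_fun \<sigma> \<cdot> q)) (comp_rec \<sigma> \<cdot> Val \<sigma> x \<cdot> BB \<sigma> x \<cdot> (rec_fun \<sigma> \<cdot> q))"

text \<open>An \<alpha>-dependent function on numbers becomes a family, indexed by numbers, of
  \<alpha>-dependent objects. The next two combinators fix the first further argument of such a
  function: \<open>flip_tm\<close> on the translated side, \<open>part_tm\<close> pointwise in
  \<alpha>.\<close>

definition swap_tm :: "ty \<Rightarrow> tm" where
  "swap_tm \<eta> = (let p = (''p'', (N \<rightarrow> N) \<rightarrow> N \<rightarrow> \<eta>); n = (''n'', N); a = (''a'', N \<rightarrow> N) in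
     lam p (lam n (lam a (Free p \<cdot> Free a \<cdot> Free n))))"

definition flip_tm :: "ty \<Rightarrow> ty \<Rightarrow> tm" where
  "flip_tm \<rho> \<eta> = (let q = (''q'', N \<rightarrow> \<rho> \<rightarrow> \<eta>); z = (''z'', \<rho>); n = (''n'', N) in
     lam q (lam z (lam n (Free q \<cdot> Free n \<cdot> Free z))))"

definition part_tm :: "ty \<Rightarrow> ty \<Rightarrow> tm" where
  "part_tm \<rho> \<eta> = (let p = (''p'', (N \<rightarrow> N) \<rightarrow> N \<rightarrow> \<rho> \<rightarrow> \<eta>); y = (''y'', (N \<rightarrow> N) \<rightarrow> \<rho>); a = (''a'', N \<rightarrow> N); n = (''n'', N) in
     lam p (lam y (lam a (lam n (Free p \<cdot> Free a \<cdot> Free n \<cdot> (Free y \<cdot> Free a))))))"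

lemma swap_tm_closed [simp]:
  "(swap_tm \<eta>) :| (((N \<rightarrow> N) \<rightarrow> N \<rightarrow> \<eta>) \<rightarrow> N \<rightarrow> (N \<rightarrow> N) \<rightarrow> \<eta>)" "fv (swap_tm \<eta>) = {}"
  "(flip_tm \<rho> \<eta>) :| ((N \<rightarrow> \<rho> \<rightarrow> \<eta>) \<rightarrow> \<rho> \<rightarrow> N \<rightarrow> \<eta>)" "fv (flip_tm \<rho> \<eta>) = {}"
  "(part_tm \<rho> \<eta>) :| (((N \<rightarrow> N) \<rightarrow> N \<rightarrow> \<rho> \<rightarrow> \<eta>) \<rightarrow> ((N \<rightarrow> N) \<rightarrow> \<rho>) \<rightarrow> (N \<rightarrow> N) \<rightarrow> N \<rightarrow> \<eta>)"
  by (auto simp: swap_tm_def flip_tm_def part_tm_def Let_def)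

lemma swap_tm_simps [simp]:
  assumes "finite W" "tyc W n = Some N"
  shows "tyc W p = Some ((N \<rightarrow> N) \<rightarrow> N \<rightarrow> \<eta>) \<Longrightarrow> tyc W a = Some (N \<rightarrow> N) \<Longrightarrow>
      cls W (swap_tm \<eta>) \<bullet>[W] p \<bullet>[W] n \<bullet>[W] a = p \<bullet>[W] a \<bullet>[W] n"
    "tyc W q = Some (N \<rightarrow> \<rho> \<rightarrow> \<eta>) \<Longrightarrow> tyc W z = Some \<rho> \<Longrightarrow>
      cls W (flip_tm \<rho> \<eta>) \<bullet>[W] q \<bullet>[W] z \<bullet>[W] n = q \<bullet>[W] n \<bullet>[W] z"
    "tyc W r = Some ((N \<rightarrow> N) \<rightarrow> N \<rightarrow> \<rho> \<rightarrow> \<eta>) \<Longrightarrow> tyc W y = Some ((N \<rightarrow> N) \<rightarrow> \<rho>) \<Longrightarrow> tyc W a = Some (N \<rightarrow> N) \<Longrightarrow>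
      cls W (part_tm \<rho> \<eta>) \<bullet>[W] r \<bullet>[W] y \<bullet>[W] a \<bullet>[W] n = r \<bullet>[W] a \<bullet>[W] n \<bullet>[W] (y \<bullet>[W] a)"
  using assms by (simp_all add: swap_tm_def flip_tm_def part_tm_def Let_def)

lemma rel_comp_pair:
  assumes "finite W" "p :| ((N \<rightarrow> N) \<rightarrow> N \<rightarrow> N)" "q :| (N \<rightarrow> ty_tr \<sigma> N)"
    "f :| ValT" "x :| (ty_tr \<sigma> N)" "rel \<sigma> W N f x"
    and pn: "\<And>n. n :| N \<Longrightarrow> rel \<sigma> W N (swap_tm N \<cdot> p \<cdot> n) (q \<cdot> n)"
  shows "rel \<sigma> W N (comp_app N N \<cdot> p \<cdot> f) (comp_pair \<sigma> x q)"
proof -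
  from assms have f: "cls W f = cls W (Val \<sigma> x)" and g: "good \<sigma> W (chi \<sigma> \<cdot> x) (Val \<sigma> x) (BB \<sigma> x)"
    by (auto simp: rel_N)
  have q: "cls W (p \<cdot> a \<cdot> n) = cls W (Val \<sigma> (q \<cdot> n) \<cdot> a)" if "n :| N" "a :| (N \<rightarrow> N)" for n a
  proof -
    have "cls W (swap_tm N \<cdot> p \<cdot> n) = cls W (Val \<sigma> (q \<cdot> n))" using pn[OF that(1)] that assms(1-3) by (simp add: rel_N)
    from arg_cong[OF this, of "\<lambda>c. app W c (cls W a)"] show ?thesis using that assms(1-3) by simp
  qed
  have gq: "good \<sigma> W (bar_fun \<sigma> \<cdot> q \<cdot> n) (val_fun \<sigma> \<cdot> q \<cdot> n) (rec_fun \<sigma> \<cdot> q \<cdot> n)" if "n :| N" for n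
  proof (rule good_cong)
    show "good \<sigma> W (chi \<sigma> \<cdot> (q \<cdot> n)) (Val \<sigma> (q \<cdot> n)) (BB \<sigma> (q \<cdot> n))"
      using pn[OF that] that assms(1-3) by (simp add: rel_N)
  qed (use that assms(1-3) in simp_all)
  show ?thesis
  proof (rule rel_NI)
    show "good \<sigma> W (comp_bar \<cdot> (chi \<sigma> \<cdot> x) \<cdot> Val \<sigma> x \<cdot> (bar_fun \<sigma> \<cdot> q)) (comp_val \<cdot> Val \<sigma> x \<cdot> (val_fun \<sigma> \<cdot> q))
        (comp_rec \<sigma> \<cdot> Val \<sigma> x \<cdot> BB \<sigma> x \<cdot> (rec_fun \<sigma> \<cdot> q))"
      by (rule good_comp[OF g gq]) (use assms in simp_all)
    show "cls W (comp_app N N \<cdot> p \<cdot> f \<cdot> a) = cls W (comp_val \<cdot> Val \<sigma> x \<cdot> (val_fun \<sigma> \<cdot> q) \<cdot> a)"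
      if "a :| (N \<rightarrow> N)" for a
      using q[of "f \<cdot> a" a] that assms(1-5) f by simp
  qed (use assms(1-5) in \<open>simp_all add: comp_pair_def\<close>)
qed

lemma Rec_tr_closed [simp]:
  assumes "simple \<eta>"
  shows "(Rec_tr \<sigma> \<eta>) :| (ty_tr \<sigma> (cty (Rec \<eta>)))" "fv (Rec_tr \<sigma> \<eta>) = {}"
proof -
  have r: "tyof [] (apps (Cn (Rec (ty_tr \<sigma> \<eta>)) \<cdot> Free (''a'', ty_tr \<sigma> \<eta>) \<cdot>
      lam (''k'', N) (Free (''F'', ty_tr \<sigma> N \<rightarrow> ty_tr \<sigma> \<eta> \<rightarrow> ty_tr \<sigma> \<eta>) \<cdot> num_tr \<sigma> (Free (''k'', N))) \<cdot> n)
      (map Free (arg_vars \<sigma> \<eta>))) = Some (ty_tr \<sigma> N)" if "n :| N" for n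
    by (rule tyof_apps[of _ "map (ty_tr \<sigma>) (arg_types \<eta>)"])
      (use that ty_tr_foldr[OF assms] in \<open>simp_all add: list_all2_conv_all_nth flip: snd_arg_vars\<close>)
  show "(Rec_tr \<sigma> \<eta>) :| (ty_tr \<sigma> (cty (Rec \<eta>)))"
    using r ty_tr_foldr[OF assms] by (simp add: Rec_tr_def Let_def del: ty_tr.simps) simp
  show "fv (Rec_tr \<sigma> \<eta>) = {}"
    by (auto simp: Rec_tr_def Let_def alpha_def)
qed

text \<open>Applied to a full tuple of arguments, the translated recursor is a composition along the
  family r[n]. The family enters as a term \<open>q\<close> that is known only by its values, so
  that it can be formed one argument at a time elsewhere.\<close>

lemma Rec_tr_apps:
  assumes fin: "finite W" and simple: "simple \<eta>" and ty: "a :| (ty_tr \<sigma> \<eta>)"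
      "F :| (ty_tr \<sigma> N \<rightarrow> ty_tr \<sigma> \<eta> \<rightarrow> ty_tr \<sigma> \<eta>)" "x :| (ty_tr \<sigma> N)"
      "typed_list vs (map (ty_tr \<sigma>) (arg_types \<eta>))" "q :| (N \<rightarrow> ty_tr \<sigma> N)"
    and q: "\<And>n. n :| N \<Longrightarrow> cls W (q \<cdot> n) = cls W (apps (iter_tm \<sigma> \<eta> \<cdot> a \<cdot> F \<cdot> n) vs)"
  shows "cls W (apps (Rec_tr \<sigma> \<eta> \<cdot> a \<cdot> F \<cdot> x) vs) = cls W (comp_pair \<sigma> x q)"
proof -
  let ?a = "(''a'', ty_tr \<sigma> \<eta>)" and ?F = "(''F'', ty_tr \<sigma> N \<rightarrow> ty_tr \<sigma> \<eta> \<rightarrow> ty_tr \<sigma> \<eta>)"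
    and ?x = "(''x'', ty_tr \<sigma> N)" and ?k = "(''k'', N)" and ?G = "(''G'', GT \<sigma>)" and ?H = "(''H'', HT \<sigma>)"
    and ?s = "(''s'', Seq N)" and ?t = "(''t'', Seq N)" and ?v = "arg_vars \<sigma> \<eta>"
  let ?L = "lam ?k (Free ?F \<cdot> num_tr \<sigma> (Free ?k))"
  define r where "r n = apps (Cn (Rec (ty_tr \<sigma> \<eta>)) \<cdot> Free ?a \<cdot> ?L \<cdot> n) (map Free ?v)" for n
  let ?V = "lam alpha (Val \<sigma> (r (Val \<sigma> (Free ?x) \<cdot> Free alpha)) \<cdot> Free alpha)"
  let ?S = "lam ?t (BB \<sigma> (r (Val \<sigma> (Free ?x) \<cdot> (hat \<cdot> Free ?t))) \<cdot> Free ?G \<cdot> Free ?H \<cdot> Free ?t)"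
  let ?B = "lam ?G (lam ?H (lam ?s (BB \<sigma> (Free ?x) \<cdot> ?S \<cdot> Free ?H \<cdot> Free ?s)))"
  let ?\<rho>3 = "(env W Free)(?a := cls W a, ?F := cls W F, ?x := cls W x)"
  define \<rho> where "\<rho> = upds ?\<rho>3 ?v (map (cls W) vs)"
  have Rec_tr: "Rec_tr \<sigma> \<eta> = lam ?a (lam ?F (lam ?x (lams ?v (pair \<sigma> ?V ?B))))"
    by (simp add: Rec_tr_def Let_def r_def)
  have ty_r: "(r n) :| (ty_tr \<sigma> N)" if "n :| N" for n
    unfolding r_def by (rule tyof_apps[of _ "map (ty_tr \<sigma>) (arg_types \<eta>)"])
      (use that ty_tr_foldr[OF simple] in \<open>simp_all add: list_all2_conv_all_nth flip: snd_arg_vars\<close>)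
  have body: "(pair \<sigma> ?V ?B) :| (ty_tr \<sigma> N)" by (simp add: ty_r)
  have len: "length ?v = length vs" using list_all2_lengthD[OF ty(4)] by (simp add: arg_vars_def)
  have args: "list_all2 (\<lambda>x a. tyc W a = Some (snd x)) ?v (map (cls W) vs)"
    using ty(4) by (auto simp: list_all2_conv_all_nth)
  have \<rho>3: "okv W ?\<rho>3" using ty by simp
  have ok: "okv W \<rho>"
    using sem_lams[OF \<rho>3 args, of "pair \<sigma> ?V ?B"] body by (simp add: \<rho>_def)
  have \<rho>: "\<rho> ?a = cls W a" "\<rho> ?F = cls W F" "\<rho> ?x = cls W x" "map \<rho> ?v = map (cls W) vs"
    using len by (simp_all add: \<rho>_def upds_notin map_upds)
  have "cls W (apps (Rec_tr \<sigma> \<eta> \<cdot> a \<cdot> F \<cdot> x) vs) =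
      foldl (app W) (sem W ?\<rho>3 (lams ?v (pair \<sigma> ?V ?B))) (map (cls W) vs)"
    unfolding cls_apps Rec_tr using ty fin body by (simp del: pair_def)
  also have "\<dots> = sem W \<rho> (pair \<sigma> ?V ?B)"
    using sem_lams[OF \<rho>3 args, of "pair \<sigma> ?V ?B"] body by (simp add: \<rho>_def)
  finally have lhs: "cls W (apps (Rec_tr \<sigma> \<eta> \<cdot> a \<cdot> F \<cdot> x) vs) = sem W \<rho> (pair \<sigma> ?V ?B)" .
  \<comment> \<open>The term r occurs under further binders, so its value is needed in every
    assignment that agrees on \<open>a\<close>, \<open>F\<close> and the tuple.\<close>
  have sem_r: "sem W \<rho>' (r n) = cls W q \<bullet>[W] sem W \<rho>' n"
    if \<rho>': "okv W \<rho>'" "\<rho>' ?a = cls W a" "\<rho>' ?F = cls W F" "map \<rho>' ?v = map (cls W) vs" and n: "n :| N" for \<rho>' n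
  proof -
    have "sem W \<rho>' ?L = sem W ((env W Free)(?a := cls W a, ?F := cls W F)) ?L"
      by (rule sem_cong) (use \<rho>' in auto)
    then have 1: "cls W (Cn (Rec (ty_tr \<sigma> \<eta>))) \<bullet>[W] cls W a \<bullet>[W] sem W \<rho>' ?L = cls W (iter_tm \<sigma> \<eta> \<cdot> a \<cdot> F)"
      using fin ty by (simp add: iter_tm_def Let_def)
    have 2: "map (sem W \<rho>') (map Free ?v) = map (cls W) vs"
      using \<rho>' by (simp add: comp_def)
    have "tyc W (sem W \<rho>' n) = Some N" using \<rho>' n by simp
    then obtain m where m: "sem W \<rho>' n = cls W m" "m :| N" by (rule tyc_repE)
    have "sem W \<rho>' (r n) = foldl (app W) (cls W (iter_tm \<sigma> \<eta> \<cdot> a \<cdot> F \<cdot> m)) (map (cls W) vs)"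
      unfolding r_def sem_apps 2 using \<rho>' 1 m by simp
    also have "\<dots> = cls W (q \<cdot> m)" using q[OF m(2)] by (simp only: cls_apps)
    finally show ?thesis using m by simp
  qed
  have upd: "map (\<rho>'(y := c)) ?v = map \<rho>' ?v" if "y \<notin> set ?v" for \<rho>' :: "var \<Rightarrow> tm set" and y c
    using that by auto
  have alpha: "alpha \<notin> set ?v" "alpha \<noteq> ?a" "alpha \<noteq> ?F" "alpha \<noteq> ?x" by (simp_all add: alpha_def)
  have V: "sem W \<rho> ?V = cls W (comp_val \<cdot> Val \<sigma> x \<cdot> (val_fun \<sigma> \<cdot> q))"
    by (rule app_ext[OF fin, where \<pi> = "N \<rightarrow> N" and \<rho> = N])
      (use fin ty ok \<rho> alpha in \<open>simp_all add: ty_r sem_r upd del: map_fun_upd\<close>)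
  have B: "sem W \<rho> ?B = cls W (comp_rec \<sigma> \<cdot> Val \<sigma> x \<cdot> BB \<sigma> x \<cdot> (rec_fun \<sigma> \<cdot> q))"
  proof (rule app_ext[OF fin, where \<pi> = "GT \<sigma>" and \<rho> = "HT \<sigma> \<rightarrow> Seq N \<rightarrow> \<sigma>"])
    fix G assume G: "tyc W G = Some (GT \<sigma>)"
    show "sem W \<rho> ?B \<bullet>[W] G = cls W (comp_rec \<sigma> \<cdot> Val \<sigma> x \<cdot> BB \<sigma> x \<cdot> (rec_fun \<sigma> \<cdot> q)) \<bullet>[W] G"
    proof (rule app_ext[OF fin, where \<pi> = "HT \<sigma>" and \<rho> = "Seq N \<rightarrow> \<sigma>"])
      fix H assume H: "tyc W H = Some (HT \<sigma>)"
      show "sem W \<rho> ?B \<bullet>[W] G \<bullet>[W] H =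
        cls W (comp_rec \<sigma> \<cdot> Val \<sigma> x \<cdot> BB \<sigma> x \<cdot> (rec_fun \<sigma> \<cdot> q)) \<bullet>[W] G \<bullet>[W] H"
      proof (rule app_ext[OF fin, where \<pi> = "Seq N" and \<rho> = \<sigma>])
        fix s assume s: "tyc W s = Some (Seq N)"
        have S: "sem W (\<rho>(?G := G, ?H := H, ?s := s)) ?S =
            cls W (comp_stop \<sigma> \<cdot> Val \<sigma> x \<cdot> (rec_fun \<sigma> \<cdot> q)) \<bullet>[W] G \<bullet>[W] H"
          by (rule app_ext[OF fin, where \<pi> = "Seq N" and \<rho> = \<sigma>])
            (use fin ty ok \<rho> G H s in \<open>simp_all add: ty_r sem_r upd del: map_fun_upd\<close>)
        show "sem W \<rho> ?B \<bullet>[W] G \<bullet>[W] H \<bullet>[W] s =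
          cls W (comp_rec \<sigma> \<cdot> Val \<sigma> x \<cdot> BB \<sigma> x \<cdot> (rec_fun \<sigma> \<cdot> q)) \<bullet>[W] G \<bullet>[W] H \<bullet>[W] s"
          using fin ty ok \<rho> G H s S by (simp add: ty_r)
      qed (use fin ty ok \<rho> G H in \<open>simp_all add: ty_r\<close>)
    qed (use fin ty ok \<rho> G in \<open>simp_all add: ty_r\<close>)
  qed (use fin ty ok \<rho> in \<open>simp_all add: ty_r\<close>)
  show ?thesis unfolding lhs using V B by (simp add: comp_pair_def)
qed

text \<open>The relation handles one argument at a time, whereas \<open>u\<close> is known only on
  full tuples. Induction on the type moves arguments from the relation into the family
  \<open>q\<close>; at \<open>N\<close> the tuple is empty and \<open>rel_comp_pair\<close>
  applies.\<close>

lemma rel_iter: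
  "simple \<eta> \<Longrightarrow> finite W \<Longrightarrow> p :| ((N \<rightarrow> N) \<rightarrow> N \<rightarrow> \<eta>) \<Longrightarrow> q :| (N \<rightarrow> ty_tr \<sigma> \<eta>) \<Longrightarrow>
    u :| (ty_tr \<sigma> \<eta>) \<Longrightarrow> f :| ValT \<Longrightarrow> x :| (ty_tr \<sigma> N) \<Longrightarrow> rel \<sigma> W N f x \<Longrightarrow>
    (\<And>n. n :| N \<Longrightarrow> rel \<sigma> W \<eta> (swap_tm \<eta> \<cdot> p \<cdot> n) (q \<cdot> n)) \<Longrightarrow>
    (\<And>W' vs q'. finite W' \<Longrightarrow> W \<subseteq> W' \<Longrightarrow> typed_list vs (map (ty_tr \<sigma>) (arg_types \<eta>)) \<Longrightarrow>
      q' :| (N \<rightarrow> ty_tr \<sigma> N) \<Longrightarrow>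
      (\<And>n. n :| N \<Longrightarrow> cls W' (q' \<cdot> n) = cls W' (apps (q \<cdot> n) vs)) \<Longrightarrow>
      cls W' (apps u vs) = cls W' (comp_pair \<sigma> x q')) \<Longrightarrow>
    rel \<sigma> W \<eta> (comp_app N \<eta> \<cdot> p \<cdot> f) u"
proof (induction \<eta> arbitrary: W p q u)
  case N
  have "cls W (apps u []) = cls W (comp_pair \<sigma> x q)" by (rule N.prems(10)) (use N.prems in simp_all)
  moreover have "rel \<sigma> W N (comp_app N N \<cdot> p \<cdot> f) (comp_pair \<sigma> x q)"
    by (rule rel_comp_pair) (use N.prems in simp_all)
  ultimately show ?case using N.prems(1-7) by (elim rel_cong) (simp_all add: comp_pair_def)
next
  case (Fn \<rho> \<eta>)
  have simple: "simple \<rho>" "simple \<eta>" using Fn.prems(1) by simp_all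
  note fin = Fn.prems(2) and ty = Fn.prems(3-7)
  have "rel \<sigma> D \<eta> (comp_app \<rho> \<eta> \<cdot> (comp_app N (\<rho> \<rightarrow> \<eta>) \<cdot> p \<cdot> f) \<cdot> y) (u \<cdot> z)"
    if y: "y :| ((N \<rightarrow> N) \<rightarrow> \<rho>)" "z :| (ty_tr \<sigma> \<rho>)" and D: "finite D" "W \<subseteq> D" and yz: "rel \<sigma> D \<rho> y z"
    for y z D
  proof -
    \<comment> \<open>The first argument is absorbed into the families on both sides, which lowers
      their type to \<eta>.\<close>
    let ?p = "part_tm \<rho> \<eta> \<cdot> p \<cdot> y" and ?q = "flip_tm (ty_tr \<sigma> \<rho>) (ty_tr \<sigma> \<eta>) \<cdot> q \<cdot> z"
    have "rel \<sigma> D \<eta> (comp_app N \<eta> \<cdot> ?p \<cdot> f) (u \<cdot> z)"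
    proof (rule Fn.IH(2)[OF simple(2) D(1)])
      show "rel \<sigma> D N f x" by (rule rel_mono[OF Fn.prems(8) D(2,1)])
    next
      fix n assume n: "n :| N"
      have "rel \<sigma> W (\<rho> \<rightarrow> \<eta>) (swap_tm (\<rho> \<rightarrow> \<eta>) \<cdot> p \<cdot> n) (q \<cdot> n)" by (rule Fn.prems(9)[OF n])
      then have "rel \<sigma> D \<eta> (comp_app \<rho> \<eta> \<cdot> (swap_tm (\<rho> \<rightarrow> \<eta>) \<cdot> p \<cdot> n) \<cdot> y) (q \<cdot> n \<cdot> z)"
        using n y D yz fin ty by (subst (asm) rel_Fn) auto
      moreover have "cls D (comp_app \<rho> \<eta> \<cdot> (swap_tm (\<rho> \<rightarrow> \<eta>) \<cdot> p \<cdot> n) \<cdot> y) = cls D (swap_tm \<eta> \<cdot> ?p \<cdot> n)"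
        by (rule cls_ext[where \<pi> = "N \<rightarrow> N" and \<rho> = \<eta>]) (use n y D ty in simp_all)
      ultimately show "rel \<sigma> D \<eta> (swap_tm \<eta> \<cdot> ?p \<cdot> n) (?q \<cdot> n)"
        using n y D ty by (elim rel_cong) simp_all
    next
      fix D' vs q'
      assume D': "finite D'" "D \<subseteq> D'" and vs: "typed_list vs (map (ty_tr \<sigma>) (arg_types \<eta>))"
        and q': "q' :| (N \<rightarrow> ty_tr \<sigma> N)"
          "\<And>n. n :| N \<Longrightarrow> cls D' (q' \<cdot> n) = cls D' (apps (?q \<cdot> n) vs)"
      \<comment> \<open>A tuple for \<open>u z\<close> is a tuple for \<open>u\<close> that starts
        with \<open>z\<close>.\<close>
      have "cls D' (apps u (z # vs)) = cls D' (comp_pair \<sigma> x q')"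
      proof (rule Fn.prems(10)[OF D'(1) _ _ q'(1)])
        fix n assume n: "n :| N"
        show "cls D' (q' \<cdot> n) = cls D' (apps (q \<cdot> n) (z # vs))"
          unfolding q'(2)[OF n] cls_apps using n y D' ty by simp
      qed (use D D' vs y in auto)
      then show "cls D' (apps (u \<cdot> z) vs) = cls D' (comp_pair \<sigma> x q')" by simp
    qed (use y ty in simp_all)
    moreover have "cls D (comp_app N \<eta> \<cdot> ?p \<cdot> f) = cls D (comp_app \<rho> \<eta> \<cdot> (comp_app N (\<rho> \<rightarrow> \<eta>) \<cdot> p \<cdot> f) \<cdot> y)"
      by (rule cls_ext[where \<pi> = "N \<rightarrow> N" and \<rho> = \<eta>]) (use y D ty in simp_all)
    ultimately show ?thesis using y ty by (elim rel_cong) simp_all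
  qed
  then show ?case using fin ty by (subst rel_Fn) auto
qed simp_all


text \<open>The iterates at a fixed number are related by induction on that number. It takes place
  inside the system, with the relation at \<eta> as induction formula and the two families as
  parameters.\<close>

lemma rel_iter_tm:
  assumes fin: "finite W" and A: "A :| ((N \<rightarrow> N) \<rightarrow> \<eta>)" "A' :| (ty_tr \<sigma> \<eta>)" "rel \<sigma> W \<eta> A A'"
    and F: "F :| ((N \<rightarrow> N) \<rightarrow> N \<rightarrow> \<eta> \<rightarrow> \<eta>)" "F' :| (ty_tr \<sigma> N \<rightarrow> ty_tr \<sigma> \<eta> \<rightarrow> ty_tr \<sigma> \<eta>)"
      "rel \<sigma> W (N \<rightarrow> \<eta> \<rightarrow> \<eta>) F F'"
    and p: "p :| ((N \<rightarrow> N) \<rightarrow> N \<rightarrow> \<eta>)"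
      "\<And>W' a. finite W' \<Longrightarrow> W \<subseteq> W' \<Longrightarrow> a :| (N \<rightarrow> N) \<Longrightarrow>
        cls W' (p \<cdot> a) = cls W' (Cn (Rec \<eta>) \<cdot> (A \<cdot> a) \<cdot> (F \<cdot> a))"
    and n: "n :| N"
  shows "rel \<sigma> W \<eta> (swap_tm \<eta> \<cdot> p \<cdot> n) (iter_tm \<sigma> \<eta> \<cdot> A' \<cdot> F' \<cdot> n)"
proof -
  let ?q = "iter_tm \<sigma> \<eta> \<cdot> A' \<cdot> F'"
  let ?P = "(''p'', (N \<rightarrow> N) \<rightarrow> N \<rightarrow> \<eta>)" and ?Q = "(''q'', N \<rightarrow> ty_tr \<sigma> \<eta>)" and ?n = "(''n'', N)"
  let ?\<phi> = "fsubst (rel_f \<eta>) (swap_tm \<eta> \<cdot> Free ?P \<cdot> Free ?n) (fsubst (rel_u \<sigma> \<eta>) (Free ?Q \<cdot> Free ?n) (rel_fm \<sigma> \<eta>))"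
  let ?\<theta> = "Free(?P := p, ?Q := ?q)"
  have ne: "?P \<noteq> rel_f \<eta>" "?Q \<noteq> rel_f \<eta>" "?n \<noteq> rel_f \<eta>" "rel_f \<eta> \<noteq> ?P" "rel_f \<eta> \<noteq> ?Q" "rel_f \<eta> \<noteq> ?n"
    by (simp_all add: rel_f_def)
  have ok: "okt ?\<theta>" using A F p by simp
  have sat: "sat D (?\<theta>(?n := m)) ?\<phi> \<longleftrightarrow> rel \<sigma> D \<eta> (swap_tm \<eta> \<cdot> p \<cdot> m) (?q \<cdot> m)"
    if "finite D" "m :| N" for D m
    using that ok A F p ne by (simp add: sat_rel_fm sub_closed)
  have "sat W (?\<theta>(?n := n)) ?\<phi>"
  proof (rule sat_nat_induct[OF fin ok])
    have "cls W A = cls W (swap_tm \<eta> \<cdot> p \<cdot> Cn Zero)"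
      by (rule cls_ext[where \<pi> = "N \<rightarrow> N" and \<rho> = \<eta>])
        (use fin A(1) F(1) p in \<open>simp_all add: p(2)[simplified]\<close>)
    then have "rel \<sigma> W \<eta> (swap_tm \<eta> \<cdot> p \<cdot> Cn Zero) (?q \<cdot> Cn Zero)"
      by (rule rel_cong[OF A(3,1,2)]) (use fin A(2) F(2) in simp_all)
    then show "sat W (?\<theta>(?n := Cn Zero)) ?\<phi>" using fin by (subst sat) simp_all
  next
    fix D m assume D: "finite D" "W \<subseteq> D" and m: "m :| N" and "sat D (?\<theta>(?n := m)) ?\<phi>"
    then have IH: "rel \<sigma> D \<eta> (swap_tm \<eta> \<cdot> p \<cdot> m) (?q \<cdot> m)" by (subst (asm) sat) simp_all
    \<comment> \<open>On the left the recursor passes the plain number \<open>m\<close> to the step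
      function; as an \<alpha>-dependent object this is the constant function, which is related to
      the translated number.\<close>
    let ?F = "comp_app N (\<eta> \<rightarrow> \<eta>) \<cdot> F \<cdot> (const_tm \<cdot> m)"
    have "rel \<sigma> D (\<eta> \<rightarrow> \<eta>) ?F (F' \<cdot> (num_fun \<sigma> \<cdot> m))"
      using F(3) rel_num[OF D(1) m, of \<sigma>] fin F(1,2) D m by (subst (asm) rel_Fn) auto
    then have "rel \<sigma> D \<eta> (comp_app \<eta> \<eta> \<cdot> ?F \<cdot> (swap_tm \<eta> \<cdot> p \<cdot> m)) (F' \<cdot> (num_fun \<sigma> \<cdot> m) \<cdot> (?q \<cdot> m))"
      using IH F(1,2) A(2) D m p(1) by (subst (asm) rel_Fn) auto
    moreover have "cls D (comp_app \<eta> \<eta> \<cdot> ?F \<cdot> (swap_tm \<eta> \<cdot> p \<cdot> m)) = cls D (swap_tm \<eta> \<cdot> p \<cdot> (Cn Succ \<cdot> m))"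
      by (rule cls_ext[where \<pi> = "N \<rightarrow> N" and \<rho> = \<eta>])
        (use D m A(1) F(1) p(1) in \<open>simp_all add: p(2)[simplified]\<close>)
    ultimately have "rel \<sigma> D \<eta> (swap_tm \<eta> \<cdot> p \<cdot> (Cn Succ \<cdot> m)) (?q \<cdot> (Cn Succ \<cdot> m))"
      using D m A(2) F(1,2) p(1) by (elim rel_cong) simp_all
    then show "sat D (?\<theta>(?n := Cn Succ \<cdot> m)) ?\<phi>" using D m by (subst sat) simp_all
  qed (use n in simp_all)
  then show ?thesis using fin n by (subst (asm) sat) simp_all
qed

text \<open>The three arguments are introduced one after the other, each in a further world. Then
  \<open>rel_iter_tm\<close> relates the iterates at all numbers, and \<open>rel_iter\<close> passes
  from numbers to a translated number by composition.\<close>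

lemma rel_Rec:
  assumes simple: "simple \<eta>" and fin: "finite W" and f: "f :| ((N \<rightarrow> N) \<rightarrow> cty (Rec \<eta>))"
    "\<And>W' a. finite W' \<Longrightarrow> W \<subseteq> W' \<Longrightarrow> a :| (N \<rightarrow> N) \<Longrightarrow> cls W' (f \<cdot> a) = cls W' (Cn (Rec \<eta>))"
  shows "rel \<sigma> W (cty (Rec \<eta>)) f (Rec_tr \<sigma> \<eta>)"
proof -
  let ?\<rho>2 = "N \<rightarrow> \<eta>" and ?\<rho>1 = "(N \<rightarrow> \<eta> \<rightarrow> \<eta>) \<rightarrow> N \<rightarrow> \<eta>"
  let ?R = "Rec_tr \<sigma> \<eta>"
  have R: "?R :| (ty_tr \<sigma> \<eta> \<rightarrow> (ty_tr \<sigma> N \<rightarrow> ty_tr \<sigma> \<eta> \<rightarrow> ty_tr \<sigma> \<eta>) \<rightarrow> ty_tr \<sigma> N \<rightarrow> ty_tr \<sigma> \<eta>)"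
    using simple by simp
  have 3: "rel \<sigma> D \<eta> (comp_app N \<eta> \<cdot> (comp_app (N \<rightarrow> \<eta> \<rightarrow> \<eta>) ?\<rho>2 \<cdot> (comp_app \<eta> ?\<rho>1 \<cdot> f \<cdot> A) \<cdot> F) \<cdot> g) (?R \<cdot> A' \<cdot> F' \<cdot> x)"
    if D: "finite D" "W \<subseteq> D"
      and A: "A :| ((N \<rightarrow> N) \<rightarrow> \<eta>)" "A' :| (ty_tr \<sigma> \<eta>)" "rel \<sigma> D \<eta> A A'"
      and F: "F :| ((N \<rightarrow> N) \<rightarrow> N \<rightarrow> \<eta> \<rightarrow> \<eta>)" "F' :| (ty_tr \<sigma> N \<rightarrow> ty_tr \<sigma> \<eta> \<rightarrow> ty_tr \<sigma> \<eta>)"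
        "rel \<sigma> D (N \<rightarrow> \<eta> \<rightarrow> \<eta>) F F'"
      and x: "g :| ValT" "x :| (ty_tr \<sigma> N)" "rel \<sigma> D N g x" for D A A' F F' g x
  proof (rule rel_iter[OF simple D(1), where q = "iter_tm \<sigma> \<eta> \<cdot> A' \<cdot> F'" and x = x])
    fix n assume "n :| N"
    with D A F f show "rel \<sigma> D \<eta> (swap_tm \<eta> \<cdot> (comp_app (N \<rightarrow> \<eta> \<rightarrow> \<eta>) ?\<rho>2 \<cdot> (comp_app \<eta> ?\<rho>1 \<cdot> f \<cdot> A) \<cdot> F) \<cdot> n)
        (iter_tm \<sigma> \<eta> \<cdot> A' \<cdot> F' \<cdot> n)"
      by (intro rel_iter_tm[OF D(1) A F]) simp_all
  next
    fix D' vs q' assume D': "finite D'" "D \<subseteq> D'" and "typed_list vs (map (ty_tr \<sigma>) (arg_types \<eta>))"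
      "q' :| (N \<rightarrow> ty_tr \<sigma> N)"
      "\<And>n. n :| N \<Longrightarrow> cls D' (q' \<cdot> n) = cls D' (apps (iter_tm \<sigma> \<eta> \<cdot> A' \<cdot> F' \<cdot> n) vs)"
    then show "cls D' (apps (?R \<cdot> A' \<cdot> F' \<cdot> x) vs) = cls D' (comp_pair \<sigma> x q')"
      by (intro Rec_tr_apps[OF D'(1) simple A(2) F(2) x(2)])
  qed (use A F x f R in simp_all)
  have 2: "rel \<sigma> D ?\<rho>2 (comp_app (N \<rightarrow> \<eta> \<rightarrow> \<eta>) ?\<rho>2 \<cdot> (comp_app \<eta> ?\<rho>1 \<cdot> f \<cdot> A) \<cdot> F) (?R \<cdot> A' \<cdot> F')"
    if D: "finite D" "W \<subseteq> D"
      and A: "A :| ((N \<rightarrow> N) \<rightarrow> \<eta>)" "A' :| (ty_tr \<sigma> \<eta>)" "rel \<sigma> D \<eta> A A'"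
      and F: "F :| ((N \<rightarrow> N) \<rightarrow> N \<rightarrow> \<eta> \<rightarrow> \<eta>)" "F' :| (ty_tr \<sigma> N \<rightarrow> ty_tr \<sigma> \<eta> \<rightarrow> ty_tr \<sigma> \<eta>)"
        "rel \<sigma> D (N \<rightarrow> \<eta> \<rightarrow> \<eta>) F F'" for D A A' F F'
  proof (subst rel_Fn[OF D(1)])
    show "\<forall>g x D'. g :| ValT \<longrightarrow> x :| (ty_tr \<sigma> N) \<longrightarrow> finite D' \<longrightarrow> D \<subseteq> D' \<longrightarrow> rel \<sigma> D' N g x \<longrightarrow>
      rel \<sigma> D' \<eta> (comp_app N \<eta> \<cdot> (comp_app (N \<rightarrow> \<eta> \<rightarrow> \<eta>) ?\<rho>2 \<cdot> (comp_app \<eta> ?\<rho>1 \<cdot> f \<cdot> A) \<cdot> F) \<cdot> g) (?R \<cdot> A' \<cdot> F' \<cdot> x)"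
      using D A F by (blast intro: 3 rel_mono)
  qed (use A F f R in simp_all)
  have 1: "rel \<sigma> D ?\<rho>1 (comp_app \<eta> ?\<rho>1 \<cdot> f \<cdot> A) (?R \<cdot> A')"
    if D: "finite D" "W \<subseteq> D"
      and A: "A :| ((N \<rightarrow> N) \<rightarrow> \<eta>)" "A' :| (ty_tr \<sigma> \<eta>)" "rel \<sigma> D \<eta> A A'" for D A A'
  proof (subst rel_Fn[OF D(1)])
    show "\<forall>F F' D'. F :| ((N \<rightarrow> N) \<rightarrow> N \<rightarrow> \<eta> \<rightarrow> \<eta>) \<longrightarrow> F' :| (ty_tr \<sigma> (N \<rightarrow> \<eta> \<rightarrow> \<eta>)) \<longrightarrow> finite D' \<longrightarrow>
      D \<subseteq> D' \<longrightarrow> rel \<sigma> D' (N \<rightarrow> \<eta> \<rightarrow> \<eta>) F F' \<longrightarrow>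
      rel \<sigma> D' ?\<rho>2 (comp_app (N \<rightarrow> \<eta> \<rightarrow> \<eta>) ?\<rho>2 \<cdot> (comp_app \<eta> ?\<rho>1 \<cdot> f \<cdot> A) \<cdot> F) (?R \<cdot> A' \<cdot> F')"
      unfolding ty_tr.simps(2) using D A by (blast intro: 2 rel_mono)
  qed (use A f R in simp_all)
  show ?thesis
    unfolding cty.simps
  proof (subst rel_Fn[OF fin])
    show "\<forall>A A' D. A :| ((N \<rightarrow> N) \<rightarrow> \<eta>) \<longrightarrow> A' :| (ty_tr \<sigma> \<eta>) \<longrightarrow> finite D \<longrightarrow> W \<subseteq> D \<longrightarrow>
      rel \<sigma> D \<eta> A A' \<longrightarrow> rel \<sigma> D ?\<rho>1 (comp_app \<eta> ?\<rho>1 \<cdot> f \<cdot> A) (?R \<cdot> A')"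
      by (blast intro: 1)
  qed (use f R in simp_all)
qed

section \<open>The fundamental lemma of the logical relation\<close>

lemma const_tr_closed:
  "T_const c \<Longrightarrow> (const_tr \<sigma> c) :| (ty_tr \<sigma> (cty c)) \<and> fv (const_tr \<sigma> c) = {}"
  by (cases c) simp_all

lemma tyof_tm_tr:
  "tyof \<Delta> t = Some \<rho> \<Longrightarrow> T_term t \<Longrightarrow> fv t \<subseteq> {alpha} \<Longrightarrow> tyof (map (ty_tr \<sigma>) \<Delta>) (tm_tr \<sigma> t) = Some (ty_tr \<sigma> \<rho>)"
proof (induction t arbitrary: \<Delta> \<rho>)
  case (Free x)
  then show ?case by (auto intro: tyof_weaken')
next
  case (Cn c)
  then show ?case using const_tr_closed[of c \<sigma>] by (auto intro: tyof_weaken')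
next
  case (App t u)
  from App.prems(1) obtain \<pi> where "tyof \<Delta> t = Some (\<pi> \<rightarrow> \<rho>)" "tyof \<Delta> u = Some \<pi>" by (rule tyof_AppE)
  with App.IH(1)[of \<Delta> "\<pi> \<rightarrow> \<rho>"] App.IH(2)[of \<Delta> \<pi>] App.prems(2,3) show ?case by simp
next
  case (Lam \<pi> t)
  then obtain \<kappa> where "tyof (\<pi> # \<Delta>) t = Some \<kappa>" "\<rho> = \<pi> \<rightarrow> \<kappa>" by auto
  with Lam.IH[of "\<pi> # \<Delta>" \<kappa>] Lam.prems(2,3) show ?case by simp
qed (auto split: if_splits)

lemma fv_tm_tr: "T_term t \<Longrightarrow> fv t \<subseteq> {alpha} \<Longrightarrow> fv (tm_tr \<sigma> t) = {}"
  using const_tr_closed by (induction t) auto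

lemma typed_list_at:
  "typed_list xs (map (Fn (N \<rightarrow> N)) \<Delta>) \<Longrightarrow> a :| (N \<rightarrow> N) \<Longrightarrow> typed_list (map (\<lambda>x. x \<cdot> a) xs) \<Delta>"
  by (auto simp: list_all2_conv_all_nth)

text \<open>Supplies \<alpha>-dependent values for the two parts of an application. A fresh variable
  takes the place of \<open>alpha\<close> and of the argument of the environment, and is then
  abstracted.\<close>

lemma ex_pointwise:
  assumes "tyof \<Delta> t = Some \<rho>" "fv t \<subseteq> {alpha}" "typed_list xs (map (Fn (N \<rightarrow> N)) \<Delta>)"
  shows "\<exists>f. f :| ((N \<rightarrow> N) \<rightarrow> \<rho>) \<and> (\<forall>W a. a :| (N \<rightarrow> N) \<longrightarrow>
    cls W (f \<cdot> a) = cls W (sub (Free(alpha := a)) (map (\<lambda>x. x \<cdot> a) xs) 0 t))"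
proof -
  obtain z where z: "z \<notin> {alpha} \<union> (\<Union>x\<in>set xs. fv x)" "snd z = N \<rightarrow> N"
    using ex_fresh[of "{alpha} \<union> (\<Union>x\<in>set xs. fv x)" "N \<rightarrow> N"] by auto
  let ?b = "sub (Free(alpha := Free z)) (map (\<lambda>x. x \<cdot> Free z) xs) 0 t"
  have b: "?b :| \<rho>"
    using assms z by (intro tyof_sub0[of _ _ \<Delta>] typed_list_at) simp_all
  have "cls W (lam z ?b \<cdot> a) = cls W (sub (Free(alpha := a)) (map (\<lambda>x. x \<cdot> a) xs) 0 t)"
    if a: "a :| (N \<rightarrow> N)" for W a
  proof -
    have "map (subst z a) (map (\<lambda>x. x \<cdot> Free z) xs) = map (\<lambda>x. x \<cdot> a) xs"
      using z by (auto simp: subst_fresh)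
    then have "subst z a ?b = sub (Free(alpha := a)) (map (\<lambda>x. x \<cdot> a) xs) 0 t"
      unfolding subst_sub by (simp only:) (use assms(2) z in \<open>auto intro!: sub_cong\<close>)
    moreover have "cls W (lam z ?b \<cdot> a) = cls W (subst z a ?b)"
      using a b z by (subst cls_eq_iff[of _ \<rho>]) (auto intro: Beta tyof_subst simp: has_type_iff simp del: cls_app)
    ultimately show ?thesis by simp
  qed
  then show ?thesis using b z by (intro exI[of _ "lam z ?b"]) auto
qed

text \<open>Loose indices stand for the bound variables: \<open>xs\<close> interprets them by
  \<alpha>-dependent objects and \<open>ys\<close> by related translated ones. Prescribing
  \<open>f\<close> only pointwise and \<open>u\<close> only up to class lets each case pick its own
  terms and return by \<open>rel_cong\<close>.\<close>

lemma rel_tm_tr: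
  assumes "finite W" "tyof \<Delta> t = Some \<rho>" "T_term t" "fv t \<subseteq> {alpha}"
    "typed_list xs (map (Fn (N \<rightarrow> N)) \<Delta>)" "typed_list ys (map (ty_tr \<sigma>) \<Delta>)"
    "\<And>i. i < length \<Delta> \<Longrightarrow> rel \<sigma> W (\<Delta> ! i) (xs ! i) (ys ! i)"
    "f :| ((N \<rightarrow> N) \<rightarrow> \<rho>)" "u :| (ty_tr \<sigma> \<rho>)"
    "\<And>a. a :| (N \<rightarrow> N) \<Longrightarrow> cls W (f \<cdot> a) = cls W (sub (Free(alpha := a)) (map (\<lambda>x. x \<cdot> a) xs) 0 t)"
    "cls W u = cls W (sub Free ys 0 (tm_tr \<sigma> t))"
  shows "rel \<sigma> W \<rho> f u"
  using assms
proof (induction t arbitrary: W \<Delta> \<rho> xs ys f u)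
  case (Free x)
  then have x: "x = alpha" and \<rho>: "\<rho> = N \<rightarrow> N" by auto
  have "cls D (f \<cdot> a) = cls D a" if "finite D" "W \<subseteq> D" "a :| (N \<rightarrow> N)" for D a
    using cls_mono[OF Free.prems(10)[OF that(3)] that(2,1)] x by simp
  then have "rel \<sigma> W (N \<rightarrow> N) f (alpha_tr \<sigma>)" using Free.prems(1,8) \<rho> by (intro rel_alpha) simp_all
  moreover have "cls W (alpha_tr \<sigma>) = cls W u" using Free.prems(11) x by (simp add: sub_closed)
  ultimately show ?case using Free.prems(8) unfolding \<rho> by (elim rel_cong) simp_all
next
  case (Bound i)
  then have i: "i < length \<Delta>" "\<Delta> ! i = \<rho>" by (auto split: if_splits)
  have len: "length xs = length \<Delta>" "length ys = length \<Delta>"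
    using list_all2_lengthD[OF Bound.prems(5)] list_all2_lengthD[OF Bound.prems(6)] by simp_all
  have ty: "(xs ! i) :| ((N \<rightarrow> N) \<rightarrow> \<rho>)" "(ys ! i) :| (ty_tr \<sigma> \<rho>)"
    using list_all2_nthD[OF Bound.prems(5), of i] list_all2_nthD[OF Bound.prems(6), of i] i len by simp_all
  have "cls W (xs ! i) = cls W f"
    by (rule cls_ext[OF Bound.prems(1) ty(1) Bound.prems(8)]) (use Bound.prems(10) i len in simp)
  moreover have "cls W (ys ! i) = cls W u" using Bound.prems(11) i len by simp
  ultimately show ?case using Bound.prems(7)[OF i(1)] ty unfolding i(2) by (elim rel_cong) simp_all
next
  case (Cn c)
  then have \<rho>: "\<rho> = cty c" and c: "T_const c" by auto
  have f: "cls D (f \<cdot> a) = cls D (Cn c)" if "finite D" "W \<subseteq> D" "a :| (N \<rightarrow> N)" for D a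
    using cls_mono[OF Cn.prems(10)[OF that(3)] that(2,1)] by simp
  have "rel \<sigma> W (cty c) f (const_tr \<sigma> c)"
  proof (cases c)
    case Zero
    then show ?thesis using f[OF Cn.prems(1) subset_refl] Cn.prems(1,8) \<rho> by (auto intro!: rel_Zero)
  next
    case Succ
    then show ?thesis using f Cn.prems(1,8) \<rho> by (auto intro!: rel_Succ)
  next
    case (Rec \<eta>)
    have "rel \<sigma> W (cty (Rec \<eta>)) f (Rec_tr \<sigma> \<eta>)"
      by (rule rel_Rec[OF _ Cn.prems(1)]) (use f Cn.prems(8) \<rho> c Rec in simp_all)
    then show ?thesis using Rec by simp
  qed (use c in simp_all)
  moreover have "cls W (const_tr \<sigma> c) = cls W u" using Cn.prems(11) const_tr_closed[OF c, of \<sigma>] by (simp add: sub_closed)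
  ultimately show ?case
    using Cn.prems(8) const_tr_closed[OF c, of \<sigma>] unfolding \<rho> by (elim rel_cong) simp_all
next
  case (App t1 t2)
  note fin = App.prems(1) and xs = App.prems(5) and ys = App.prems(6)
  from App.prems(2) obtain \<pi> where ty: "tyof \<Delta> t1 = Some (\<pi> \<rightarrow> \<rho>)" "tyof \<Delta> t2 = Some \<pi>" by (rule tyof_AppE)
  have T: "T_term t1" "T_term t2" and fv: "fv t1 \<subseteq> {alpha}" "fv t2 \<subseteq> {alpha}" using App.prems(3,4) by auto
  obtain f1 where f1: "f1 :| ((N \<rightarrow> N) \<rightarrow> \<pi> \<rightarrow> \<rho>)"
    "\<And>W a. a :| (N \<rightarrow> N) \<Longrightarrow> cls W (f1 \<cdot> a) = cls W (sub (Free(alpha := a)) (map (\<lambda>x. x \<cdot> a) xs) 0 t1)"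
    using ex_pointwise[OF ty(1) fv(1) xs] by blast
  obtain f2 where f2: "f2 :| ((N \<rightarrow> N) \<rightarrow> \<pi>)"
    "\<And>W a. a :| (N \<rightarrow> N) \<Longrightarrow> cls W (f2 \<cdot> a) = cls W (sub (Free(alpha := a)) (map (\<lambda>x. x \<cdot> a) xs) 0 t2)"
    using ex_pointwise[OF ty(2) fv(2) xs] by blast
  let ?u1 = "sub Free ys 0 (tm_tr \<sigma> t1)" and ?u2 = "sub Free ys 0 (tm_tr \<sigma> t2)"
  have u: "?u1 :| (ty_tr \<sigma> (\<pi> \<rightarrow> \<rho>))" "?u2 :| (ty_tr \<sigma> \<pi>)"
    using tyof_sub0[OF okt_Free ys] tyof_tm_tr[OF ty(1) T(1) fv(1)] tyof_tm_tr[OF ty(2) T(2) fv(2)] by blast+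
  have "rel \<sigma> W (\<pi> \<rightarrow> \<rho>) f1 ?u1"
    by (rule App.IH(1)[OF fin ty(1) T(1) fv(1) xs ys App.prems(7) f1(1) u(1) f1(2) refl])
  moreover have "rel \<sigma> W \<pi> f2 ?u2"
    by (rule App.IH(2)[OF fin ty(2) T(2) fv(2) xs ys App.prems(7) f2(1) u(2) f2(2) refl])
  ultimately have "rel \<sigma> W \<rho> (comp_app \<pi> \<rho> \<cdot> f1 \<cdot> f2) (?u1 \<cdot> ?u2)"
    using fin f1(1) f2(1) u by (subst (asm) rel_Fn) auto
  moreover have "cls W (comp_app \<pi> \<rho> \<cdot> f1 \<cdot> f2) = cls W f"
  proof (rule cls_ext[OF fin _ App.prems(8)])
    fix a assume a: "a :| (N \<rightarrow> N)"
    show "cls W (comp_app \<pi> \<rho> \<cdot> f1 \<cdot> f2 \<cdot> a) = cls W (f \<cdot> a)"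
      unfolding App.prems(10)[OF a] using f1(2)[OF a, of W] f2(2)[OF a, of W] fin f1(1) f2(1) a by simp
  qed (use f1(1) f2(1) in simp)
  moreover have "cls W (?u1 \<cdot> ?u2) = cls W u" using App.prems(11) by simp
  ultimately show ?case using f1(1) f2(1) u by (elim rel_cong) simp_all
next
  case (Lam \<pi> t)
  note fin = Lam.prems(1) and xs = Lam.prems(5) and ys = Lam.prems(6)
  obtain \<kappa> where ty: "tyof (\<pi> # \<Delta>) t = Some \<kappa>" and \<rho>: "\<rho> = \<pi> \<rightarrow> \<kappa>" using Lam.prems(2) by auto
  have T: "T_term t" and fv: "fv t \<subseteq> {alpha}" using Lam.prems(3,4) by auto
  note ty' = tyof_tm_tr[OF ty T fv, of \<sigma>, simplified]
  have "rel \<sigma> D \<kappa> (comp_app \<pi> \<kappa> \<cdot> f \<cdot> x) (u \<cdot> y)"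
    if x: "x :| ((N \<rightarrow> N) \<rightarrow> \<pi>)" and y: "y :| (ty_tr \<sigma> \<pi>)" and D: "finite D" "W \<subseteq> D" and xy: "rel \<sigma> D \<pi> x y"
    for x y D
  proof (rule Lam.IH[OF D(1) ty T fv, where xs = "x # xs" and ys = "y # ys"])
    show "rel \<sigma> D ((\<pi> # \<Delta>) ! i) ((x # xs) ! i) ((y # ys) ! i)" if "i < length (\<pi> # \<Delta>)" for i
      using that xy rel_mono[OF Lam.prems(7) D(2,1)] by (cases i) auto
  next
    fix a assume a: "a :| (N \<rightarrow> N)"
    have "cls D (comp_app \<pi> \<kappa> \<cdot> f \<cdot> x \<cdot> a) = app D (cls D (f \<cdot> a)) (cls D (x \<cdot> a))"
      using D x a Lam.prems(8) \<rho> by simp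
    also have "cls D (f \<cdot> a) = cls D (sub (Free(alpha := a)) (map (\<lambda>x. x \<cdot> a) xs) 0 (Lam \<pi> t))"
      by (rule cls_mono[OF Lam.prems(10)[OF a] D(2,1)])
    also have "app D \<dots> (cls D (x \<cdot> a)) = cls D (sub (Free(alpha := a)) (x \<cdot> a # map (\<lambda>x. x \<cdot> a) xs) 0 t)"
      by (rule cls_beta[OF _ typed_list_at[OF xs a] ty]) (use a x in simp_all)
    finally show "cls D (comp_app \<pi> \<kappa> \<cdot> f \<cdot> x \<cdot> a) = cls D (sub (Free(alpha := a)) (map (\<lambda>x. x \<cdot> a) (x # xs)) 0 t)" by simp
  next
    have "cls D (u \<cdot> y) = app D (cls D (sub Free ys 0 (Lam (ty_tr \<sigma> \<pi>) (tm_tr \<sigma> t)))) (cls D y)"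
      using cls_mono[OF Lam.prems(11) D(2,1)] by simp
    also have "\<dots> = cls D (sub Free (y # ys) 0 (tm_tr \<sigma> t))"
      by (rule cls_beta[OF okt_Free ys ty' y])
    finally show "cls D (u \<cdot> y) = cls D (sub Free (y # ys) 0 (tm_tr \<sigma> t))" .
  qed (use x y xs ys Lam.prems(8,9) \<rho> in simp_all)
  then show ?case unfolding \<rho> using fin Lam.prems(8,9) \<rho> by (subst rel_Fn) auto
qed


section \<open>The theorem from the relation in the empty world\<close>

lemma subst_eq_sub: "subst x u t = sub (Free(x := u)) [] 0 t"
  using subst_sub[of x u Free "[]" 0 t] by (auto intro!: sub_cong)

text \<open>The fundamental lemma with empty environments at type \<open>N\<close>; a single
  \<beta>-step shows that \<open>lam alpha t\<close> has the required values.\<close>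

lemma closed_good:
  assumes "T_term t" "t :| N" "fv t \<subseteq> {alpha}"
  shows "cls {} (lam alpha t) = cls {} (Val \<sigma> (tm_tr \<sigma> t))"
    and "good \<sigma> {} (chi \<sigma> \<cdot> tm_tr \<sigma> t) (Val \<sigma> (tm_tr \<sigma> t)) (BB \<sigma> (tm_tr \<sigma> t))"
proof -
  have T: "(tm_tr \<sigma> t) :| (ty_tr \<sigma> N)" using tyof_tm_tr[OF assms(2,1,3)] by simp
  have "rel \<sigma> {} N (lam alpha t) (tm_tr \<sigma> t)"
  proof (rule rel_tm_tr[OF _ assms(2,1,3), where xs = "[]" and ys = "[]"])
    fix a assume a: "a :| (N \<rightarrow> N)"
    have "{} \<turnstile> lam alpha t \<cdot> a \<doteq> subst alpha a t" by (rule Beta) (use a assms(2) in \<open>simp_all add: has_type_iff\<close>)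
    moreover have "(subst alpha a t) :| N" by (rule tyof_subst) (use a assms(2) in simp_all)
    ultimately show "cls {} (lam alpha t \<cdot> a) = cls {} (sub (Free(alpha := a)) (map (\<lambda>x. x \<cdot> a) []) 0 t)"
      using a assms(2) by (subst cls_eq_iff[of _ N]) (simp_all add: subst_eq_sub)
  qed (use assms(2) T in simp_all)
  then show "cls {} (lam alpha t) = cls {} (Val \<sigma> (tm_tr \<sigma> t))"
    "good \<sigma> {} (chi \<sigma> \<cdot> tm_tr \<sigma> t) (Val \<sigma> (tm_tr \<sigma> t)) (BB \<sigma> (tm_tr \<sigma> t))"
    using T assms(2) by (simp_all add: rel_N)
qed

theorem theorem3p4:
  fixes \<sigma> :: ty and t :: tm
  assumes "T_term t" and "t \<Colon> N" and "fv t \<subseteq> {alpha}"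
  shows "\<exists>S. wff S \<and> ffv S \<subseteq> {seqv} \<and>
    {} \<turnstile> Conj (bar S) (Conj (secures S (lam alpha t)) (GBR \<sigma> S (BB \<sigma> (tm_tr \<sigma> t))))"
proof -
  have t: "t :| N" using assms(2) by (simp add: has_type_iff)
  let ?T = "tm_tr \<sigma> t"
  let ?\<chi> = "chi \<sigma> \<cdot> ?T"
  define S where "S = (?\<chi> \<cdot> Free seqv \<doteq> Cn Zero)"
  have T [simp]: "?T :| (ty_tr \<sigma> N)" "fv ?T = {}"
    using tyof_tm_tr[OF t assms(1,3)] fv_tm_tr[OF assms(1,3)] by simp_all
  have [simp]: "snd seqv = Seq N" by (simp add: seqv_def)
  have wff [simp]: "wff S" by (simp add: S_def has_type_iff)
  have ffv: "ffv S \<subseteq> {seqv}" by (simp add: S_def)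
  note eq = closed_good(1)[OF assms(1) t assms(3), of \<sigma>] and g = closed_good(2)[OF assms(1) t assms(3), of \<sigma>]
  have sem_T [simp]: "sem D \<rho> ?T = cls D ?T" if "finite D" "okv D \<rho>" for D \<rho> e
    using that by (simp add: sem_closed)
  have S: "sat D \<theta> S \<longleftrightarrow> cls D (?\<chi> \<cdot> \<theta> seqv) = cls D (Cn Zero)" if "finite D" "okt \<theta>" for D \<theta>
    using that by (simp add: S_def env_def)
  let ?a = "(''a'', N \<rightarrow> N)" and ?n = "(''n'', N)" and ?t = "(''t'', Seq N)" and ?b = "(''b'', N \<rightarrow> N)"
    and ?G = "(''G'', GT \<sigma>)" and ?H = "(''H'', HT \<sigma>)" and ?x = "(''x'', N)"
  have ne: "seqv \<noteq> ?a" "seqv \<noteq> ?n" "seqv \<noteq> ?t" "seqv \<noteq> ?b" "seqv \<noteq> ?G" "seqv \<noteq> ?H" "seqv \<noteq> ?x"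
    "?a \<noteq> seqv" "?n \<noteq> seqv" "?t \<noteq> seqv" "?b \<noteq> seqv" "?G \<noteq> seqv" "?H \<noteq> seqv" "?x \<noteq> seqv"
    by (simp_all add: seqv_def)
  have Neg: "sat D \<theta> (Neg S)" if D: "finite D" "okt \<theta>" "m :| N" "cls D (?\<chi> \<cdot> \<theta> seqv) = cls D (Cn Succ \<cdot> m)" for D \<theta> m
  proof -
    have "sat D' \<theta> Bot" if "finite D'" "D \<subseteq> D'" "sat D' \<theta> S" for D'
    proof -
      have "cls D' (Cn Zero) = cls D' (Cn Succ \<cdot> m)"
        using S[OF that(1) D(2)] that(3) cls_mono[OF D(4) that(2,1)] by simp
      then show ?thesis unfolding sat_def by (rule cls_Zero_Succ) (use D in simp_all)
    qed
    then show ?thesis using D by simp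
  qed
  \<comment> \<open>Membership says that a number is zero, and \<open>num_cases\<close> decides
    this; a successor refutes it.\<close>
  have decidable: "sat {} Free (all seqv (Disj S (Neg S)))"
  proof -
    have "sat {} (Free(seqv := u)) (Disj S (Neg S))" if u: "u :| (Seq N)" for u
      unfolding sat_def
    proof (rule num_cases[of "{}" "?\<chi> \<cdot> u"])
      fix D assume "finite D" "cls D (?\<chi> \<cdot> u) = cls D (Cn Zero)"
      then have "sat D (Free(seqv := u)) (Disj S (Neg S))" using u by (intro sat_DisjI) (simp_all add: S)
      then show "D \<turnstile> fsub (Free(seqv := u)) [] 0 (Disj S (Neg S))" unfolding sat_def .
    next
      fix D m assume D: "finite D" "m :| N" "cls D (?\<chi> \<cdot> u) = cls D (Cn Succ \<cdot> m)"
      have "sat D (Free(seqv := u)) (Neg S)" by (rule Neg[OF D(1) _ D(2)]) (use D u in simp_all)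
      then have "sat D (Free(seqv := u)) (Disj S (Neg S))" using u by (intro sat_DisjI disjI2) simp_all
      then show "D \<turnstile> fsub (Free(seqv := u)) [] 0 (Disj S (Neg S))" unfolding sat_def .
    qed (use u in simp_all)
    then show ?thesis by simp
  qed
  have barred: "sat {} Free (all ?a (ex ?n (fsubst seqv (initial \<cdot> Free ?a \<cdot> Free ?n) S)))"
  proof -
    let ?A = "fsubst seqv (initial \<cdot> Free ?a \<cdot> Free ?n) S"
    have "sat {} (Free(?a := a)) (ex ?n ?A)" if a: "a :| (N \<rightarrow> N)" for a
      unfolding sat_def
    proof (rule good.bar[OF g _ _ a])
      fix D n assume D: "finite D" "n :| N" "cls D (?\<chi> \<cdot> (initial \<cdot> a \<cdot> n)) = cls D (Cn Zero)"
      have "sat D (Free(?a := a, ?n := n)) ?A" using D a ne by (simp add: S sub_closed)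
      then have "sat D (Free(?a := a)) (ex ?n ?A)" by (intro sat_exI[of _ _ n]) (use D a in simp_all)
      then show "D \<turnstile> fsub (Free(?a := a)) [] 0 (ex ?n ?A)" unfolding sat_def .
    qed simp_all
    then show ?thesis by simp
  qed
  \<comment> \<open>Goodness gives stability under one further entry only; induction on the appended
    sequence gives full monotonicity.\<close>
  have append: "cls D (?\<chi> \<cdot> (append \<cdot> s \<cdot> u)) = cls D (Cn Zero)"
    if D: "finite D" and s: "s :| (Seq N)" "cls D (?\<chi> \<cdot> s) = cls D (Cn Zero)" and u: "u :| (Seq N)" for D s u
  proof -
    let ?A = "fsubst seqv (append \<cdot> Free seqv \<cdot> Free ?t) S"
    have A: "sat D' (Free(seqv := s, ?t := u)) ?A \<longleftrightarrow> cls D' (?\<chi> \<cdot> (append \<cdot> s \<cdot> u)) = cls D' (Cn Zero)"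
      if "finite D'" "u :| (Seq N)" for D' u
      using that s(1) ne by (simp add: S sub_closed)
    have "sat D (Free(seqv := s, ?t := u)) ?A"
    proof (rule sat_seq_induct)
      show "sat D (Free(seqv := s, ?t := Cn (Empty N))) ?A" using D s by (subst A) simp_all
    next
      fix D' u x assume D': "finite D'" "D \<subseteq> D'" "u :| (Seq N)" "x :| N" "sat D' (Free(seqv := s, ?t := u)) ?A"
      then have "cls D' (?\<chi> \<cdot> (append \<cdot> s \<cdot> u)) = cls D' (Cn Zero)" by (subst (asm) A) simp_all
      from good.monotone[OF g D'(1) _ _ D'(4) this]
      show "sat D' (Free(seqv := s, ?t := Cn (Snoc N) \<cdot> u \<cdot> x)) ?A" using D' s by (subst A) simp_all
    qed (use D s u in simp_all)
    then show ?thesis using D u by (subst (asm) A) simp_all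
  qed
  have bar: "sat {} Free (bar S)"
  proof -
    have "sat {} Free (all seqv (all ?t (Imp S (fsubst seqv (append \<cdot> Free seqv \<cdot> Free ?t) S))))"
      using append ne by (simp add: S sub_closed del: cls_app)
    then show ?thesis using decidable barred by (simp add: bar_def Let_def del: sat_all)
  qed
  have secures: "sat {} Free (secures S (lam alpha t))"
  proof -
    let ?A = "all ?b (lam alpha t \<cdot> (prepend \<cdot> Free seqv \<cdot> Free ?b) \<doteq> Free ?n)"
    have wff: "wff ?A" using t by (intro wff_all) (simp add: has_type_iff)
    have "sat D (Free(seqv := s)) (ex ?n ?A)"
      if D: "finite D" and s: "s :| (Seq N)" "cls D (?\<chi> \<cdot> s) = cls D (Cn Zero)" for D s
    proof (rule sat_exI[OF _ wff])
      have "sem D \<rho> (lam alpha t) = cls D (lam alpha t)" if "okv D \<rho>" for \<rho>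
        using assms(3) t D that by (intro sem_closed) auto
      moreover have "cls D (lam alpha t) = cls D (Val \<sigma> ?T)" using cls_mono[OF eq _ D] by simp
      ultimately have "sat D (Free(seqv := s, ?n := Val \<sigma> ?T \<cdot> (hat \<cdot> s), ?b := b))
          (lam alpha t \<cdot> (prepend \<cdot> Free seqv \<cdot> Free ?b) \<doteq> Free ?n)"
        if b: "b :| (N \<rightarrow> N)" for b
        using good.secures[OF g D _ s(1) b s(2)] D s b t ne by (simp add: env_def)
      \<comment> \<open>The constant value is the one taken at \<open>s\<close> continued by
        zeros.\<close>
      then show "sat D (Free(seqv := s, ?n := Val \<sigma> ?T \<cdot> (hat \<cdot> s))) ?A"
        using D s t by (subst sat_all) (simp_all add: has_type_iff)
    qed (use s in simp_all)
    then show ?thesis using wff by (simp add: secures_def Let_def S)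
  qed
  have GBR: "sat {} Free (GBR \<sigma> S (BB \<sigma> ?T))"
  proof -
    let ?B = "BB \<sigma> ?T \<cdot> Free ?G \<cdot> Free ?H"
    let ?L = "lam ?x (?B \<cdot> (snoc \<cdot> Free seqv \<cdot> Free ?x))"
    let ?\<theta> = "\<lambda>G H s. Free(?G := G, ?H := H, seqv := s)"
    have stop: "cls D (BB \<sigma> ?T \<cdot> G \<cdot> H \<cdot> s) = cls D (G \<cdot> s)"
      if "finite D" "G :| (GT \<sigma>)" "H :| (HT \<sigma>)" "s :| (Seq N)" "sat D (?\<theta> G H s) S" for D G H s
      using that good.stop[OF g that(1) _ that(2-4)] by (simp add: S)
    have continue: "cls D (BB \<sigma> ?T \<cdot> G \<cdot> H \<cdot> s) = app D (cls D (H \<cdot> s)) (sem D (env D (?\<theta> G H s)) ?L)"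
      if ty: "finite D" "G :| (GT \<sigma>)" "H :| (HT \<sigma>)" "s :| (Seq N)" and neg: "sat D (?\<theta> G H s) (Neg S)"
      for D G H s
    proof -
      \<comment> \<open>The continuation in the bar recursion equation is an abstraction with free
        variables; its value is the combinator used in \<open>good\<close>.\<close>
      have "sem D (env D (?\<theta> G H s)) ?L = cls D (shift \<sigma> \<cdot> (BB \<sigma> ?T \<cdot> G \<cdot> H) \<cdot> s)"
        unfolding cls_app[of _ "shift \<sigma> \<cdot> (BB \<sigma> ?T \<cdot> G \<cdot> H)"] cls_app[of _ "shift \<sigma>"]
        by (rule eq_shift) (use ty ne in \<open>simp_all add: env_def\<close>)
      moreover have "cls D (BB \<sigma> ?T \<cdot> G \<cdot> H \<cdot> s) = cls D (H \<cdot> s \<cdot> (shift \<sigma> \<cdot> (BB \<sigma> ?T \<cdot> G \<cdot> H) \<cdot> s))"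
      proof (rule num_cases_eq[OF ty(1), of "?\<chi> \<cdot> s" _ \<sigma>])
        fix D' assume D': "finite D'" "D \<subseteq> D'" "cls D' (?\<chi> \<cdot> s) = cls D' (Cn Zero)"
        \<comment> \<open>Where the test gives zero the assumed negation is contradicted, and the
          equation follows from falsity.\<close>
        then have "sat D' (?\<theta> G H s) S" using ty by (simp add: S)
        then have "sat D' (?\<theta> G H s) Bot" using neg D' ty by simp
        then have "D' \<turnstile> Bot" by (simp add: sat_def)
        then have "D' \<turnstile> BB \<sigma> ?T \<cdot> G \<cdot> H \<cdot> s \<doteq> H \<cdot> s \<cdot> (shift \<sigma> \<cdot> (BB \<sigma> ?T \<cdot> G \<cdot> H) \<cdot> s)"
          by (rule BotE) (use ty in \<open>simp add: has_type_iff\<close>)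
        then show "cls D' (BB \<sigma> ?T \<cdot> G \<cdot> H \<cdot> s) = cls D' (H \<cdot> s \<cdot> (shift \<sigma> \<cdot> (BB \<sigma> ?T \<cdot> G \<cdot> H) \<cdot> s))"
          using ty by (subst cls_eq_iff[of _ \<sigma>]) simp_all
      next
        fix D' m assume "finite D'" "D \<subseteq> D'" "m :| N" "cls D' (?\<chi> \<cdot> s) = cls D' (Cn Succ \<cdot> m)"
        then show "cls D' (BB \<sigma> ?T \<cdot> G \<cdot> H \<cdot> s) = cls D' (H \<cdot> s \<cdot> (shift \<sigma> \<cdot> (BB \<sigma> ?T \<cdot> G \<cdot> H) \<cdot> s))"
          using ty by (intro good.continue[OF g]) simp_all
      qed (use ty in simp_all)
      ultimately show ?thesis by simp
    qed
    have tyL: "?L :| (N \<rightarrow> \<sigma>)" by simp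
    have "sat {} (?\<theta> G H s) (Conj (Imp S (?B \<cdot> Free seqv \<doteq> Free ?G \<cdot> Free seqv))
        (Imp (Neg S) (?B \<cdot> Free seqv \<doteq> Free ?H \<cdot> Free seqv \<cdot> ?L)))"
      if ty: "G :| (GT \<sigma>)" "H :| (HT \<sigma>)" "s :| (Seq N)" for G H s
    proof -
      have "sat D (?\<theta> G H s) (?B \<cdot> Free seqv \<doteq> Free ?G \<cdot> Free seqv)"
        if "finite D" "sat D (?\<theta> G H s) S" for D
        using stop[OF that(1) ty that(2)] that(1) ty ne by (simp add: env_def)
      moreover have "sat D (?\<theta> G H s) (?B \<cdot> Free seqv \<doteq> Free ?H \<cdot> Free seqv \<cdot> ?L)"
        if "finite D" "sat D (?\<theta> G H s) (Neg S)" for D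
        using continue[OF that(1) ty that(2)] that(1) ty tyL ne by (simp add: env_def)
      moreover have "okt (?\<theta> G H s)" "wff (Neg S)" using ty by simp_all
      ultimately show ?thesis by (subst sat_Conj, subst (1 2) sat_Imp) (simp_all del: sat_Imp sat_Eq)
    qed
    then show ?thesis
      unfolding GBR_def Let_def by (simp add: has_type_iff del: sat_Imp sat_Eq sat_Conj)
  qed
  have "{} \<turnstile> Conj (bar S) (Conj (secures S (lam alpha t)) (GBR \<sigma> S (BB \<sigma> ?T)))"
    unfolding sat_Free[symmetric] using bar secures GBR by simp
  then show ?thesis using wff ffv by blast
qed


end
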